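(* Let $(X,\mu,(T_n)_{n\in\mathbb Z})$ be the infinite Chacon system, let $d>1$, and let $\lambda$ be a (nonzero) ergodic $(T_1)^{\times d}$-invariant Radon measure on $X^d$. Then there is a partition of $\{1,\dots,d\}$ into subsets $J_1,\dots,J_k$ such that $\lambda$ splits into the direct product of its marginals $\lambda_i$ on $X^{J_i}$, where each $\lambda_i$ is, up to a multiplicative constant, either $\mu$ if $\#J_i=1$, or an invariant quasi-graph Radon measure on $X^{J_i}$ if $\#J_i>1$.
   Context: **The infinite Chacon system.** Put $h_0:=1$, $h_{n+1}:=6h_n+1$ for $n\ge 0$, and for $n\ge 0$ $$F_n:=\left\{-\tfrac{h_n-1}2,-\tfrac{h_n-3}2,\dots,\tfrac{h_n-1}2\right\}\subset\mathbb Z,\qquad C_{n+1}:=\{-h_n,0,h_n+1\}.$$ Let $X_n:=F_n\times C_{n+1}\times C_{n+2}\times\cdots$ with the product topology. The map $(f_n,c_{n+1},c_{n+2},\dots)\mapsto(f_n+c_{n+1},c_{n+2},\dots)$ is a topological embedding $X_n\to X_{n+1}$, by which $X_n$ is regarded as a (compact open) subset of $X_{n+1}$; $X=\bigcup_n X_n$ is the inductive limit, a locally compact non-compact Cantor space. For $f\in F_n$ let $[f]_n:=\{(f_n,c_{n+1},\dots)\in X_n: f_n=f\}$. For $g\in\mathbb Z$ and $x\in X$, for all large $n$ one has $x=(f_n,c_{n+1},\dots)\in X_n$ with $g+f_n\in F_n$, and $T_gx:=(g+f_n,c_{n+1},\dots)\in X_n$; this is a well-defined free continuous $\mathbb Z$-action.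 $\mu$ is the unique Borel measure on $X$ with $\mu([f]_n)=3^{-n}$ for all $f\in F_n$, $n\ge0$. A measure is Radon if it is finite on compact sets. **Quasi-graph measures.** Let $J\subset\mathbb N=\{1,2,\dots\}$ and let $\alpha=(\alpha_n)_{n\in\mathbb N\setminus J}$ with $\alpha_n\in C_n$. Put $C_n^\alpha:=C_n$ if $n\in J$ and $C_n^\alpha:=\{\alpha_n\}$ if $n\notin J$. Let $X^\alpha_n:=F_n\times C^\alpha_{n+1}\times C^\alpha_{n+2}\times\cdots$ with the product topology, regarded as a subset of $X^\alpha_{n+1}$ via the embedding $(f_n,c_{n+1},c_{n+2},\dots)\mapsto(f_n+c_{n+1},c_{n+2},\dots)$, and let $X^\alpha=\bigcup_nX_n^\alpha$ be the inductive limit. The $\mathbb Z$-action $T^\alpha=(T^\alpha_g)_{g\in\mathbb Z}$ on $X^\alpha$ is defined by $T^\alpha_gx:=(g+f_n,c_{n+1},\dots)\in X^\alpha_n$ whenever $x=(f_n,c_{n+1},\dots)\in X^\alpha_n$ with $g+f_n\in F_n$ (which holds for all large $n$). Let $\mu^\alpha$ be the unique Borel measure on $X^\alpha$ giving mass $(\#C_1^\alpha\cdots\#C_n^\alpha)^{-1}$ to each set $\{(f_n,c_{n+1},\dots)\in X_n^\alpha: f_n=f\}$, $f\in F_n$, $n\ge0$. Let $\phi_\alpha:X^\alpha\to X$ be the injective continuous equivariant map sending $(f_n,c_{n+1},\dots)\in X_n^\alpha$ to $(f_n,c_{n+1},\dots)\in X_n$. For another sequence $\beta=(\beta_n)_{n\notin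 J}$, $\beta_n\in C_n$ (same $J$), let $\phi_{\beta,\alpha}:X^\alpha\to X^\beta$ be the equivariant homeomorphism defined as follows: if $x\in X_{n-1}^\alpha$, $n>0$, has expansion $(f_n,c_{n+1},c_{n+2},\dots)$ in $X_n^\alpha$, then $\phi_{\beta,\alpha}(x):=(\widetilde f_n,\widetilde c_{n+1},\widetilde c_{n+2},\dots)\in X_n^\beta$, where $\widetilde f_n:=f_n+\sum_{j\le n,\,j\notin J}(\beta_j-\alpha_j)$ and, for $l>n$, $\widetilde c_l:=c_l$ if $l\in J$ and $\widetilde c_l:=\beta_l$ if $l\notin J$. Given $d>1$, a subset $J\subset\mathbb N$, and sequences $\alpha^{(i)}=(\alpha^{(i)}_n)_{n\in\mathbb N\setminus J}$ with $\alpha^{(i)}_n\in C_n$ for all $n\in\mathbb N\setminus J$, $i=1,\dots,d$ (the same $J$ for all $i$), define $\psi_{\alpha^{(1)},\dots,\alpha^{(d)}}:X^{\alpha^{(1)}}\to X^d$ by $$\psi_{\alpha^{(1)},\dots,\alpha^{(d)}}(x):=\big(\phi_{\alpha^{(1)}}(x),\phi_{\alpha^{(2)}}(\phi_{\alpha^{(2)},\alpha^{(1)}}(x)),\dots,\phi_{\alpha^{(d)}}(\phi_{\alpha^{(d)},\alpha^{(1)}}(x))\big).$$ For integers $k_1,\dots,k_{d-1}$, the measure on $X^d$ obtained by pushing $\mu^{\alpha^{(1)}}$ forward by $\psi_{\alpha^{(1)},\dots,\alpha^{(d)}}$ and then by $\mathrm{Id}\times T_{k_1}\times\cdots\times T_{k_{d-1}}$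 is called a quasi-graph measure. It is $(T_1)^{\times d}$-invariant. A quasi-graph Radon measure is a quasi-graph measure which is Radon on $X^d$. *)

theory Defs
  imports "HOL-Analysis.Analysis"
begin

primrec chacon_h :: "nat \<Rightarrow> int" where
  "chacon_h 0 = 1"
| "chacon_h (Suc n) = 6 * chacon_h n + 1"

text \<open>Every \<open>chacon_h n\<close> is odd, so the division is exact.\<close>
definition chacon_F :: "nat \<Rightarrow> int set" where
  "chacon_F n = {- ((chacon_h n - 1) div 2) .. (chacon_h n - 1) div 2}"

text \<open>Only the values at indices \<open>n \<ge> 1\<close> are ever used.\<close>
definition chacon_C :: "nat \<Rightarrow> int set" where
  "chacon_C n = {- chacon_h (n - 1), 0, chacon_h (n - 1) + 1}"

definition quasi_C :: "nat set \<Rightarrow> (nat \<Rightarrow> int) \<Rightarrow> nat \<Rightarrow> int set" where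
  "quasi_C J \<alpha> n = (if n \<in> J then chacon_C n else {\<alpha> n})"

text \<open>The construction of \<open>X\<close> and of \<open>X\<^sup>\<alpha>\<close> is the same, with cut sets
  \<open>D = chacon_C\<close> and \<open>D = quasi_C J \<alpha>\<close> respectively, so it is done once for an arbitrary
  family \<open>D\<close> of cut sets (\<open>D k \<subseteq> chacon_C k\<close>).
  The level \<open>X\<^sub>n = F\<^sub>n \<times> D\<^sub>n\<^sub>+\<^sub>1 \<times> D\<^sub>n\<^sub>+\<^sub>2 \<times> \<dots>\<close> consists of pairs \<open>(f, c)\<close> where \<open>c\<close> is an
  extensional function on \<open>{n<..}\<close>.\<close>

definition cf_level :: "(nat \<Rightarrow> int set) \<Rightarrow> nat \<Rightarrow> (int \<times> (nat \<Rightarrow> int)) set" where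
  "cf_level D n = chacon_F n \<times> PiE {n<..} D"

definition cf_level_top :: "(nat \<Rightarrow> int set) \<Rightarrow> nat \<Rightarrow> (int \<times> (nat \<Rightarrow> int)) topology" where
  "cf_level_top D n =
     prod_topology (discrete_topology (chacon_F n))
       (product_topology (\<lambda>k. discrete_topology (D k)) {n<..})"

definition cf_emb :: "nat \<Rightarrow> int \<times> (nat \<Rightarrow> int) \<Rightarrow> int \<times> (nat \<Rightarrow> int)" where
  "cf_emb n = (\<lambda>(f, c). (f + c (Suc n), restrict c {Suc n<..}))"

primrec cf_push :: "nat \<Rightarrow> nat \<Rightarrow> int \<times> (nat \<Rightarrow> int) \<Rightarrow> int \<times> (nat \<Rightarrow> int)" where
  "cf_push n 0 p = p"
| "cf_push n (Suc i) p = cf_emb (n + i) (cf_push n i p)"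

text \<open>The inductive limit is the set of classes of pairs \<open>(n, p)\<close> with \<open>p \<in> X\<^sub>n\<close>, two
  pairs being identified when they have the same image in some common later level.\<close>

type_synonym cf_point = "(nat \<times> int \<times> (nat \<Rightarrow> int)) set"

definition cf_rel ::
  "(nat \<Rightarrow> int set) \<Rightarrow> ((nat \<times> int \<times> (nat \<Rightarrow> int)) \<times> (nat \<times> int \<times> (nat \<Rightarrow> int))) set" where
  "cf_rel D = {((n, p), (m, q)). p \<in> cf_level D n \<and> q \<in> cf_level D m \<and>
                 (\<exists>i j. n + i = m + j \<and> cf_push n i p = cf_push m j q)}"

definition cf_space :: "(nat \<Rightarrow> int set) \<Rightarrow> cf_point set" where
  "cf_space D = (SIGMA n:UNIV. cf_level D n) // cf_rel D"

definition cf_pt :: "(nat \<Rightarrow> int set) \<Rightarrow> nat \<Rightarrow> int \<times> (nat \<Rightarrow> int) \<Rightarrow> cf_point" where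
  "cf_pt D n p = cf_rel D `` {(n, p)}"

definition cf_top :: "(nat \<Rightarrow> int set) \<Rightarrow> cf_point topology" where
  "cf_top D = topology (\<lambda>U. U \<subseteq> cf_space D \<and>
     (\<forall>n. openin (cf_level_top D n) {p \<in> cf_level D n. cf_pt D n p \<in> U}))"

lemma topspace_cf_level_top: "topspace (cf_level_top D n) = cf_level D n"
  by (simp add: cf_level_top_def cf_level_def)

lemma openin_cf_top:
  "openin (cf_top D) U \<longleftrightarrow> U \<subseteq> cf_space D \<and>
     (\<forall>n. openin (cf_level_top D n) {p \<in> cf_level D n. cf_pt D n p \<in> U})"
proof -
  have "istopology (\<lambda>U. U \<subseteq> cf_space D \<and>
     (\<forall>n. openin (cf_level_top D n) {p \<in> cf_level D n. cf_pt D n p \<in> U}))"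
    unfolding istopology_def
  proof (intro conjI allI impI, goal_cases)
    case (2 S T n)
    have "{p \<in> cf_level D n. cf_pt D n p \<in> S \<inter> T} =
        {p \<in> cf_level D n. cf_pt D n p \<in> S} \<inter> {p \<in> cf_level D n. cf_pt D n p \<in> T}"
      by blast
    with 2 show ?case by (simp add: openin_Int)
  next
    case (4 \<K> n)
    have "{p \<in> cf_level D n. cf_pt D n p \<in> \<Union>\<K>} =
        (\<Union>K\<in>\<K>. {p \<in> cf_level D n. cf_pt D n p \<in> K})"
      by blast
    with 4 show ?case by auto
  qed blast+
  then show ?thesis by (simp add: cf_top_def)
qed

definition cf_cyl :: "(nat \<Rightarrow> int set) \<Rightarrow> nat \<Rightarrow> int \<Rightarrow> cf_point set" where
  "cf_cyl D n f = cf_pt D n ` {p \<in> cf_level D n. fst p = f}"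

definition cf_T :: "(nat \<Rightarrow> int set) \<Rightarrow> int \<Rightarrow> cf_point \<Rightarrow> cf_point" where
  "cf_T D g x = (THE y. \<exists>n f c. (f, c) \<in> cf_level D n \<and> g + f \<in> chacon_F n \<and>
                   x = cf_pt D n (f, c) \<and> y = cf_pt D n (g + f, c))"

definition borel_of :: "'a topology \<Rightarrow> 'a measure" where
  "borel_of X = sigma (topspace X) {U. openin X U}"

definition cf_measure :: "(nat \<Rightarrow> int set) \<Rightarrow> cf_point measure" where
  "cf_measure D = (THE M. sets M = sets (borel_of (cf_top D)) \<and>
     (\<forall>n. \<forall>f\<in>chacon_F n. emeasure M (cf_cyl D n f) = ennreal (1 / (\<Prod>k=1..n. real (card (D k))))))"

abbreviation chacon_top :: "cf_point topology" where
  "chacon_top \<equiv> cf_top chacon_C"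

abbreviation chacon_T :: "int \<Rightarrow> cf_point \<Rightarrow> cf_point" where
  "chacon_T \<equiv> cf_T chacon_C"

abbreviation chacon_mu :: "cf_point measure" where
  "chacon_mu \<equiv> cf_measure chacon_C"

text \<open>The normalisation of \<open>chacon_mu\<close> is thus the usual one, \<open>\<mu> ([f]\<^sub>n) = 3\<^sup>-\<^sup>n\<close>.\<close>
lemma prod_card_chacon_C: "(\<Prod>k=1..n. real (card (chacon_C k))) = 3 ^ n"
proof -
  have pos: "chacon_h n > 0" for n
    by (induction n) auto
  have "card (chacon_C k) = 3" for k
    using pos[of "k - 1"] by (simp add: chacon_C_def)
  then show ?thesis by simp
qed

text \<open>Powers \<open>X\<^sup>I\<close> over a finite set \<open>I\<close> of coordinate labels; points are extensional functions
  on \<open>I\<close>.\<close>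

abbreviation chacon_pow_top :: "nat set \<Rightarrow> (nat \<Rightarrow> cf_point) topology" where
  "chacon_pow_top I \<equiv> product_topology (\<lambda>_. chacon_top) I"

definition chacon_pow_T :: "nat set \<Rightarrow> (nat \<Rightarrow> cf_point) \<Rightarrow> (nat \<Rightarrow> cf_point)" where
  "chacon_pow_T I x = (\<lambda>i\<in>I. chacon_T 1 (x i))"

definition radon_measure_on :: "'a topology \<Rightarrow> 'a measure \<Rightarrow> bool" where
  "radon_measure_on X M \<longleftrightarrow> sets M = sets (borel_of X) \<and>
     (\<forall>K. compactin X K \<longrightarrow> emeasure M K < \<infinity>)"

definition invariant_measure :: "('a \<Rightarrow> 'a) \<Rightarrow> 'a measure \<Rightarrow> bool" where
  "invariant_measure T M \<longleftrightarrow> T \<in> measurable M M \<and>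
     (\<forall>A\<in>sets M. emeasure M (T -` A \<inter> space M) = emeasure M A)"

definition ergodic_measure :: "('a \<Rightarrow> 'a) \<Rightarrow> 'a measure \<Rightarrow> bool" where
  "ergodic_measure T M \<longleftrightarrow> invariant_measure T M \<and>
     (\<forall>A\<in>sets M. T -` A \<inter> space M = A \<longrightarrow> emeasure M A = 0 \<or> emeasure M (space M - A) = 0)"

definition quasi_phi :: "nat set \<Rightarrow> (nat \<Rightarrow> int) \<Rightarrow> cf_point \<Rightarrow> cf_point" where
  "quasi_phi J \<alpha> x = (THE y. \<exists>n p. p \<in> cf_level (quasi_C J \<alpha>) n \<and>
                        x = cf_pt (quasi_C J \<alpha>) n p \<and> y = cf_pt chacon_C n p)"

text \<open>The map \<open>\<phi>\<^bsub>\<beta>,\<alpha>\<^esub> : X\<^sup>\<alpha> \<rightarrow> X\<^sup>\<beta>\<close>.\<close>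
definition quasi_phi2 ::
  "nat set \<Rightarrow> (nat \<Rightarrow> int) \<Rightarrow> (nat \<Rightarrow> int) \<Rightarrow> cf_point \<Rightarrow> cf_point" where
  "quasi_phi2 J \<beta> \<alpha> x = (THE y. \<exists>n>0. \<exists>f c.
      x \<in> cf_pt (quasi_C J \<alpha>) (n - 1) ` cf_level (quasi_C J \<alpha>) (n - 1) \<and>
      (f, c) \<in> cf_level (quasi_C J \<alpha>) n \<and> x = cf_pt (quasi_C J \<alpha>) n (f, c) \<and>
      y = cf_pt (quasi_C J \<beta>) n
            (f + (\<Sum>j\<in>{1..n} - J. \<beta> j - \<alpha> j), \<lambda>l\<in>{n<..}. if l \<in> J then c l else \<beta> l))"

text \<open>Quasi-graph measures on \<open>X\<^sup>I\<close>, for a finite set \<open>I\<close> with at least two elements. The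
  coordinates are taken in increasing order of their labels, so \<open>Min I\<close> is the first one, the
  one carrying \<open>\<alpha>\<^sup>(\<^sup>1\<^sup>)\<close> and no shift. The shift exponent \<open>k (Min I)\<close> and the values \<open>\<alpha> i n\<close> with
  \<open>n \<in> J\<close> or \<open>n = 0\<close> are not used.\<close>

definition quasi_psi ::
  "nat set \<Rightarrow> nat set \<Rightarrow> (nat \<Rightarrow> nat \<Rightarrow> int) \<Rightarrow> cf_point \<Rightarrow> (nat \<Rightarrow> cf_point)" where
  "quasi_psi I J \<alpha> x = (\<lambda>i\<in>I. if i = Min I then quasi_phi J (\<alpha> i) x
                               else quasi_phi J (\<alpha> i) (quasi_phi2 J (\<alpha> i) (\<alpha> (Min I)) x))"

definition quasi_graph ::
  "nat set \<Rightarrow> nat set \<Rightarrow> (nat \<Rightarrow> nat \<Rightarrow> int) \<Rightarrow> (nat \<Rightarrow> int) \<Rightarrow> (nat \<Rightarrow> cf_point) measure" where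
  "quasi_graph I J \<alpha> k =
     distr (distr (cf_measure (quasi_C J (\<alpha> (Min I)))) (borel_of (chacon_pow_top I)) (quasi_psi I J \<alpha>))
       (borel_of (chacon_pow_top I))
       (\<lambda>x. \<lambda>i\<in>I. if i = Min I then x i else chacon_T (k i) (x i))"

definition quasi_graph_measure :: "nat set \<Rightarrow> (nat \<Rightarrow> cf_point) measure \<Rightarrow> bool" where
  "quasi_graph_measure I M \<longleftrightarrow>
     (\<exists>J \<alpha> k. J \<subseteq> {1..} \<and> (\<forall>i\<in>I. \<forall>n\<in>{1..} - J. \<alpha> i n \<in> chacon_C n) \<and> M = quasi_graph I J \<alpha> k)"

definition quasi_graph_radon_measure :: "nat set \<Rightarrow> (nat \<Rightarrow> cf_point) measure \<Rightarrow> bool" where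
  "quasi_graph_radon_measure I M \<longleftrightarrow>
     quasi_graph_measure I M \<and> radon_measure_on (chacon_pow_top I) M"

text \<open>The measure \<open>\<mu>\<close>, transported to \<open>X\<^sup>I\<close> for a one-point set \<open>I\<close>.\<close>
definition chacon_mu_single :: "nat set \<Rightarrow> (nat \<Rightarrow> cf_point) measure" where
  "chacon_mu_single I = distr chacon_mu (borel_of (chacon_pow_top I)) (\<lambda>x. \<lambda>i\<in>I. x)"

text \<open>The direct product of measures \<open>\<Lambda> B\<close> on \<open>X\<^sup>B\<close>, where \<open>B\<close> runs over a partition \<open>P\<close> of \<open>I\<close>:
  the product measure on \<open>\<Prod>B\<in>P. X\<^sup>B\<close>, carried over to \<open>X\<^sup>I\<close> by gluing the blocks together.\<close>
definition block_product ::
  "nat set \<Rightarrow> nat set set \<Rightarrow> (nat set \<Rightarrow> (nat \<Rightarrow> cf_point) measure) \<Rightarrow> (nat \<Rightarrow> cf_point) measure"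
  where
  "block_product I P \<Lambda> =
     distr (PiM P \<Lambda>) (borel_of (chacon_pow_top I)) (\<lambda>\<omega>. \<lambda>i\<in>I. \<omega> (THE B. B \<in> P \<and> i \<in> B) i)"

end

theory Submission
  imports Defs
begin

text \<open>
  A point of \<open>X\<^sup>d\<close> is given by a vector \<open>f\<^sub>n\<close> and increments \<open>c\<^sub>k \<in> C\<^sub>k\<^sup>d\<close>, \<open>k > n\<close>; writing
  \<open>h = h\<^sub>k\<^sub>-\<^sub>1\<close>, the entries of \<open>c\<^sub>k\<close> are \<open>- h\<close>, \<open>0\<close> or \<open>h + 1\<close>. Let \<open>\<lambda>\<close> be ergodic.

  Suppose that for some nontrivial set \<open>S\<close> of coordinates \<open>c\<^sub>k\<close> is infinitely often either
  \<open>a = (0, - h)\<close> or \<open>b = (h + 1, 0)\<close> (on \<open>S\<close>, off \<open>S\<close>). As \<open>b - a = h + 1\<^sub>S\<close>, the diagonal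
  translation by \<open>h\<close> exchanges the first \<open>a\<close> after level \<open>n\<close> with \<open>b\<close> and moves \<open>f\<^sub>n\<close> by \<open>- 1\<^sub>S\<close>.
  Whether \<open>a\<close> or \<open>b\<close> comes first is an asymptotically invariant event, so in the limit ergodicity
  yields \<open>p \<lambda> = (1 - p) T\<^sub>S \<lambda>\<close>, where \<open>T\<^sub>S\<close> moves only the coordinates in \<open>S\<close>. If the ratio were
  not \<open>1\<close>, then \<open>a\<close> and \<open>b\<close> would have summable probabilities. Hence \<open>\<lambda>\<close> is invariant under
  \<open>T\<^sub>S\<close> and under \<open>T\<close> on the complement of \<open>S\<close>, and by ergodicity all its sections over
  the complement are proportional: \<open>\<lambda>\<close> is a product of two ergodic measures, and one concludes by
  induction on \<open>d\<close>.

  Otherwise almost surely every late \<open>c\<^sub>k\<close> is constant or has both an entry \<open>- h\<close> and an entry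
  \<open>h + 1\<close>. Then the offsets between the coordinates at all late levels do not change along
  the orbit, so they are almost surely constant. This says that \<open>\<lambda>\<close> lives on a quasi-graph,
  with \<open>J\<close> the set of \<open>k\<close> for which \<open>c\<^sub>k\<close> is constant, and invariance makes it a multiple of
  the quasi-graph measure.
\<close>

section \<open>Coordinates and topology of the inductive limit\<close>

text \<open>Points of X are equivalence classes, so the arguments run on the integers
  \<open>cf_co D n x\<close>: late ones determine the point, translation by g eventually adds g to
  them, and their successive differences are the increments. The two cases exclude each other
  because a nonconstant vector with entries - h, 0, h + 1 that lacks one of the extreme entries is
  of type a or b for a nontrivial S. Vectors with both extreme entries spread over 2 h + 1; since
  h_(n+1) = 6 h_n + 1 confines F_n + C_(n+1) to about the middle half of F_(n+1), equal offsets at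
  one level then force equal offsets below. The obstacle in the first case is that \<lambda> may be
  infinite and the event "a before b" is only asymptotically invariant, so one cannot condition on
  it. Instead the restrictions of \<lambda> to these events have a limit dominated by \<lambda>, and
  an invariant measure dominated by an ergodic one is a constant multiple of it. The same principle
  replaces disintegration in the splitting: \<lambda> is restricted to a set of complementary
  coordinates and projected, and two such projections are compared inside the one over the
  union.\<close>

lemma chacon_h_ge_1: "chacon_h n \<ge> 1"
  by (induction n) auto

lemma mem_chacon_F_iff: "f \<in> chacon_F n \<longleftrightarrow> 2 * \<bar>f\<bar> < chacon_h n"
  unfolding chacon_F_def by auto

lemma mem_chacon_C_Suc_iff:
  "c \<in> chacon_C (Suc n) \<longleftrightarrow> c = - chacon_h n \<or> c = 0 \<or> c = chacon_h n + 1"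
  unfolding chacon_C_def by auto

lemma finite_chacon_F: "finite (chacon_F n)"
  by (simp add: chacon_F_def)

lemma finite_chacon_C: "finite (chacon_C n)"
  by (simp add: chacon_C_def)

lemma chacon_F_add_C:
  assumes "f \<in> chacon_F n" "c \<in> chacon_C (Suc n)"
  shows "f + c \<in> chacon_F (Suc n)"
  using assms chacon_h_ge_1[of n] by (auto simp: mem_chacon_F_iff mem_chacon_C_Suc_iff)

text \<open>Distinct elements of C_(n+1) differ by at least h_n, while F_n has diameter h_n - 1, so
  the three translates of F_n are disjoint. Those by - h_n and 0 are adjacent; between 0 and h_n + 1
  one integer is left out, the spacer behind the summand 1 in shifts by h_n.\<close>

lemma chacon_F_add_C_inj:
  assumes "f \<in> chacon_F n" "f' \<in> chacon_F n" "c \<in> chacon_C (Suc n)" "c' \<in> chacon_C (Suc n)"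
    and "f + c = f' + c'"
  shows "f = f' \<and> c = c'"
  using assms chacon_h_ge_1[of n] by (auto simp: mem_chacon_F_iff mem_chacon_C_Suc_iff)

lemma cf_push_add: "cf_push n (i + j) p = cf_push (n + i) j (cf_push n i p)"
  by (induction j) (auto simp: add.assoc)

lemma cf_push_eq:
  assumes "c \<in> extensional {n<..}"
  shows "cf_push n i (f, c) = (f + (\<Sum>k\<in>{n<..n + i}. c k), restrict c {n + i<..})"
proof (induction i)
  case 0
  then show ?case using assms by (simp add: extensional_restrict)
next
  case (Suc i)
  have "{n<..n + Suc i} = insert (Suc (n + i)) {n<..n + i}" by auto
  then have "(\<Sum>k\<in>{n<..n + Suc i}. c k) = c (Suc (n + i)) + (\<Sum>k\<in>{n<..n + i}. c k)"
    by simp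
  then show ?case
    by (simp add: Suc cf_emb_def restrict_def fun_eq_iff)
qed

section \<open>Levels and integer coordinates of a point\<close>

definition cf_X :: "(nat \<Rightarrow> int set) \<Rightarrow> nat \<Rightarrow> cf_point set" where
  "cf_X D n = cf_pt D n ` cf_level D n"

text \<open>The entry f_n in the expansion of x at level n, meaningful for x in
  \<open>cf_X D n\<close>. The representing pair is unique by \<open>cf_pt_inj\<close>. For later
  levels m the value is f_n plus the sum of the c_k with n < k \<le> m.\<close>

definition cf_co :: "(nat \<Rightarrow> int set) \<Rightarrow> nat \<Rightarrow> cf_point \<Rightarrow> int" where
  "cf_co D n x = fst (THE p. p \<in> cf_level D n \<and> x = cf_pt D n p)"

locale cut_sets =
  fixes D :: "nat \<Rightarrow> int set"
  assumes D_sub: "D (Suc k) \<subseteq> chacon_C (Suc k)"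
begin

lemma D_sub': "k > 0 \<Longrightarrow> D k \<subseteq> chacon_C k"
  using D_sub by (cases k) auto

lemma finite_D: "k > 0 \<Longrightarrow> finite (D k)"
  using D_sub' finite_chacon_C finite_subset by blast

lemma mem_cf_level: "(f, c) \<in> cf_level D n \<longleftrightarrow> f \<in> chacon_F n \<and> c \<in> PiE {n<..} D"
  by (simp add: cf_level_def)

lemma cf_emb_level: "p \<in> cf_level D n \<Longrightarrow> cf_emb n p \<in> cf_level D (Suc n)"
  using D_sub[of n]
  by (cases p) (auto simp: mem_cf_level cf_emb_def PiE_iff intro!: chacon_F_add_C)

lemma cf_emb_inj:
  assumes "p \<in> cf_level D n" "q \<in> cf_level D n" "cf_emb n p = cf_emb n q"
  shows "p = q"
proof -
  obtain f c g d where pq: "p = (f, c)" "q = (g, d)" by (cases p, cases q) auto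
  have *: "f + c (Suc n) = g + d (Suc n)" "restrict c {Suc n<..} = restrict d {Suc n<..}"
    using assms(3) by (auto simp: pq cf_emb_def)
  have "c (Suc n) \<in> D (Suc n)" "d (Suc n) \<in> D (Suc n)"
    using assms(1,2) by (auto simp: pq mem_cf_level)
  then have 1: "f = g \<and> c (Suc n) = d (Suc n)"
    using D_sub[of n] assms(1,2) *(1) by (intro chacon_F_add_C_inj[of f n]) (auto simp: pq mem_cf_level)
  have "c k = d k" for k
  proof -
    consider "k > Suc n" | "k = Suc n" | "k \<le> n" by linarith
    then show ?thesis
    proof cases
      case 1
      then show ?thesis using fun_cong[OF *(2), of k] by simp
    next
      case 3
      then show ?thesis using assms(1,2) by (auto simp: pq mem_cf_level PiE_iff extensional_def)
    qed (use 1 in auto)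
  qed
  then show ?thesis using 1 pq by auto
qed

lemma cf_push_level: "p \<in> cf_level D n \<Longrightarrow> cf_push n i p \<in> cf_level D (n + i)"
  by (induction i) (auto simp: cf_emb_level)

lemma cf_push_inj:
  "p \<in> cf_level D n \<Longrightarrow> q \<in> cf_level D n \<Longrightarrow> cf_push n i p = cf_push n i q \<Longrightarrow> p = q"
proof (induction i)
  case (Suc i)
  then show ?case using cf_emb_inj[OF cf_push_level cf_push_level] by auto
qed auto

lemma equiv_cf_rel: "equiv (SIGMA n:UNIV. cf_level D n) (cf_rel D)"
proof (rule equivI)
  show "refl_on (SIGMA n:UNIV. cf_level D n) (cf_rel D)"
    unfolding refl_on_def cf_rel_def by auto
  show "sym (cf_rel D)"
    unfolding sym_def cf_rel_def by auto metis
  show "cf_rel D \<subseteq> (SIGMA n:UNIV. cf_level D n) \<times> (SIGMA n:UNIV. cf_level D n)"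
    unfolding cf_rel_def by auto
  show "trans (cf_rel D)"
  proof (rule transI)
    fix a b c assume ab: "(a, b) \<in> cf_rel D" and bc: "(b, c) \<in> cf_rel D"
    obtain n p m q l r where abc: "a = (n, p)" "b = (m, q)" "c = (l, r)"
      by (cases a, cases b, cases c) auto
    obtain i j where ij: "n + i = m + j" "cf_push n i p = cf_push m j q"
      using ab by (auto simp: cf_rel_def abc)
    obtain j' k where jk: "m + j' = l + k" "cf_push m j' q = cf_push l k r"
      using bc by (auto simp: cf_rel_def abc)
    have "cf_push n (i + j') p = cf_push m (j + j') q"
      by (simp add: cf_push_add ij)
    also have "\<dots> = cf_push m (j' + j) q" by (simp add: add.commute)
    also have "\<dots> = cf_push l (k + j) r" by (simp add: cf_push_add jk)
    finally have "cf_push n (i + j') p = cf_push l (k + j) r" .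
    moreover have "n + (i + j') = l + (k + j)" using ij(1) jk(1) by linarith
    ultimately show "(a, c) \<in> cf_rel D"
      using ab bc by (auto simp: cf_rel_def abc)
  qed
qed

lemma cf_pt_eq_iff:
  assumes "p \<in> cf_level D n" "q \<in> cf_level D m"
  shows "cf_pt D n p = cf_pt D m q \<longleftrightarrow> (\<exists>i j. n + i = m + j \<and> cf_push n i p = cf_push m j q)"
proof -
  have "cf_pt D n p = cf_pt D m q \<longleftrightarrow> ((n, p), (m, q)) \<in> cf_rel D"
    unfolding cf_pt_def using assms by (intro eq_equiv_class_iff[OF equiv_cf_rel]) auto
  then show ?thesis using assms by (simp add: cf_rel_def)
qed

lemma cf_pt_push:
  assumes "p \<in> cf_level D n"
  shows "cf_pt D (n + i) (cf_push n i p) = cf_pt D n p"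
proof -
  have "n + i + 0 = n + i \<and> cf_push (n + i) 0 (cf_push n i p) = cf_push n i p" by simp
  then show ?thesis
    using assms cf_push_level[OF assms, of i] by (subst cf_pt_eq_iff) blast+
qed

lemma cf_pt_inj:
  assumes "p \<in> cf_level D n" "q \<in> cf_level D n" "cf_pt D n p = cf_pt D n q"
  shows "p = q"
  using assms cf_push_inj[OF assms(1,2)] unfolding cf_pt_eq_iff[OF assms(1,2)] by auto

lemma cf_space_eq: "cf_space D = (\<Union>n. cf_X D n)"
  unfolding cf_space_def quotient_def cf_X_def cf_pt_def by auto

lemma cf_X_sub_space: "cf_X D n \<subseteq> cf_space D"
  by (auto simp: cf_space_eq)

lemma cf_X_mono: "n \<le> m \<Longrightarrow> cf_X D n \<subseteq> cf_X D m"
proof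
  fix x assume nm: "n \<le> m" and "x \<in> cf_X D n"
  then obtain p where "p \<in> cf_level D n" "x = cf_pt D n p" by (auto simp: cf_X_def)
  then show "x \<in> cf_X D m"
    using cf_pt_push[of p n "m - n"] cf_push_level[of p n "m - n"] nm by (auto simp: cf_X_def)
qed

lemma cf_co_pt_same: "(f, c) \<in> cf_level D n \<Longrightarrow> cf_co D n (cf_pt D n (f, c)) = f"
proof -
  assume *: "(f, c) \<in> cf_level D n"
  have "(THE p. p \<in> cf_level D n \<and> cf_pt D n (f, c) = cf_pt D n p) = (f, c)"
    using * by (intro the_equality) (auto dest: cf_pt_inj)
  then show ?thesis by (simp add: cf_co_def)
qed

lemma cf_pt_later:
  assumes "(f, c) \<in> cf_level D n" "n \<le> m"
  shows "cf_pt D n (f, c) = cf_pt D m (f + (\<Sum>k\<in>{n<..m}. c k), restrict c {m<..})"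
    and "(f + (\<Sum>k\<in>{n<..m}. c k), restrict c {m<..}) \<in> cf_level D m"
proof -
  have c: "c \<in> extensional {n<..}" using assms by (auto simp: mem_cf_level PiE_iff)
  have "cf_push n (m - n) (f, c) = (f + (\<Sum>k\<in>{n<..m}. c k), restrict c {m<..})"
    using cf_push_eq[OF c, of "m - n" f] assms(2) by simp
  then show "cf_pt D n (f, c) = cf_pt D m (f + (\<Sum>k\<in>{n<..m}. c k), restrict c {m<..})"
    and "(f + (\<Sum>k\<in>{n<..m}. c k), restrict c {m<..}) \<in> cf_level D m"
    using cf_pt_push[OF assms(1), of "m - n"] cf_push_level[OF assms(1), of "m - n"] assms(2) by auto
qed

lemma cf_co_pt:
  assumes "(f, c) \<in> cf_level D n" "n \<le> m"
  shows "cf_co D m (cf_pt D n (f, c)) = f + (\<Sum>k\<in>{n<..m}. c k)"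
  using cf_co_pt_same[OF cf_pt_later(2)[OF assms]] cf_pt_later(1)[OF assms] by simp

lemma cf_co_step:
  assumes "(f, c) \<in> cf_level D n" "n < m"
  shows "cf_co D m (cf_pt D n (f, c)) - cf_co D (m - 1) (cf_pt D n (f, c)) = c m"
proof -
  have "{n<..m} = insert m {n<..m - 1}" using assms by auto
  then have "(\<Sum>k\<in>{n<..m}. c k) = c m + (\<Sum>k\<in>{n<..m - 1}. c k)"
    using assms by (cases m) auto
  then show ?thesis using assms by (subst (1 2) cf_co_pt) auto
qed

lemma cf_X_expand:
  assumes "x \<in> cf_X D n"
  defines "p \<equiv> (cf_co D n x, \<lambda>k\<in>{n<..}. cf_co D k x - cf_co D (k - 1) x)"
  shows "p \<in> cf_level D n" "x = cf_pt D n p"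
proof -
  obtain f c where fc: "(f, c) \<in> cf_level D n" "x = cf_pt D n (f, c)"
    using assms by (auto simp: cf_X_def)
  have "p = (f, c)"
    using fc cf_co_step[OF fc(1)]
    by (auto simp: p_def cf_co_pt_same restrict_def fun_eq_iff mem_cf_level PiE_iff extensional_def)
  then show "p \<in> cf_level D n" "x = cf_pt D n p" using fc by auto
qed

lemma cf_co_F: "x \<in> cf_X D n \<Longrightarrow> cf_co D n x \<in> chacon_F n"
  using cf_X_expand(1) by (auto simp: mem_cf_level)

lemma cf_co_D: "x \<in> cf_X D n \<Longrightarrow> n < k \<Longrightarrow> cf_co D k x - cf_co D (k - 1) x \<in> D k"
  using cf_X_expand(1)[of x n] by (auto simp: mem_cf_level PiE_iff)

lemma cf_co_C: "x \<in> cf_X D n \<Longrightarrow> n < k \<Longrightarrow> cf_co D k x - cf_co D (k - 1) x \<in> chacon_C k"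
  using cf_co_D[of x n k] D_sub'[of k] by auto

lemma cf_co_eqI:
  assumes "x \<in> cf_X D n" "y \<in> cf_X D n" "\<And>k. k \<ge> n \<Longrightarrow> cf_co D k x = cf_co D k y"
  shows "x = y"
proof -
  have "(\<lambda>k\<in>{n<..}. cf_co D k x - cf_co D (k - 1) x) = (\<lambda>k\<in>{n<..}. cf_co D k y - cf_co D (k - 1) y)"
    using assms(3) by (auto simp: restrict_def fun_eq_iff)
  then show ?thesis using cf_X_expand(2)[OF assms(1)] cf_X_expand(2)[OF assms(2)] assms(3)[of n] by simp
qed

lemma cf_X_exists:
  assumes "u n \<in> chacon_F n" "\<And>k. k > n \<Longrightarrow> u k - u (k - 1) \<in> D k"
  shows "\<exists>x\<in>cf_X D n. \<forall>k\<ge>n. cf_co D k x = u k"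
proof -
  define c where "c = (\<lambda>k\<in>{n<..}. u k - u (k - 1))"
  have l: "(u n, c) \<in> cf_level D n" using assms by (auto simp: mem_cf_level c_def)
  have "cf_co D k (cf_pt D n (u n, c)) = u k" if "k \<ge> n" for k
    using that
  proof (induction k rule: dec_induct)
    case base
    then show ?case using cf_co_pt_same[OF l] by simp
  next
    case (step k)
    then have "c (Suc k) = u (Suc k) - u k" by (simp add: c_def)
    then show ?case using cf_co_step[OF l, of "Suc k"] step by simp
  qed
  then show ?thesis using l by (auto simp: cf_X_def)
qed

text \<open>Prescribing f at level n and the coordinates of x afterwards yields a point of level n
  by \<open>cf_X_exists\<close>; it agrees with x from level n + 1 on and hence equals x.\<close>

lemma cf_X_down:
  assumes "x \<in> cf_X D (Suc n)" "f \<in> chacon_F n" "c \<in> D (Suc n)" "cf_co D (Suc n) x = f + c"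
  shows "x \<in> cf_X D n" "cf_co D n x = f"
proof -
  define u where "u k = (if k = n then f else cf_co D k x)" for k
  have "\<exists>y\<in>cf_X D n. \<forall>k\<ge>n. cf_co D k y = u k"
  proof (rule cf_X_exists)
    fix k assume "k > n"
    then show "u k - u (k - 1) \<in> D k"
      using cf_co_D[OF assms(1), of k] assms by (cases "k = Suc n") (auto simp: u_def)
  qed (simp add: u_def assms)
  then obtain y where y: "y \<in> cf_X D n" "\<And>k. k \<ge> n \<Longrightarrow> cf_co D k y = u k" by blast
  have "x = y"
    using assms(1) y cf_X_mono[of n "Suc n"] by (intro cf_co_eqI[of _ "Suc n"]) (auto simp: u_def)
  then show "x \<in> cf_X D n" "cf_co D n x = f" using y(1) y(2)[of n] by (auto simp: u_def)
qed

lemma cf_cyl_eq: "cf_cyl D n f = {x \<in> cf_X D n. cf_co D n x = f}"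
  unfolding cf_cyl_def cf_X_def using cf_co_pt_same by fastforce

lemma cf_cyl_split:
  "f \<in> chacon_F n \<Longrightarrow> cf_cyl D n f = (\<Union>c\<in>D (Suc n). cf_cyl D (Suc n) (f + c))"
proof (intro equalityI subsetI)
  fix x assume x: "x \<in> cf_cyl D n f"
  then have "x \<in> cf_X D n" "cf_co D n x = f" by (auto simp: cf_cyl_eq)
  then show "x \<in> (\<Union>c\<in>D (Suc n). cf_cyl D (Suc n) (f + c))"
    using cf_co_D[of x n "Suc n"] cf_X_mono[of n "Suc n"]
    by (auto simp: cf_cyl_eq intro!: bexI[of _ "cf_co D (Suc n) x - cf_co D n x"])
qed (auto simp: cf_cyl_eq dest: cf_X_down)

section \<open>Cylinders as compact open neighbourhoods\<close>

lemma topspace_cf_top: "topspace (cf_top D) = cf_space D"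
proof -
  have "openin (cf_top D) (cf_space D)"
    unfolding openin_cf_top
  proof (intro conjI allI)
    fix n
    have "{p \<in> cf_level D n. cf_pt D n p \<in> cf_space D} = topspace (cf_level_top D n)"
      using cf_X_sub_space by (auto simp: topspace_cf_level_top cf_X_def)
    then show "openin (cf_level_top D n) {p \<in> cf_level D n. cf_pt D n p \<in> cf_space D}"
      by simp
  qed auto
  then show ?thesis
    using openin_cf_top openin_subset openin_topspace by blast
qed

lemma continuous_map_cf_pt: "continuous_map (cf_level_top D n) (cf_top D) (cf_pt D n)"
  unfolding continuous_map_def
  using cf_X_sub_space by (auto simp: topspace_cf_level_top topspace_cf_top openin_cf_top cf_X_def)

lemma continuous_map_cf_emb:
  "continuous_map (cf_level_top D n) (cf_level_top D (Suc n)) (cf_emb n)"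
proof -
  have fs: "continuous_map (cf_level_top D n) (discrete_topology (chacon_F n)) fst"
    unfolding cf_level_top_def by (rule continuous_map_fst)
  have sn: "continuous_map (cf_level_top D n) (discrete_topology (D k)) (\<lambda>p. snd p k)" if "k > n" for k
    unfolding cf_level_top_def
    by (rule continuous_map_componentwise[THEN iffD1, OF continuous_map_snd, THEN conjunct2, rule_format])
       (use that in auto)
  have 1: "continuous_map (cf_level_top D n) (discrete_topology (chacon_F (Suc n)))
      (\<lambda>p. fst p + snd p (Suc n))"
    unfolding continuous_map_def
  proof (intro conjI allI impI)
    show "(\<lambda>p. fst p + snd p (Suc n)) \<in>
        topspace (cf_level_top D n) \<rightarrow> topspace (discrete_topology (chacon_F (Suc n)))"
      using cf_emb_level[of _ n] by (auto simp: topspace_cf_level_top cf_emb_def mem_cf_level)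
  next
    fix U :: "int set" assume "openin (discrete_topology (chacon_F (Suc n))) U"
    have "{p \<in> topspace (cf_level_top D n). fst p + snd p (Suc n) \<in> U} =
      (\<Union>c\<in>D (Suc n). {p \<in> topspace (cf_level_top D n). fst p \<in> {f \<in> chacon_F n. f + c \<in> U}} \<inter>
         {p \<in> topspace (cf_level_top D n). snd p (Suc n) \<in> {c}})"
      by (auto simp: topspace_cf_level_top mem_cf_level)
    also have "openin (cf_level_top D n) \<dots>"
    proof (rule openin_Union, clarify, rule openin_Int)
      fix c
      show "openin (cf_level_top D n) {p \<in> topspace (cf_level_top D n). fst p \<in> {f \<in> chacon_F n. f + c \<in> U}}"
        by (rule openin_continuous_map_preimage[OF fs]) auto
    next
      fix c assume "c \<in> D (Suc n)"
      then show "openin (cf_level_top D n) {p \<in> topspace (cf_level_top D n). snd p (Suc n) \<in> {c}}"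
        by (intro openin_continuous_map_preimage[OF sn]) auto
    qed
    finally show "openin (cf_level_top D n)
        {p \<in> topspace (cf_level_top D n). fst p + snd p (Suc n) \<in> U}" .
  qed
  have 2: "continuous_map (cf_level_top D n) (product_topology (\<lambda>k. discrete_topology (D k)) {Suc n<..})
      (\<lambda>p. restrict (snd p) {Suc n<..})"
    unfolding continuous_map_componentwise using sn by auto
  have "cf_emb n = (\<lambda>p. (fst p + snd p (Suc n), restrict (snd p) {Suc n<..}))"
    by (auto simp: cf_emb_def fun_eq_iff)
  then show ?thesis
    using 1 2 unfolding cf_level_top_def[of D "Suc n"] continuous_map_pairwise
    by (simp add: o_def)
qed

text \<open>Openness must be checked in every level m. For m \<ge> n the cylinder is split into
  cylinders of level m, where it becomes a condition on the first entry only; for m \<le> n it is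
  pulled back along the continuous embeddings.\<close>

lemma openin_cf_cyl:
  assumes "f \<in> chacon_F n"
  shows "openin (cf_top D) (cf_cyl D n f)"
proof -
  have up: "openin (cf_level_top D m) {p \<in> cf_level D m. cf_pt D m p \<in> cf_cyl D n f}"
    if "n \<le> m" for m
    using that assms
  proof (induction n arbitrary: f rule: inc_induct)
    case base
    have "{p \<in> cf_level D m. cf_pt D m p \<in> cf_cyl D m f} = {f} \<times> topspace (product_topology (\<lambda>k. discrete_topology (D k)) {m<..})"
      using base cf_co_pt_same by (auto simp: cf_cyl_eq cf_X_def mem_cf_level)
    also have "openin (cf_level_top D m) \<dots>"
      unfolding cf_level_top_def openin_prod_Times_iff
      using base by (intro disjI2 conjI openin_topspace) simp
    finally show ?case .
  next
    case (step n)
    have "{p \<in> cf_level D m. cf_pt D m p \<in> cf_cyl D n f} =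
       (\<Union>c\<in>D (Suc n). {p \<in> cf_level D m. cf_pt D m p \<in> cf_cyl D (Suc n) (f + c)})"
      using cf_cyl_split[OF step.prems] by auto
    moreover have "openin (cf_level_top D m) {p \<in> cf_level D m. cf_pt D m p \<in> cf_cyl D (Suc n) (f + c)}"
      if "c \<in> D (Suc n)" for c
      using step.IH[of "f + c"] step.prems D_sub[of n] that chacon_F_add_C[of f n c] by blast
    ultimately show ?case by auto
  qed
  have down: "openin (cf_level_top D m) {p \<in> cf_level D m. cf_pt D m p \<in> cf_cyl D n f}"
    if "m \<le> n" for m
    using that
  proof (induction m rule: inc_induct)
    case base
    then show ?case using up[of n] by simp
  next
    case (step m)
    have "cf_pt D (Suc m) (cf_emb m p) = cf_pt D m p" if "p \<in> cf_level D m" for p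
      using cf_pt_push[OF that, of 1] by simp
    then have "{p \<in> cf_level D m. cf_pt D m p \<in> cf_cyl D n f} = {p \<in> topspace (cf_level_top D m).
       cf_emb m p \<in> {p \<in> cf_level D (Suc m). cf_pt D (Suc m) p \<in> cf_cyl D n f}}"
      using cf_emb_level by (auto simp: topspace_cf_level_top)
    then show ?case
      using openin_continuous_map_preimage[OF continuous_map_cf_emb step.IH] by simp
  qed
  have "openin (cf_level_top D m) {p \<in> cf_level D m. cf_pt D m p \<in> cf_cyl D n f}" for m
    using up[of m] down[of m] by (cases "n \<le> m") auto
  moreover have "cf_cyl D n f \<subseteq> cf_space D"
    using cf_X_sub_space[of n] by (auto simp: cf_cyl_eq)
  ultimately show ?thesis
    unfolding openin_cf_top by blast
qed

lemma compactin_cf_cyl: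
  assumes "f \<in> chacon_F n"
  shows "compactin (cf_top D) (cf_cyl D n f)"
proof -
  have "cf_cyl D n f = cf_pt D n ` ({f} \<times> PiE {n<..} D)"
    using assms by (auto simp: cf_cyl_def mem_cf_level)
  moreover have "compactin (cf_level_top D n) ({f} \<times> PiE {n<..} D)"
    unfolding cf_level_top_def compactin_Times compactin_PiE
    using assms finite_D by (auto simp: compactin_discrete_topology)
  ultimately show ?thesis
    using image_compactin continuous_map_cf_pt by metis
qed

lemma cf_top_base:
  assumes U: "openin (cf_top D) U" and x: "x \<in> U"
  shows "\<exists>n0. x \<in> cf_X D n0 \<and> (\<forall>n\<ge>n0. cf_cyl D n (cf_co D n x) \<subseteq> U)"
proof -
  have "x \<in> cf_space D" using assms by (auto simp: openin_cf_top)
  then obtain n f c where fc: "(f, c) \<in> cf_level D n" "x = cf_pt D n (f, c)"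
    by (auto simp: cf_space_eq cf_X_def)
  define S where "S = {p \<in> cf_level D n. cf_pt D n p \<in> U}"
  have oS: "openin (cf_level_top D n) S" using U by (auto simp: openin_cf_top S_def)
  have fS: "(f, c) \<in> S" using fc x by (auto simp: S_def)
  from oS[unfolded cf_level_top_def openin_prod_topology_alt, rule_format, OF fS]
  obtain A B where AB: "f \<in> A" "c \<in> B" "A \<times> B \<subseteq> S"
    "openin (product_topology (\<lambda>k. discrete_topology (D k)) {n<..}) B"
    by (elim exE conjE) (rule that)
  from AB(4)[unfolded openin_product_topology_alt topspace_discrete_topology, rule_format, OF AB(2)]
  obtain W where W: "finite {k \<in> {n<..}. W k \<noteq> D k}" "c \<in> PiE {n<..} W" "PiE {n<..} W \<subseteq> B"
    by blast
  obtain N where N: "\<And>k. k \<in> {n<..} \<Longrightarrow> W k \<noteq> D k \<Longrightarrow> k \<le> N" "n \<le> N"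
  proof -
    obtain N' where "\<forall>k\<in>{k \<in> {n<..}. W k \<noteq> D k}. k \<le> N'"
      using W(1) finite_nat_set_iff_bounded_le by blast
    then show ?thesis by (intro that[of "max n N'"]) (auto simp: max_def)
  qed
  have "cf_cyl D m (cf_co D m x) \<subseteq> U" if m: "m \<ge> N" for m
  proof
    fix y assume "y \<in> cf_cyl D m (cf_co D m x)"
    then obtain c' where c': "(cf_co D m x, c') \<in> cf_level D m" "y = cf_pt D m (cf_co D m x, c')"
      by (auto simp: cf_cyl_def)
    \<comment> \<open>The splice of x up to level m with y afterwards: it satisfies the finitely
      many constraints \<open>W\<close>, all at indices up to N \<le> m, and represents y because x
      and y have the same coordinate at level m.\<close>
    define e where "e = (\<lambda>k\<in>{n<..}. if k \<le> m then c k else c' k)"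
    have e: "(f, e) \<in> cf_level D n" "e \<in> PiE {n<..} W"
      using fc(1) c'(1) W(2) N m by (force simp: mem_cf_level e_def PiE_iff)+
    have "(\<Sum>k\<in>{n<..m}. c k) = (\<Sum>k\<in>{n<..m}. e k)"
      by (intro sum.cong) (auto simp: e_def)
    moreover have "restrict e {m<..} = c'"
      using c'(1) N m by (auto simp: e_def restrict_def fun_eq_iff mem_cf_level PiE_iff extensional_def)
    ultimately have "cf_pt D n (f, e) = y"
      using cf_pt_later(1)[OF e(1), of m] cf_co_pt[OF fc(1), of m] m N(2) c'(2) fc(2) by simp
    then show "y \<in> U" using AB W(3) e by (auto simp: S_def)
  qed
  moreover have "x \<in> cf_X D N" using fc cf_X_mono[OF N(2)] by (auto simp: cf_X_def)
  ultimately show ?thesis by blast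
qed

end

interpretation C: cut_sets chacon_C
  by standard auto

section \<open>The action\<close>

lemma chacon_h_gt: "chacon_h n > int n"
  by (induction n) auto

text \<open>Against h_(n+1) = 6 h_n + 1 this leaves a margin of at least h_n on either side of
  F_(n+1). As h_n exceeds any given integer for large n, every translation is eventually
  admissible.\<close>

lemma cf_co_Suc_bound:
  assumes "f \<in> chacon_F n" "c \<in> chacon_C (Suc n)"
  shows "2 * \<bar>f + c\<bar> \<le> 3 * chacon_h n + 1"
  using assms chacon_h_ge_1[of n] by (auto simp: mem_chacon_F_iff mem_chacon_C_Suc_iff)

context cut_sets
begin

lemma cf_co_Suc_C: "x \<in> cf_X D n \<Longrightarrow> cf_co D (Suc n) x - cf_co D n x \<in> chacon_C (Suc n)"
  using cf_co_C[of x n "Suc n"] by simp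

lemma cf_shift_F:
  assumes "x \<in> cf_X D n" "cf_co D n x + v \<in> chacon_F n" "n \<le> j"
  shows "cf_co D j x + v \<in> chacon_F j"
  using \<open>n \<le> j\<close>
proof (induction j rule: dec_induct)
  case (step j)
  have "x \<in> cf_X D j" using assms(1) cf_X_mono step by blast
  then show ?case
    using chacon_F_add_C[OF step.IH cf_co_Suc_C[of x]] by (simp add: algebra_simps)
qed (use assms in auto)

text \<open>Descending from level m, the coordinate of y is an element of F_k, the shifted
  coordinate of x, plus the increment of x; uniqueness of such a decomposition peels off the same
  increment from y. The case v = 0 says that points sharing a late cylinder share the earlier
  ones.\<close>

lemma cf_shift_down:
  assumes "x \<in> cf_X D n" "y \<in> cf_X D m" "cf_co D m y = cf_co D m x + v"
    and "cf_co D n x + v \<in> chacon_F n" "n \<le> k" "k \<le> m"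
  shows "y \<in> cf_X D k \<and> cf_co D k y = cf_co D k x + v"
proof -
  from \<open>k \<le> m\<close> show ?thesis using \<open>n \<le> k\<close>
  proof (induction k rule: inc_induct)
    case base
    then show ?case using assms by simp
  next
    case (step k)
    have x: "x \<in> cf_X D k" using assms(1) cf_X_mono step by blast
    have *: "cf_co D (Suc k) y = (cf_co D k x + v) + (cf_co D (Suc k) x - cf_co D k x)"
      using step by simp
    have "cf_co D (Suc k) x - cf_co D k x \<in> D (Suc k)" using cf_co_D[OF x, of "Suc k"] by simp
    then show ?case
      using cf_X_down[OF _ cf_shift_F[OF assms(1,4)] _ *] step by simp
  qed
qed

lemma cf_ev_large:
  assumes "x \<in> cf_space D"
  shows "\<forall>\<^sub>F n in sequentially. x \<in> cf_X D n \<and> cf_co D n x + g \<in> chacon_F n"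
proof -
  obtain m where m: "x \<in> cf_X D m" using assms by (auto simp: cf_space_eq)
  have "x \<in> cf_X D n \<and> cf_co D n x + g \<in> chacon_F n" if n: "n \<ge> Suc (m + nat \<bar>g\<bar>)" for n
  proof -
    obtain k where k: "n = Suc k" "k \<ge> m + nat \<bar>g\<bar>" using n by (cases n) auto
    have x: "x \<in> cf_X D k" "x \<in> cf_X D n" using m k cf_X_mono[of m k] cf_X_mono[of m n] by auto
    have "2 * \<bar>cf_co D k x + (cf_co D n x - cf_co D k x)\<bar> \<le> 3 * chacon_h k + 1"
      using cf_co_Suc_bound[OF cf_co_F cf_co_Suc_C] x k by metis
    moreover have "chacon_h k > \<bar>g\<bar>" using chacon_h_gt[of k] k by linarith
    ultimately show ?thesis using x by (auto simp: mem_chacon_F_iff k)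
  qed
  then show ?thesis unfolding eventually_sequentially by blast
qed

lemma cf_ev_X: "x \<in> cf_space D \<Longrightarrow> \<forall>\<^sub>F n in sequentially. x \<in> cf_X D n"
  using cf_ev_large[of x 0] by (auto elim: eventually_mono)

lemma cf_ev_eqI:
  assumes "x \<in> cf_space D" "y \<in> cf_space D"
    and "\<forall>\<^sub>F n in sequentially. cf_co D n x = cf_co D n y"
  shows "x = y"
proof -
  have "\<forall>\<^sub>F n in sequentially. cf_co D n x = cf_co D n y \<and> x \<in> cf_X D n \<and> y \<in> cf_X D n"
    using assms cf_ev_X by (simp add: eventually_conj_iff)
  then obtain N where "\<And>n. n \<ge> N \<Longrightarrow> cf_co D n x = cf_co D n y \<and> x \<in> cf_X D n \<and> y \<in> cf_X D n"
    by (auto simp: eventually_sequentially)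
  then show ?thesis by (intro cf_co_eqI[of x N]) auto
qed

lemma cf_T_co:
  assumes x: "x \<in> cf_X D n" and g: "cf_co D n x + g \<in> chacon_F n"
  shows "cf_T D g x \<in> cf_X D n" and "n \<le> k \<Longrightarrow> cf_co D k (cf_T D g x) = cf_co D k x + g"
proof -
  obtain f c where fc: "(f, c) \<in> cf_level D n" "x = cf_pt D n (f, c)"
    using x by (auto simp: cf_X_def)
  define y where "y = cf_pt D n (g + f, c)"
  have f: "cf_co D n x = f" using fc by (simp add: cf_co_pt_same)
  have y1: "(g + f, c) \<in> cf_level D n" using fc g f by (simp add: mem_cf_level add.commute)
  have y2: "y \<in> cf_X D n" using y1 by (auto simp: cf_X_def y_def)
  have co: "cf_co D k (cf_pt D m (g + f', c')) = cf_co D k (cf_pt D m (f', c')) + g"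
    if "m \<le> k" "(f', c') \<in> cf_level D m" "(g + f', c') \<in> cf_level D m" for f' c' k m
    using that by (simp add: cf_co_pt)
  have "cf_T D g x = y"
    unfolding cf_T_def
  proof (rule the_equality)
    show "\<exists>n f c. (f, c) \<in> cf_level D n \<and> g + f \<in> chacon_F n \<and> x = cf_pt D n (f, c) \<and> y = cf_pt D n (g + f, c)"
      using fc g f y_def by (metis add.commute)
  next
    fix z assume "\<exists>n f c. (f, c) \<in> cf_level D n \<and> g + f \<in> chacon_F n \<and> x = cf_pt D n (f, c) \<and> z = cf_pt D n (g + f, c)"
    then obtain m f' c' where m: "(f', c') \<in> cf_level D m" "g + f' \<in> chacon_F m" "x = cf_pt D m (f', c')"
      "z = cf_pt D m (g + f', c')" by blast
    have z1: "(g + f', c') \<in> cf_level D m" using m by (simp add: mem_cf_level)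
    have "cf_co D k z = cf_co D k y" if "k \<ge> max m n" for k
      using co[of m k f' c'] co[of n k f c] m fc y1 z1 that by (simp add: y_def)
    then have "\<forall>\<^sub>F k in sequentially. cf_co D k z = cf_co D k y"
      unfolding eventually_sequentially by blast
    moreover have "z \<in> cf_X D m" using z1 m by (auto simp: cf_X_def)
    ultimately show "z = y" using y2 cf_X_sub_space by (intro cf_ev_eqI) blast+
  qed
  then show "cf_T D g x \<in> cf_X D n" "n \<le> k \<Longrightarrow> cf_co D k (cf_T D g x) = cf_co D k x + g"
    using y2 co[of n k f c] fc y1 y_def by auto
qed

text \<open>One translation by t may act as v up to level k and as t beyond, provided that the
  difference t - v, absorbed by the increment between k and k + 1, leaves this increment admissible.
  This is how a diagonal translation by the large number h acts on early levels as a shift by 1 or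
  not at all.\<close>

lemma cf_hop:
  assumes x: "x \<in> cf_X D n" and v: "cf_co D n x + v \<in> chacon_F n" and k: "n \<le> k"
    and c: "cf_co D (Suc k) x - cf_co D k x + t - v \<in> D (Suc k)"
  shows "cf_T D t x \<in> cf_X D n"
    and "n \<le> j \<Longrightarrow> j \<le> k \<Longrightarrow> cf_co D j (cf_T D t x) = cf_co D j x + v"
    and "k < j \<Longrightarrow> cf_co D j (cf_T D t x) = cf_co D j x + t"
proof -
  let ?y = "cf_T D t x"
  have Fk: "cf_co D k x + v \<in> chacon_F k" by (rule cf_shift_F[OF x v k])
  have "(cf_co D k x + v) + (cf_co D (Suc k) x - cf_co D k x + t - v) \<in> chacon_F (Suc k)"
    using Fk c D_sub by (intro chacon_F_add_C) auto
  then have F: "cf_co D (Suc k) x + t \<in> chacon_F (Suc k)" by simp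
  have xk: "x \<in> cf_X D (Suc k)" using x cf_X_mono[of n "Suc k"] k by auto
  have y: "?y \<in> cf_X D (Suc k)" "\<And>j. Suc k \<le> j \<Longrightarrow> cf_co D j ?y = cf_co D j x + t"
    using cf_T_co[OF xk F] by auto
  have e: "cf_co D (Suc k) ?y = (cf_co D k x + v) + (cf_co D (Suc k) x - cf_co D k x + t - v)"
    using y(2)[of "Suc k"] by simp
  have yk: "?y \<in> cf_X D k" "cf_co D k ?y = cf_co D k x + v"
    using cf_X_down[OF y(1) Fk c e] by auto
  note d = cf_shift_down[OF x yk v]
  show "?y \<in> cf_X D n" using d[of n] k by simp
  show "n \<le> j \<Longrightarrow> j \<le> k \<Longrightarrow> cf_co D j ?y = cf_co D j x + v" using d[of j] by simp
  show "k < j \<Longrightarrow> cf_co D j ?y = cf_co D j x + t" using y(2)[of j] by simp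
qed

lemma cf_T_ev:
  assumes "x \<in> cf_space D"
  shows "\<forall>\<^sub>F n in sequentially. cf_co D n (cf_T D g x) = cf_co D n x + g"
  using cf_ev_large[OF assms, of g] by eventually_elim (use cf_T_co(2) in blast)

lemma cf_T_space: "x \<in> cf_space D \<Longrightarrow> cf_T D g x \<in> cf_space D"
  using eventually_happens[OF cf_ev_large[of x g]] cf_T_co(1) cf_X_sub_space by fastforce

lemma cf_T_add:
  assumes "x \<in> cf_space D"
  shows "cf_T D g (cf_T D h x) = cf_T D (g + h) x"
proof (rule cf_ev_eqI)
  show "\<forall>\<^sub>F n in sequentially. cf_co D n (cf_T D g (cf_T D h x)) = cf_co D n (cf_T D (g + h) x)"
    using cf_T_ev[OF assms, of h] cf_T_ev[OF assms, of "g + h"] cf_T_ev[OF cf_T_space[OF assms, of h], of g]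
    by eventually_elim simp
qed (use assms cf_T_space in auto)

lemma cf_T_0: "x \<in> cf_space D \<Longrightarrow> cf_T D 0 x = x"
  using cf_T_ev[of x 0] by (intro cf_ev_eqI cf_T_space) auto

end

section \<open>Borel sets of the powers\<close>

lemma sets_borel_of: "sets (borel_of X) = sigma_sets (topspace X) {U. openin X U}"
  unfolding borel_of_def by (intro sets_measure_of) (auto dest: openin_subset)

lemma space_borel_of: "space (borel_of X) = topspace X"
  unfolding borel_of_def by (intro space_measure_of) (auto dest: openin_subset)

lemma openin_in_borel_of: "openin X U \<Longrightarrow> U \<in> sets (borel_of X)"
  by (auto simp: sets_borel_of)

lemma sets_borel_of_base:
  assumes "countable E" "\<And>e. e \<in> E \<Longrightarrow> openin X e"
    and "\<And>U x. openin X U \<Longrightarrow> x \<in> U \<Longrightarrow> \<exists>e\<in>E. x \<in> e \<and> e \<subseteq> U"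
  shows "sets (borel_of X) = sigma_sets (topspace X) E"
  unfolding sets_borel_of
proof (rule sigma_sets_eqI)
  fix U assume "U \<in> {U. openin X U}"
  then have "U = \<Union>{e \<in> E. e \<subseteq> U}" using assms(3) by blast
  moreover have "\<Union>{e \<in> E. e \<subseteq> U} \<in> sigma_sets (topspace X) E"
    using assms(1) by (intro sigma_sets_UNION) auto
  ultimately show "U \<in> sigma_sets (topspace X) E" by simp
qed (use assms(2) in auto)

context cut_sets
begin

lemma cf_cyl_sub_if_meet:
  assumes "x \<in> cf_cyl D n f" "x \<in> cf_cyl D m g" "n \<le> m"
  shows "cf_cyl D m g \<subseteq> cf_cyl D n f"
proof
  fix y assume "y \<in> cf_cyl D m g"
  then show "y \<in> cf_cyl D n f"
    using cf_shift_down[of x n y m 0 n] assms cf_co_F[of x n] by (auto simp: cf_cyl_eq)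
qed

definition "cyls = {cf_cyl D n f | n f. f \<in> chacon_F n}"

lemma countable_cyls: "countable cyls"
proof -
  have "cyls = (\<lambda>(n, f). cf_cyl D n f) ` (SIGMA n:UNIV. chacon_F n)"
    by (auto simp: cyls_def)
  then show ?thesis by simp
qed

lemma sets_cf_borel: "sets (borel_of (cf_top D)) = sigma_sets (cf_space D) cyls"
proof -
  have "\<exists>e\<in>cyls. x \<in> e \<and> e \<subseteq> U" if "openin (cf_top D) U" "x \<in> U" for U x
  proof -
    obtain n where "x \<in> cf_X D n" "cf_cyl D n (cf_co D n x) \<subseteq> U" using cf_top_base[OF \<open>openin (cf_top D) U\<close> \<open>x \<in> U\<close>] by auto
    moreover have "cf_cyl D n (cf_co D n x) \<in> cyls"
      using cf_co_F[OF \<open>x \<in> cf_X D n\<close>] by (auto simp: cyls_def)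
    moreover have "x \<in> cf_cyl D n (cf_co D n x)" using \<open>x \<in> cf_X D n\<close> by (simp add: cf_cyl_eq)
    ultimately show ?thesis using \<open>cf_cyl D n (cf_co D n x) \<subseteq> U\<close> by blast
  qed
  then show ?thesis
    using sets_borel_of_base[OF countable_cyls, of "cf_top D"] openin_cf_cyl topspace_cf_top
    by (auto simp: cyls_def)
qed

lemma cf_cyl_sets: "f \<in> chacon_F n \<Longrightarrow> cf_cyl D n f \<in> sets (borel_of (cf_top D))"
  using openin_cf_cyl openin_in_borel_of by blast

lemma Union_cyls: "\<Union>cyls = cf_space D"
proof (intro equalityI subsetI)
  fix x assume "x \<in> cf_space D"
  then obtain n where n: "x \<in> cf_X D n" by (auto simp: cf_space_eq)
  then have "x \<in> cf_cyl D n (cf_co D n x)" "cf_cyl D n (cf_co D n x) \<in> cyls"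
    using cf_co_F by (auto simp: cyls_def cf_cyl_eq)
  then show "x \<in> \<Union>cyls" by blast
next
  fix x assume "x \<in> \<Union>cyls"
  then obtain n f where "x \<in> cf_cyl D n f" by (auto simp: cyls_def)
  then show "x \<in> cf_space D" using cf_X_sub_space[of n] by (auto simp: cf_cyl_eq)
qed

text \<open>Two cylinders are disjoint or nested, so together with the empty set they are stable
  under intersection, and countably many of them, of finite mass, cover the space.\<close>

lemma cyl_measure_eqI:
  assumes M: "sets M = sets (borel_of (cf_top D))" and N: "sets N = sets (borel_of (cf_top D))"
    and eq: "\<And>n f. f \<in> chacon_F n \<Longrightarrow> emeasure M (cf_cyl D n f) = emeasure N (cf_cyl D n f)"
    and fin: "\<And>n f. f \<in> chacon_F n \<Longrightarrow> emeasure M (cf_cyl D n f) \<noteq> \<infinity>"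
  shows "M = N"
proof (rule measure_eqI_generator_eq_countable[where E = "insert {} cyls" and A = cyls and \<Omega> = "cf_space D"])
  have "a \<inter> b \<in> insert {} cyls" if ab: "a \<in> cyls" "b \<in> cyls" for a b
  proof (cases "a \<inter> b = {}")
    case False
    then obtain x where x: "x \<in> a" "x \<in> b" by blast
    obtain n f m g where nm: "a = cf_cyl D n f" "b = cf_cyl D m g" using ab unfolding cyls_def by blast
    then have "a \<subseteq> b \<or> b \<subseteq> a"
      using x cf_cyl_sub_if_meet[of x] nat_le_linear[of n m] by metis
    then have "a \<inter> b = a \<or> a \<inter> b = b" by blast
    then show ?thesis using ab by auto
  qed auto
  then show "Int_stable (insert {} cyls)" unfolding Int_stable_def by auto
  show "insert {} cyls \<subseteq> Pow (cf_space D)" using Union_cyls by auto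
  have "sigma_sets (cf_space D) (insert {} cyls) = sigma_sets (cf_space D) cyls"
    by (rule sigma_sets_eqI) (auto simp: sigma_sets.Empty)
  then show "sets M = sigma_sets (cf_space D) (insert {} cyls)" "sets N = sigma_sets (cf_space D) (insert {} cyls)"
    using M N sets_cf_borel by auto
qed (use eq fin countable_cyls Union_cyls in \<open>auto simp: cyls_def\<close>)

end

section \<open>Finite powers and their boxes\<close>

abbreviation cX :: "nat \<Rightarrow> cf_point set" where "cX \<equiv> cf_X chacon_C"
abbreviation co :: "nat \<Rightarrow> cf_point \<Rightarrow> int" where "co \<equiv> cf_co chacon_C"
abbreviation chacon_space :: "cf_point set" where "chacon_space \<equiv> cf_space chacon_C"

definition pbox :: "nat set \<Rightarrow> nat \<Rightarrow> (nat \<Rightarrow> int) \<Rightarrow> (nat \<Rightarrow> cf_point) set" where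
  "pbox I n f = PiE I (\<lambda>i. cf_cyl chacon_C n (f i))"

definition pS :: "nat set \<Rightarrow> (nat \<Rightarrow> cf_point) set" where
  "pS I = PiE I (\<lambda>_. chacon_space)"

abbreviation pB :: "nat set \<Rightarrow> (nat \<Rightarrow> cf_point) measure" where
  "pB I \<equiv> borel_of (chacon_pow_top I)"

definition pT :: "nat set \<Rightarrow> (nat \<Rightarrow> int) \<Rightarrow> (nat \<Rightarrow> cf_point) \<Rightarrow> (nat \<Rightarrow> cf_point)" where
  "pT I v x = (\<lambda>i\<in>I. chacon_T (v i) (x i))"

lemma chacon_pow_T_eq: "chacon_pow_T I = pT I (\<lambda>_. 1)"
  by (simp add: chacon_pow_T_def pT_def fun_eq_iff)

lemma topspace_pow: "topspace (chacon_pow_top I) = pS I"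
  by (simp add: C.topspace_cf_top pS_def)

lemma space_pB: "space (pB I) = pS I"
  unfolding space_borel_of topspace_pow ..

lemma mem_box_iff: "x \<in> pbox I n f \<longleftrightarrow> x \<in> extensional I \<and> (\<forall>i\<in>I. x i \<in> cX n \<and> co n (x i) = f i)"
  by (auto simp: pbox_def PiE_iff C.cf_cyl_eq)

lemma cX_space: "x \<in> cX n \<Longrightarrow> x \<in> chacon_space"
  using C.cf_X_sub_space by blast

lemma box_sub: "pbox I n f \<subseteq> pS I"
proof
  fix x assume "x \<in> pbox I n f"
  then have "x \<in> extensional I" "\<And>i. i \<in> I \<Longrightarrow> x i \<in> chacon_space"
    using cX_space[of _ n] by (auto simp: mem_box_iff)
  then show "x \<in> pS I" by (auto simp: pS_def PiE_iff)
qed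

lemma self_box: "x \<in> extensional I \<Longrightarrow> \<forall>i\<in>I. x i \<in> cX n \<Longrightarrow> x \<in> pbox I n (\<lambda>i. co n (x i))"
  by (auto simp: mem_box_iff)

lemma box_cong: "(\<And>i. i \<in> I \<Longrightarrow> f i = g i) \<Longrightarrow> pbox I n f = pbox I n g"
  unfolding pbox_def by (intro PiE_cong) simp

lemma pS_extensional: "x \<in> pS I \<Longrightarrow> x \<in> extensional I"
  by (auto simp: pS_def PiE_iff)

lemma openin_box:
  assumes "finite I" "\<forall>i\<in>I. f i \<in> chacon_F n"
  shows "openin (chacon_pow_top I) (pbox I n f)"
  unfolding pbox_def using assms by (subst openin_PiE) (auto intro: C.openin_cf_cyl)

lemma compactin_box:
  assumes "\<forall>i\<in>I. f i \<in> chacon_F n"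
  shows "compactin (chacon_pow_top I) (pbox I n f)"
  unfolding pbox_def using assms by (auto simp: compactin_PiE intro: C.compactin_cf_cyl)

lemma box_sets: "finite I \<Longrightarrow> \<forall>i\<in>I. f i \<in> chacon_F n \<Longrightarrow> pbox I n f \<in> sets (pB I)"
  using openin_box openin_in_borel_of by blast

lemma box_sub_if_meet:
  assumes "x \<in> pbox I n f" "x \<in> pbox I m g" "n \<le> m"
  shows "pbox I m g \<subseteq> pbox I n f"
proof -
  have "cf_cyl chacon_C m (g i) \<subseteq> cf_cyl chacon_C n (f i)" if "i \<in> I" for i
    using assms that by (intro C.cf_cyl_sub_if_meet[of "x i"]) (auto simp: pbox_def)
  then show ?thesis unfolding pbox_def by (auto simp: PiE_iff)
qed

text \<open>Boxes on which translation by v is a mere relabelling f to f + v. They still form a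
  base, since at late levels the shifted coordinates of any point are admissible, so measures can be
  compared on such boxes alone.\<close>

definition boxes :: "nat set \<Rightarrow> (nat \<Rightarrow> int) \<Rightarrow> (nat \<Rightarrow> cf_point) set set" where
  "boxes I v = {pbox I n f | n f. \<forall>i\<in>I. f i \<in> chacon_F n \<and> f i + v i \<in> chacon_F n}"

lemma box_in_boxes: "\<forall>i\<in>I. f i \<in> chacon_F n \<and> f i + v i \<in> chacon_F n \<Longrightarrow> pbox I n f \<in> boxes I v"
  unfolding boxes_def by blast

lemma countable_boxes:
  assumes "finite I" shows "countable (boxes I v)"
proof -
  have "boxes I v \<subseteq> (\<lambda>(n, f). pbox I n f) ` (SIGMA n:UNIV. PiE I (\<lambda>_. chacon_F n))"
  proof
    fix b assume "b \<in> boxes I v"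
    then obtain n f where nf: "b = pbox I n f" "\<forall>i\<in>I. f i \<in> chacon_F n" by (auto simp: boxes_def)
    have "b = pbox I n (restrict f I)" unfolding nf by (intro box_cong) simp
    then show "b \<in> (\<lambda>(n, f). pbox I n f) ` (SIGMA n:UNIV. PiE I (\<lambda>_. chacon_F n))"
      using nf by (intro image_eqI[of _ _ "(n, restrict f I)"]) auto
  qed
  moreover have "countable (SIGMA n:UNIV. PiE I (\<lambda>_. chacon_F n))"
    using assms by (intro countable_SIGMA countable_PiE) auto
  ultimately show ?thesis by (meson countable_image countable_subset)
qed

lemma ev_pX:
  assumes "finite I" "x \<in> pS I"
  shows "\<forall>\<^sub>F n in sequentially. \<forall>i\<in>I. x i \<in> cX n \<and> co n (x i) + v i \<in> chacon_F n"
  using assms by (intro eventually_ball_finite ballI C.cf_ev_large) (auto simp: pS_def)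

lemma pX_level:
  assumes "finite I" "x \<in> pS I"
  obtains n where "n \<ge> m" "\<forall>i\<in>I. x i \<in> cX n" "\<forall>i\<in>I. co n (x i) + v i \<in> chacon_F n"
  using eventually_happens[OF eventually_conj[OF ev_pX[OF assms, of v] eventually_ge_at_top[of m]]] that
  by auto

lemma boxes_base:
  assumes "finite I" "openin (chacon_pow_top I) U" "x \<in> U"
  shows "\<exists>e\<in>boxes I v. x \<in> e \<and> e \<subseteq> U"
proof -
  obtain V where V: "\<And>i. i \<in> I \<Longrightarrow> openin chacon_top (V i)" "x \<in> PiE I V" "PiE I V \<subseteq> U"
    using assms(2,3) unfolding openin_product_topology_alt by meson
  have "\<forall>i\<in>I. \<exists>n0. x i \<in> cX n0 \<and> (\<forall>n\<ge>n0. cf_cyl chacon_C n (co n (x i)) \<subseteq> V i)"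
    using V by (intro ballI C.cf_top_base) auto
  then obtain N where N: "\<And>i. i \<in> I \<Longrightarrow> x i \<in> cX (N i)"
     "\<And>i n. i \<in> I \<Longrightarrow> n \<ge> N i \<Longrightarrow> cf_cyl chacon_C n (co n (x i)) \<subseteq> V i" by metis
  obtain M0 where M0: "\<And>i. i \<in> I \<Longrightarrow> N i \<le> M0" using assms(1) finite_nat_set_iff_bounded_le[of "N ` I"] by auto
  have "x \<in> pS I" using assms(2,3) openin_subset topspace_pow by blast
  then obtain M where M: "M0 \<le> M" "\<forall>i\<in>I. x i \<in> cX M" "\<forall>i\<in>I. co M (x i) + v i \<in> chacon_F M"
    using pX_level[OF assms(1)] by metis
  have ext: "x \<in> extensional I" using V(2) by (auto simp: PiE_iff)
  have "x \<in> pbox I M (\<lambda>i. co M (x i))" using self_box[OF ext M(2)] .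
  moreover have "pbox I M (\<lambda>i. co M (x i)) \<in> boxes I v"
    using M C.cf_co_F by (intro box_in_boxes) blast
  moreover have "cf_cyl chacon_C M (co M (x i)) \<subseteq> V i" if "i \<in> I" for i
    using N(2)[OF that, of M] M0[OF that] M(1) by simp
  then have "pbox I M (\<lambda>i. co M (x i)) \<subseteq> PiE I V"
    unfolding pbox_def by (intro PiE_mono)
  ultimately show ?thesis
    using V(3) by (intro bexI[of _ "pbox I M (\<lambda>i. co M (x i))"] conjI) simp_all
qed

lemma sets_pB:
  assumes "finite I"
  shows "sets (pB I) = sigma_sets (pS I) (boxes I v)"
proof -
  have "openin (chacon_pow_top I) e" if "e \<in> boxes I v" for e
    using that openin_box[OF assms] unfolding boxes_def by blast
  then show ?thesis
    unfolding topspace_pow[symmetric]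
    using boxes_base[OF assms] by (intro sets_borel_of_base countable_boxes assms)
qed

lemma Union_boxes:
  assumes I: "finite I"
  shows "\<Union>(boxes I v) = pS I"
proof (intro equalityI subsetI)
  fix x assume x: "x \<in> pS I"
  obtain n where n: "\<forall>i\<in>I. x i \<in> cX n" "\<forall>i\<in>I. co n (x i) + v i \<in> chacon_F n"
    using pX_level[OF I x] by metis
  then have "x \<in> pbox I n (\<lambda>i. co n (x i))" "pbox I n (\<lambda>i. co n (x i)) \<in> boxes I v"
    using self_box[OF pS_extensional[OF x], of n] C.cf_co_F by (auto intro: box_in_boxes)
  then show "x \<in> \<Union>(boxes I v)" by blast
qed (use box_sub in \<open>auto simp: boxes_def\<close>)

text \<open>There are only countably many boxes, so a set that contains a box around each of its
  points is a countable union of boxes. Most measurability proofs below reduce to this local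
  condition.\<close>

lemma box_open_sets:
  assumes "finite I" "A \<subseteq> pS I"
    and "\<And>x. x \<in> A \<Longrightarrow> \<exists>n. (\<forall>i\<in>I. x i \<in> cX n) \<and> pbox I n (\<lambda>i. co n (x i)) \<subseteq> A"
  shows "A \<in> sets (pB I)"
proof -
  have "A = \<Union>{b \<in> boxes I (\<lambda>_. 0). b \<subseteq> A}"
  proof (intro equalityI subsetI)
    fix x assume x: "x \<in> A"
    then obtain n where n: "\<forall>i\<in>I. x i \<in> cX n" "pbox I n (\<lambda>i. co n (x i)) \<subseteq> A"
      using assms(3) by blast
    have "x \<in> pbox I n (\<lambda>i. co n (x i))"
      using x assms(2) n by (intro self_box) (auto simp: pS_def PiE_iff)
    moreover have "pbox I n (\<lambda>i. co n (x i)) \<in> boxes I (\<lambda>_. 0)" using n C.cf_co_F by (intro box_in_boxes) simp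
    ultimately show "x \<in> \<Union>{b \<in> boxes I (\<lambda>_. 0). b \<subseteq> A}" using n by blast
  qed auto
  also have "\<dots> \<in> sets (pB I)"
  proof (rule sets.countable_Union)
    show "countable {b \<in> boxes I (\<lambda>_. 0). b \<subseteq> A}"
      by (rule countable_subset[OF _ countable_boxes[OF assms(1), of "\<lambda>_. 0"]]) blast
    show "{b \<in> boxes I (\<lambda>_. 0). b \<subseteq> A} \<subseteq> sets (pB I)"
      using box_sets[OF assms(1)] by (auto simp: boxes_def)
  qed
  finally show ?thesis .
qed

lemma box_measure_eqI:
  assumes I: "finite I" and M: "sets M = sets (pB I)" and N: "sets N = sets (pB I)"
    and eq: "\<And>n f. \<forall>i\<in>I. f i \<in> chacon_F n \<and> f i + v i \<in> chacon_F n \<Longrightarrow> emeasure M (pbox I n f) = emeasure N (pbox I n f)"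
    and fin: "\<And>n f. \<forall>i\<in>I. f i \<in> chacon_F n \<and> f i + v i \<in> chacon_F n \<Longrightarrow> emeasure M (pbox I n f) \<noteq> \<infinity>"
  shows "M = N"
proof (rule measure_eqI_generator_eq_countable[where E = "insert {} (boxes I v)" and A = "boxes I v" and \<Omega> = "pS I"])
  have "a \<inter> b \<in> insert {} (boxes I v)" if ab: "a \<in> boxes I v" "b \<in> boxes I v" for a b
  proof (cases "a \<inter> b = {}")
    case False
    then obtain x where x: "x \<in> a" "x \<in> b" by blast
    obtain n f m g where nm: "a = pbox I n f" "b = pbox I m g" using ab unfolding boxes_def by blast
    then have "a \<subseteq> b \<or> b \<subseteq> a"
      using x box_sub_if_meet[of x] nat_le_linear[of n m] by metis
    then have "a \<inter> b = a \<or> a \<inter> b = b" by blast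
    then show ?thesis using ab by auto
  qed auto
  then show "Int_stable (insert {} (boxes I v))" unfolding Int_stable_def by auto
  show "insert {} (boxes I v) \<subseteq> Pow (pS I)" using Union_boxes[OF I] by auto
  have "sigma_sets (pS I) (insert {} (boxes I v)) = sigma_sets (pS I) (boxes I v)"
    by (rule sigma_sets_eqI) (auto simp: sigma_sets.Empty)
  then show "sets M = sigma_sets (pS I) (insert {} (boxes I v))" "sets N = sigma_sets (pS I) (insert {} (boxes I v))"
    using M N sets_pB[OF I, of v] by auto
qed (use eq fin countable_boxes Union_boxes I in \<open>auto simp: boxes_def\<close>)

section \<open>Coordinatewise translations\<close>

lemma pT_pS: "x \<in> pS I \<Longrightarrow> pT I v x \<in> pS I"
  by (auto simp: pS_def pT_def PiE_iff C.cf_T_space)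

lemma pT_add: "x \<in> pS I \<Longrightarrow> pT I v (pT I w x) = pT I (\<lambda>i. v i + w i) x"
  by (auto simp: pS_def pT_def PiE_iff C.cf_T_add restrict_def fun_eq_iff)

lemma pT_0: "x \<in> pS I \<Longrightarrow> pT I (\<lambda>_. 0) x = x"
  by (auto simp: pS_def pT_def PiE_iff C.cf_T_0 restrict_def fun_eq_iff extensional_def)

lemma pT_inv: "x \<in> pS I \<Longrightarrow> pT I (\<lambda>i. - v i) (pT I v x) = x" "x \<in> pS I \<Longrightarrow> pT I v (pT I (\<lambda>i. - v i) x) = x"
  by (auto simp: pT_add pT_0)

lemma pT_co:
  assumes "\<forall>i\<in>I. x i \<in> cX n" "\<forall>i\<in>I. co n (x i) + v i \<in> chacon_F n" "i \<in> I"
  shows "pT I v x i \<in> cX n" "n \<le> k \<Longrightarrow> co k (pT I v x i) = co k (x i) + v i"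
  using assms C.cf_T_co by (auto simp: pT_def)

lemma pT_box_sub:
  assumes "\<forall>i\<in>I. f i + v i \<in> chacon_F n" "x \<in> pbox I n f"
  shows "pT I v x \<in> pbox I n (\<lambda>i. f i + v i)"
proof -
  have "\<forall>i\<in>I. x i \<in> cX n" "\<forall>i\<in>I. co n (x i) + v i \<in> chacon_F n"
    using assms by (auto simp: mem_box_iff)
  then show ?thesis using pT_co[of I x n v] assms(2) by (auto simp: mem_box_iff) (simp add: pT_def)
qed

lemma pT_box:
  assumes "\<forall>i\<in>I. f i \<in> chacon_F n" "\<forall>i\<in>I. f i + v i \<in> chacon_F n"
  shows "pT I v -` pbox I n (\<lambda>i. f i + v i) \<inter> pS I = pbox I n f"
proof (intro equalityI subsetI)
  fix x assume x: "x \<in> pT I v -` pbox I n (\<lambda>i. f i + v i) \<inter> pS I"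
  have "pT I (\<lambda>i. - v i) (pT I v x) \<in> pbox I n (\<lambda>i. (f i + v i) + - v i)"
    using x assms by (intro pT_box_sub[where f = "\<lambda>i. f i + v i" and v = "\<lambda>i. - v i"]) simp_all
  moreover have "pT I (\<lambda>i. - v i) (pT I v x) = x" using x by (intro pT_inv) simp
  ultimately show "x \<in> pbox I n f" by simp
qed (use assms pT_box_sub box_sub in fastforce)

lemma pT_measurable:
  assumes I: "finite I"
  shows "pT I v \<in> measurable (pB I) (pB I)"
proof (rule measurable_sigma_sets[OF sets_pB[OF I, of "\<lambda>_. 0"]])
  show "boxes I (\<lambda>_. 0) \<subseteq> Pow (pS I)" using Union_boxes[OF I, of "\<lambda>_. 0"] by auto
  show "pT I v \<in> space (pB I) \<rightarrow> pS I" by (auto simp: space_pB pT_pS)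
  fix B assume "B \<in> boxes I (\<lambda>_. 0)"
  then obtain n f where B: "B = pbox I n f" "\<forall>i\<in>I. f i \<in> chacon_F n" by (auto simp: boxes_def)
  show "pT I v -` B \<inter> space (pB I) \<in> sets (pB I)"
  proof (rule box_open_sets[OF I])
    fix x assume x: "x \<in> pT I v -` B \<inter> space (pB I)"
    then have xS: "x \<in> pS I" by (simp add: space_pB)
    obtain m where m: "m \<ge> n" "\<forall>i\<in>I. x i \<in> cX m" "\<forall>i\<in>I. co m (x i) + v i \<in> chacon_F m"
      using pX_level[OF I xS] by metis
    have xb: "x \<in> pbox I m (\<lambda>i. co m (x i))" using self_box[OF pS_extensional[OF xS] m(2)] .
    have "pT I v x \<in> pbox I m (\<lambda>i. co m (x i) + v i)" by (rule pT_box_sub[OF m(3) xb])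
    then have "pbox I m (\<lambda>i. co m (x i) + v i) \<subseteq> B"
      using x m(1) box_sub_if_meet[of "pT I v x" I n f m] by (auto simp: B(1))
    then have "pbox I m (\<lambda>i. co m (x i)) \<subseteq> pT I v -` B \<inter> space (pB I)"
      using pT_box_sub[OF m(3)] box_sub by (auto simp: space_pB)
    then show "\<exists>n. (\<forall>i\<in>I. x i \<in> cX n) \<and> pbox I n (\<lambda>i. co n (x i)) \<subseteq> pT I v -` B \<inter> space (pB I)"
      using m by blast
  qed (simp add: space_pB)
qed

section \<open>Ergodic measures\<close>

lemma distr_eq_if_invariant:
  assumes "invariant_measure T M" shows "distr M M T = M"
  using assms by (intro measure_eqI) (auto simp: invariant_measure_def emeasure_distr)

lemma AE_invariant_measure:
  assumes "invariant_measure T M" "AE x in M. P x"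
  shows "AE x in M. P (T x)"
proof (rule AE_distrD[where f = T and P = P and M' = M])
  show "T \<in> measurable M M" using assms(1) by (simp add: invariant_measure_def)
  show "AE x in distr M M T. P x" unfolding distr_eq_if_invariant[OF assms(1)] by (rule assms(2))
qed

text \<open>The strictly invariant set \<open>B\<close> of points whose orbit is eventually in \<open>A\<close> agrees with
  the almost invariant set \<open>A\<close> up to a null set.\<close>
lemma ergodic_measure_AE:
  assumes erg: "ergodic_measure T M" and A: "A \<in> sets M"
    and inv: "AE x in M. T x \<in> A \<longleftrightarrow> x \<in> A"
  shows "(AE x in M. x \<in> A) \<or> (AE x in M. x \<notin> A)"
proof -
  have im: "invariant_measure T M" and T: "T \<in> measurable M M"
    using erg by (auto simp: ergodic_measure_def invariant_measure_def)
  have Tn: "(T ^^ n) \<in> measurable M M" for n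
    by (induction n) (use T in \<open>auto intro: measurable_compose simp: o_def\<close>)
  define B where "B = {x \<in> space M. \<exists>N. \<forall>n\<ge>N. (T ^^ n) x \<in> A}"
  have "B = (\<Union>N. \<Inter>n\<in>{N..}. (T ^^ n) -` A \<inter> space M)"
    by (auto simp: B_def)
  also have "\<dots> \<in> sets M"
    using Tn A by (intro sets.countable_UN sets.countable_INT' image_subsetI measurable_sets) auto
  finally have B: "B \<in> sets M" .
  have "T -` B \<inter> space M = B"
  proof (intro equalityI subsetI)
    fix x assume "x \<in> T -` B \<inter> space M"
    then obtain N where "x \<in> space M" "\<forall>n\<ge>N. (T ^^ n) (T x) \<in> A" by (auto simp: B_def)
    then have "\<forall>n\<ge>Suc N. (T ^^ n) x \<in> A"
      by (metis Suc_le_D Suc_le_mono comp_apply funpow_Suc_right)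
    then show "x \<in> B" using \<open>x \<in> space M\<close> by (auto simp: B_def)
  next
    fix x assume "x \<in> B"
    then obtain N where N: "x \<in> space M" "\<forall>n\<ge>N. (T ^^ n) x \<in> A" by (auto simp: B_def)
    then have "\<forall>n\<ge>N. (T ^^ n) (T x) \<in> A"
      by (metis comp_apply funpow_Suc_right le_SucI)
    then show "x \<in> T -` B \<inter> space M"
      using N(1) T by (auto simp: B_def dest: measurable_space)
  qed
  then have "emeasure M B = 0 \<or> emeasure M (space M - B) = 0"
    using erg B by (auto simp: ergodic_measure_def)
  moreover have BA: "AE x in M. x \<in> B \<longleftrightarrow> x \<in> A"
  proof -
    have "AE x in M. (T ^^ Suc n) x \<in> A \<longleftrightarrow> (T ^^ n) x \<in> A" for n
    proof (induction n)
      case (Suc n)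
      have "AE x in M. (T ^^ Suc n) (T x) \<in> A \<longleftrightarrow> (T ^^ n) (T x) \<in> A"
        by (rule AE_invariant_measure[OF im Suc])
      then show ?case by (simp only: funpow_Suc_right o_apply)
    qed (use inv in simp)
    then have "AE x in M. \<forall>n. (T ^^ Suc n) x \<in> A \<longleftrightarrow> (T ^^ n) x \<in> A"
      by (simp add: AE_all_countable)
    then show ?thesis
    proof (rule AE_mp, intro AE_I2 impI)
      fix x assume x: "x \<in> space M" "\<forall>n. (T ^^ Suc n) x \<in> A \<longleftrightarrow> (T ^^ n) x \<in> A"
      have "(T ^^ n) x \<in> A \<longleftrightarrow> x \<in> A" for n
        using x(2) by (induction n) auto
      then show "x \<in> B \<longleftrightarrow> x \<in> A" using x(1) by (auto simp: B_def)
    qed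
  qed
  moreover have "emeasure M B = 0 \<Longrightarrow> AE x in M. x \<notin> B"
    using B by (auto simp: AE_iff_measurable[OF B] intro!: AE_not_in null_setsI)
  moreover have "emeasure M (space M - B) = 0 \<Longrightarrow> AE x in M. x \<in> B"
    using B by (intro AE_I[of _ _ "space M - B"]) auto
  moreover have "AE x in M. x \<notin> A" if "AE x in M. x \<notin> B"
    using that BA by eventually_elim simp
  moreover have "AE x in M. x \<in> A" if "AE x in M. x \<in> B"
    using that BA by eventually_elim simp
  ultimately show ?thesis by blast
qed

text \<open>The density of N with respect to M is invariant almost everywhere, by uniqueness of the
  Radon-Nikodym derivative and invertibility of T; ergodicity makes it almost everywhere constant,
  and N \<le> M bounds the constant by 1.\<close>

lemma ergodic_measure_proportional:
  assumes "sigma_finite_measure M" and erg: "ergodic_measure T M"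
    and T': "T' \<in> measurable M M" "\<And>x. x \<in> space M \<Longrightarrow> T' (T x) = x" "\<And>x. x \<in> space M \<Longrightarrow> T (T' x) = x"
    and N: "sets N = sets M" "\<And>A. A \<in> sets M \<Longrightarrow> emeasure N A \<le> emeasure M A"
    and Ninv: "\<And>A. A \<in> sets M \<Longrightarrow> emeasure N (T -` A \<inter> space M) = emeasure N A"
  obtains p :: real where "0 \<le> p" "p \<le> 1" "\<And>A. A \<in> sets M \<Longrightarrow> emeasure N A = ennreal p * emeasure M A"
proof (cases "emeasure M (space M) = 0")
  case True
  have "emeasure N A = ennreal 0 * emeasure M A" if "A \<in> sets M" for A
    using N(2)[OF that] emeasure_space[of M A] True by simp
  then show ?thesis using that[of 0] by auto
next
  case False
  interpret sigma_finite_measure M by fact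
  have im: "invariant_measure T M" and T: "T \<in> measurable M M"
    using erg by (auto simp: ergodic_measure_def invariant_measure_def)
  have ac: "absolutely_continuous M N"
    unfolding absolutely_continuous_def
  proof
    fix A assume "A \<in> null_sets M"
    then show "A \<in> null_sets N" using N(2)[of A] N(1) by (auto simp: null_sets_def)
  qed
  define f where "f = RN_deriv M N"
  have f[measurable]: "f \<in> borel_measurable M" by (simp add: f_def)
  have fN: "density M f = N" unfolding f_def by (rule density_RN_deriv[OF ac N(1)])
  have fT: "(\<lambda>x. f (T x)) \<in> borel_measurable M" using T f by (rule measurable_compose)
  have "density M (\<lambda>x. f (T x)) = N"
  proof (rule measure_eqI)
    fix A assume "A \<in> sets (density M (\<lambda>x. f (T x)))"
    then have A: "A \<in> sets M" by simp
    \<comment> \<open>The image of A under T, written as a preimage under the inverse so that it is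
      visibly measurable.\<close>
    define A' where "A' = T' -` A \<inter> space M"
    have A': "A' \<in> sets M" using T'(1) A by (simp add: A'_def measurable_sets)
    have TA': "T -` A' \<inter> space M = A"
      using T'(2) T sets.sets_into_space[OF A] by (auto simp: A'_def dest: measurable_space)
    have "emeasure (density M (\<lambda>x. f (T x))) A = (\<integral>\<^sup>+x. f (T x) * indicator A x \<partial>M)"
      by (rule emeasure_density[OF fT A])
    also have "\<dots> = (\<integral>\<^sup>+x. f (T x) * indicator A' (T x) \<partial>M)"
      using TA' by (intro nn_integral_cong) (auto simp: indicator_def)
    also have "\<dots> = (\<integral>\<^sup>+x. f x * indicator A' x \<partial>distr M M T)"
      using A' by (subst nn_integral_distr[OF T]) auto
    also have "\<dots> = emeasure N A'"
      unfolding distr_eq_if_invariant[OF im] fN[symmetric] using A' by (simp add: emeasure_density)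
    also have "\<dots> = emeasure N A"
      using Ninv[OF A'] TA' by simp
    finally show "emeasure (density M (\<lambda>x. f (T x))) A = emeasure N A" .
  qed (simp add: N)
  then have inv: "AE x in M. f (T x) = f x"
    using RN_deriv_unique[OF fT] unfolding f_def by simp
  \<comment> \<open>Constancy of an invariant function: f lies almost always or almost never in each
    of countably many basic open sets. Any point compatible with all these decisions carries the
    almost sure value, since the basic sets separate values.\<close>
  obtain \<B> :: "ennreal set set" where \<B>: "countable \<B>" "topological_basis \<B>"
    using ex_countable_basis by blast
  have dich: "(AE x in M. f x \<in> U) \<or> (AE x in M. f x \<notin> U)" if "U \<in> \<B>" for U
  proof -
    have "open U" using \<B>(2) that by (auto simp: topological_basis_def)
    then have UM: "f -` U \<inter> space M \<in> sets M" using f by (auto intro: measurable_sets)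
    have "AE x in M. T x \<in> f -` U \<inter> space M \<longleftrightarrow> x \<in> f -` U \<inter> space M"
      using inv by (rule AE_mp) (use T in \<open>auto dest: measurable_space intro!: AE_I2\<close>)
    then show ?thesis
      using ergodic_measure_AE[OF erg UM] by (auto elim!: AE_mp intro: AE_I2)
  qed
  have cut: "AE x in M. \<forall>U\<in>\<B>. f x \<in> U \<longleftrightarrow> (AE y in M. f y \<in> U)"
  proof (subst AE_ball_countable[OF \<B>(1)], intro ballI)
    fix U assume "U \<in> \<B>"
    show "AE x in M. f x \<in> U \<longleftrightarrow> (AE y in M. f y \<in> U)"
    proof (cases "AE y in M. f y \<in> U")
      case False
      then have "AE y in M. f y \<notin> U" using dich[OF \<open>U \<in> \<B>\<close>] by auto
      then show ?thesis using False by auto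
    qed auto
  qed
  have "\<not> (AE x in M. False)"
    using False AE_iff_measurable[OF sets.top, of M "\<lambda>_. False"] by auto
  then have "\<exists>x0. \<forall>U\<in>\<B>. f x0 \<in> U \<longleftrightarrow> (AE y in M. f y \<in> U)"
  proof (rule contrapos_np)
    assume "\<nexists>x0. \<forall>U\<in>\<B>. f x0 \<in> U \<longleftrightarrow> (AE y in M. f y \<in> U)"
    then show "AE x in M. False" using cut by (auto elim!: eventually_mono)
  qed
  then obtain x0 where x0: "\<forall>U\<in>\<B>. f x0 \<in> U \<longleftrightarrow> (AE y in M. f y \<in> U)"
    by blast
  define q where "q = f x0"
  have fq: "AE x in M. f x = q"
  proof (rule AE_mp[OF cut], intro AE_I2 impI)
    fix x assume x: "\<forall>U\<in>\<B>. f x \<in> U \<longleftrightarrow> (AE y in M. f y \<in> U)"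
    show "f x = q"
    proof (rule ccontr)
      assume "f x \<noteq> q"
      then obtain U where U: "open U" "f x \<in> U" "q \<notin> U" using t1_space by blast
      then obtain V where "V \<in> \<B>" "f x \<in> V" "V \<subseteq> U"
        using topological_basisE[OF \<B>(2)] by metis
      then show False using x x0 U by (auto simp: q_def)
    qed
  qed
  have Nq: "emeasure N A = q * emeasure M A" if A: "A \<in> sets M" for A
  proof -
    have "emeasure N A = (\<integral>\<^sup>+x. f x * indicator A x \<partial>M)"
      unfolding fN[symmetric] using A by (simp add: emeasure_density)
    also have "\<dots> = (\<integral>\<^sup>+x. q * indicator A x \<partial>M)"
      using fq by (intro nn_integral_cong_AE) auto
    finally show ?thesis using A by (simp add: nn_integral_cmult_indicator)
  qed
  obtain A :: "nat \<Rightarrow> 'a set" where A: "range A \<subseteq> sets M" "(\<Union>i. A i) = space M" "\<And>i. emeasure M (A i) \<noteq> \<infinity>"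
    using sigma_finite by metis
  have "\<exists>i. emeasure M (A i) \<noteq> 0"
  proof (rule ccontr)
    assume "\<not> (\<exists>i. emeasure M (A i) \<noteq> 0)"
    then have "A i \<in> null_sets M" for i using A(1) by (auto intro!: null_setsI)
    then have "(\<Union>i. A i) \<in> null_sets M" by (rule null_sets_UN)
    then show False using False A(2) by auto
  qed
  then obtain i where i: "emeasure M (A i) \<noteq> 0" by blast
  have "q * emeasure M (A i) \<le> 1 * emeasure M (A i)"
    using Nq[of "A i"] N(2)[of "A i"] A(1) by auto
  then have "q \<le> 1"
    using i A(3)[of i] ennreal_mult_le_mult_iff[of "emeasure M (A i)" q 1] by (simp add: mult.commute)
  then obtain p where "q = ennreal p" "0 \<le> p" "p \<le> 1"
    by (cases q) (auto simp: top_unique)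
  then show ?thesis using that[of p] Nq by auto
qed

text \<open>The power of the compact space [0, \<infinity>] is compact by Tychonoff, but for a large
  index set not sequentially compact. Hence a cluster point of the image filter rather than the
  limit of a subsequence; it inherits every closed condition that holds eventually.\<close>

lemma cluster_point_ennreal:
  fixes u :: "nat \<Rightarrow> 'b \<Rightarrow> ennreal"
  obtains g where "\<And>S. closed S \<Longrightarrow> (\<forall>\<^sub>F k in sequentially. u k \<in> S) \<Longrightarrow> g \<in> S"
proof -
  have "compactin (product_topology (\<lambda>_::'b. euclidean :: ennreal topology) UNIV) (PiE UNIV (\<lambda>_. UNIV))"
    unfolding compactin_PiE using compact_UNIV by auto
  then have "compact (UNIV :: ('b \<Rightarrow> ennreal) set)"
    unfolding euclidean_product_topology by simp
  then obtain g where g: "inf (nhds g) (filtermap u sequentially) \<noteq> bot"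
    unfolding compact_filter by (auto dest!: spec[of _ "filtermap u sequentially"] simp: filtermap_bot_iff)
  show ?thesis
  proof (rule that)
    fix S assume S: "closed S" "\<forall>\<^sub>F k in sequentially. u k \<in> S"
    show "g \<in> S"
    proof (rule ccontr)
      assume "g \<notin> S"
      then have "eventually (\<lambda>h. h \<in> - S) (nhds g)"
        using S(1) by (intro eventually_nhds_in_open) auto
      moreover have "eventually (\<lambda>h. h \<in> S) (filtermap u sequentially)"
        using S(2) by (simp add: eventually_filtermap)
      ultimately have "eventually (\<lambda>h. False) (inf (nhds g) (filtermap u sequentially))"
        unfolding eventually_inf by (intro exI[of _ "\<lambda>h. h \<in> - S"] exI[of _ "\<lambda>h. h \<in> S"]) auto
      then show False using g by (simp add: eventually_False)
    qed
  qed
qed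

text \<open>A substitute for weak compactness: a cluster point of the set functions
  \<open>\<lambda>B. L (B \<inter> A k)\<close> in a power of \<open>[0, \<infinity>]\<close> is finitely additive, and countably additive
  inside each \<open>X m\<close> because it is dominated by \<open>L\<close>. Closed relations pass to the cluster point.\<close>
lemma cluster_measure:
  fixes L :: "'a measure" and X :: "nat \<Rightarrow> 'a set"
  assumes X: "\<And>m. X m \<in> sets L" "incseq X" "(\<Union>m. X m) = space L" "\<And>m. emeasure L (X m) \<noteq> \<infinity>"
    and A: "\<And>k. A k \<in> sets L"
  obtains N where "sets N = sets L" "\<And>B. B \<in> sets L \<Longrightarrow> emeasure N B \<le> emeasure L B"
    and "\<And>B C m. B \<in> sets L \<Longrightarrow> C \<in> sets L \<Longrightarrow> B \<subseteq> X m \<Longrightarrow> C \<subseteq> X m \<Longrightarrow>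
           \<forall>\<^sub>F k in sequentially. emeasure L (B \<inter> A k) = emeasure L (C \<inter> A k) \<Longrightarrow>
           emeasure N B = emeasure N C"
    and "\<And>B C m. B \<in> sets L \<Longrightarrow> C \<in> sets L \<Longrightarrow> B \<subseteq> X m \<Longrightarrow> C \<subseteq> X m \<Longrightarrow>
           \<forall>\<^sub>F k in sequentially. emeasure L (B \<inter> A k) + emeasure L (C \<inter> A k) = emeasure L C \<Longrightarrow>
           emeasure N B + emeasure N C = emeasure L C"
proof -
  obtain g where g: "\<And>S. closed S \<Longrightarrow> (\<forall>\<^sub>F k in sequentially. (\<lambda>B. emeasure L (B \<inter> A k)) \<in> S) \<Longrightarrow> g \<in> S"
    using cluster_point_ennreal[of "\<lambda>k B. emeasure L (B \<inter> A k)"] by metis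
  have cont: "continuous_on UNIV (\<lambda>h :: 'a set \<Rightarrow> ennreal. h B)" for B
    by simp
  have g_le: "g B \<le> emeasure L B" if "B \<in> sets L" for B
  proof -
    have "closed {h :: 'a set \<Rightarrow> ennreal. h B \<le> emeasure L B}"
      by (intro closed_Collect_le cont continuous_on_const)
    moreover have "emeasure L (B \<inter> A k) \<le> emeasure L B" for k
      using that by (intro emeasure_mono) auto
    ultimately show ?thesis using g[of "{h. h B \<le> emeasure L B}"] by simp
  qed
  have g_add: "g (B \<union> C) = g B + g C" if "B \<in> sets L" "C \<in> sets L" "B \<inter> C = {}" for B C
  proof -
    have "closed {h :: 'a set \<Rightarrow> ennreal. h (B \<union> C) = h B + h C}"
      by (intro closed_Collect_eq cont continuous_on_add_ennreal)
    moreover have "emeasure L ((B \<union> C) \<inter> A k) = emeasure L (B \<inter> A k) + emeasure L (C \<inter> A k)" for k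
      using that A[of k] by (subst plus_emeasure) (auto intro!: arg_cong[where f = "emeasure L"])
    ultimately show ?thesis using g[of "{h. h (B \<union> C) = h B + h C}"] by simp
  qed
  have g_empty: "g {} = 0" using g_le[of "{}"] by simp
  have g_mono: "g B \<le> g C" if "B \<in> sets L" "C \<in> sets L" "B \<subseteq> C" for B C
    using g_add[of B "C - B"] that by (auto simp: Un_absorb1)
  have g_sum: "(\<Sum>i. g (B i \<inter> X m)) = g ((\<Union>i. B i) \<inter> X m)"
    if B: "range B \<subseteq> sets L" "disjoint_family B" for B :: "nat \<Rightarrow> 'a set" and m
  proof -
    define R where "R n = (\<Union>i\<in>{n..}. B i) \<inter> X m" for n
    have Rs: "R n \<in> sets L" for n using B(1) X(1) by (auto simp: R_def)
    have Bs: "B i \<in> sets L" for i using B(1) by auto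
    have step: "g (R n) = g (B n \<inter> X m) + g (R (Suc n))" for n
    proof -
      have "R n = (B n \<inter> X m) \<union> R (Suc n)"
      proof -
        have "{n..} = insert n {Suc n..}" by auto
        then show ?thesis by (auto simp: R_def)
      qed
      moreover have "(B n \<inter> X m) \<inter> R (Suc n) = {}"
      proof -
        have "B n \<inter> B i = {}" if "i \<ge> Suc n" for i
          using B(2) that by (intro disjoint_family_onD) auto
        then show ?thesis by (auto simp: R_def)
      qed
      ultimately show ?thesis using g_add[of "B n \<inter> X m" "R (Suc n)"] Rs Bs X(1) by auto
    qed
    have split: "g (R 0) = (\<Sum>i<n. g (B i \<inter> X m)) + g (R n)" for n
    proof (induction n)
      case (Suc n)
      then show ?case using step[of n] by (simp add: add.assoc)
    qed simp
    have "(\<lambda>n. emeasure L (R n)) \<longlonglongrightarrow> emeasure L (\<Inter>n. R n)"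
    proof (rule Lim_emeasure_decseq)
      show "emeasure L (R n) \<noteq> \<infinity>" for n
        using X(4)[of m] emeasure_mono[of "R n" "X m" L] X(1)[of m] by (auto simp: R_def top_unique)
      show "decseq R"
        unfolding decseq_def R_def by (intro allI impI Int_mono UN_mono) auto
    qed (use Rs in auto)
    moreover have "(\<Inter>n. R n) = {}"
    proof (rule ccontr)
      assume "(\<Inter>n. R n) \<noteq> {}"
      then obtain x where x: "\<And>n. x \<in> R n" by blast
      from x[of 0] obtain i where i: "x \<in> B i" by (auto simp: R_def)
      from x[of "Suc i"] obtain j where "j > i" "x \<in> B j" by (auto simp: R_def Suc_le_eq)
      then show False using i disjoint_family_onD[OF B(2), of i j] by auto
    qed
    ultimately have "(\<lambda>n. emeasure L (R n)) \<longlonglongrightarrow> 0" by simp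
    then have "(\<lambda>n. g (R n)) \<longlonglongrightarrow> 0"
      by (rule tendsto_sandwich[OF _ _ tendsto_const, rotated 2]) (auto intro!: g_le Rs always_eventually)
    then have "(\<lambda>n. (\<Sum>i<n. g (B i \<inter> X m)) + g (R n)) \<longlonglongrightarrow> (\<Sum>i. g (B i \<inter> X m)) + 0"
      by (intro tendsto_add summable_LIMSEQ) auto
    then have "(\<lambda>n. g (R 0)) \<longlonglongrightarrow> (\<Sum>i. g (B i \<inter> X m))"
      unfolding split[symmetric] by simp
    then have "g (R 0) = (\<Sum>i. g (B i \<inter> X m))" by (simp add: LIMSEQ_const_iff)
    then show ?thesis by (simp add: R_def)
  qed
  \<comment> \<open>On sets of infinite measure domination by L gives no continuity and g may fail
    to be countably additive; its values inside the sets \<open>X m\<close> are therefore extended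
    by exhaustion.\<close>
  define \<nu> where "\<nu> B = (SUP m. g (B \<inter> X m))" for B
  have inc: "incseq (\<lambda>m. g (B \<inter> X m))" if "B \<in> sets L" for B
    using that X(1,2) by (intro incseq_SucI g_mono) (auto simp: incseq_Suc_iff)
  have ca: "countably_additive (sets L) \<nu>"
    unfolding countably_additive_def
  proof (intro allI impI)
    fix B :: "nat \<Rightarrow> 'a set" assume B: "range B \<subseteq> sets L" "disjoint_family B"
    have "(\<Sum>i. \<nu> (B i)) = (SUP m. \<Sum>i. g (B i \<inter> X m))"
      unfolding \<nu>_def using inc B by (intro ennreal_suminf_SUP_eq) auto
    then show "(\<Sum>i. \<nu> (B i)) = \<nu> (\<Union>i. B i)"
      by (simp add: g_sum[OF B] \<nu>_def)
  qed
  define N where "N = measure_of (space L) (sets L) \<nu>"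
  have N: "emeasure N B = \<nu> B" if "B \<in> sets L" for B
    unfolding N_def using ca that g_empty
    by (intro emeasure_measure_of_sigma sets.sigma_algebra_axioms) (auto simp: positive_def \<nu>_def)
  have Ng: "emeasure N B = g B" if B: "B \<in> sets L" "B \<subseteq> X m" for B m
  proof -
    have "g (B \<inter> X k) \<le> g B" for k using B X(1) by (intro g_mono) auto
    then have "\<nu> B \<le> g B" unfolding \<nu>_def by (intro SUP_least)
    moreover have "g B \<le> \<nu> B"
      unfolding \<nu>_def using B(2) by (intro SUP_upper2[of m]) (auto simp: Int_absorb2)
    ultimately show ?thesis using N B by auto
  qed
  show ?thesis
  proof (rule that[of N])
    show "sets N = sets L" by (simp add: N_def)
  next
    fix B assume B: "B \<in> sets L"
    have "g (B \<inter> X k) \<le> emeasure L B" for k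
      using g_le[of "B \<inter> X k"] emeasure_mono[of "B \<inter> X k" B L] B X(1)[of k] by (auto intro: order_trans)
    then show "emeasure N B \<le> emeasure L B"
      unfolding N[OF B] \<nu>_def by (intro SUP_least)
  next
    fix B C m assume BC: "B \<in> sets L" "C \<in> sets L" "B \<subseteq> X m" "C \<subseteq> X m"
      and ev: "\<forall>\<^sub>F k in sequentially. emeasure L (B \<inter> A k) = emeasure L (C \<inter> A k)"
    have "closed {h :: 'a set \<Rightarrow> ennreal. h B = h C}"
      by (intro closed_Collect_eq cont)
    then have "g B = g C" using g[of "{h. h B = h C}"] ev by simp
    then show "emeasure N B = emeasure N C" using BC Ng by auto
  next
    fix B C m assume BC: "B \<in> sets L" "C \<in> sets L" "B \<subseteq> X m" "C \<subseteq> X m"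
      and ev: "\<forall>\<^sub>F k in sequentially. emeasure L (B \<inter> A k) + emeasure L (C \<inter> A k) = emeasure L C"
    have "closed {h :: 'a set \<Rightarrow> ennreal. h B + h C = emeasure L C}"
      by (intro closed_Collect_eq cont continuous_on_add_ennreal continuous_on_const)
    then have "g B + g C = emeasure L C" using g[of "{h. h B + h C = emeasure L C}"] ev by simp
    then show "emeasure N B + emeasure N C = emeasure L C" using BC Ng by auto
  qed
qed

section \<open>Measures on powers of the Chacon system\<close>

definition pX :: "nat set \<Rightarrow> nat \<Rightarrow> (nat \<Rightarrow> cf_point) set" where
  "pX I n = {x \<in> pS I. \<forall>i\<in>I. x i \<in> cX n}"

text \<open>The cut element c_(n+1): \<open>inc n x\<close> lies in \<open>chacon_C (Suc n)\<close>,
  and its entries are expressed through \<open>chacon_h n\<close>.\<close>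

definition inc :: "nat \<Rightarrow> cf_point \<Rightarrow> int" where
  "inc n x = co (Suc n) x - co n x"

lemma inc_C: "x \<in> cX n \<Longrightarrow> n \<le> k \<Longrightarrow> inc k x \<in> chacon_C (Suc k)"
  using C.cf_co_C[of x n "Suc k"] by (simp add: inc_def)

lemma mem_box_pX: "x \<in> pbox I n f \<longleftrightarrow> x \<in> pX I n \<and> (\<forall>i\<in>I. co n (x i) = f i)"
  using box_sub[of I n f] by (auto simp: mem_box_iff pX_def pS_extensional)

lemma pX_mono: "n \<le> m \<Longrightarrow> pX I n \<subseteq> pX I m"
  using C.cf_X_mono by (auto simp: pX_def)

lemma box_sub_pX: "n \<le> m \<Longrightarrow> pbox I n f \<subseteq> pX I m"
  using pX_mono[of n m I] by (auto simp: mem_box_pX)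

lemma pX_eq: "pX I n = (\<Union>f\<in>PiE I (\<lambda>_. chacon_F n). pbox I n f)"
proof (intro equalityI subsetI)
  fix x assume x: "x \<in> pX I n"
  then show "x \<in> (\<Union>f\<in>PiE I (\<lambda>_. chacon_F n). pbox I n f)"
    using C.cf_co_F by (intro UN_I[of "\<lambda>i\<in>I. co n (x i)"]) (auto simp: mem_box_pX pX_def)
qed (auto simp: mem_box_pX)

lemma Union_pX: "finite I \<Longrightarrow> (\<Union>n. pX I n) = pS I"
proof (intro equalityI subsetI)
  fix x assume I: "finite I" and x: "x \<in> pS I"
  obtain n where "\<forall>i\<in>I. x i \<in> cX n" using pX_level[OF I x] by metis
  then show "x \<in> (\<Union>n. pX I n)" using x by (auto simp: pX_def)
qed (auto simp: pX_def)

lemma pX_open_sets: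
  assumes I: "finite I" and A: "A \<subseteq> pS I"
    and loc: "\<And>x. x \<in> A \<Longrightarrow> \<exists>n. x \<in> pX I n \<and>
      (\<forall>y\<in>pX I n. (\<forall>i\<in>I. co n (y i) = co n (x i)) \<longrightarrow> y \<in> A)"
  shows "A \<in> sets (pB I)"
proof (rule box_open_sets[OF I A])
  fix x assume "x \<in> A"
  then obtain n where n: "x \<in> pX I n" "\<And>y. y \<in> pX I n \<Longrightarrow> (\<forall>i\<in>I. co n (y i) = co n (x i)) \<Longrightarrow> y \<in> A"
    using loc by metis
  then show "\<exists>n. (\<forall>i\<in>I. x i \<in> cX n) \<and> pbox I n (\<lambda>i. co n (x i)) \<subseteq> A"
    by (intro exI[of _ n]) (auto simp: mem_box_pX pX_def)
qed

lemma pX_agree: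
  assumes "x \<in> pX I n" "y \<in> pX I m" "\<forall>i\<in>I. co m (y i) = co m (x i)" "n \<le> k" "k \<le> m" "i \<in> I"
  shows "y i \<in> cX k" "co k (y i) = co k (x i)"
  using assms C.cf_shift_down[of "x i" n "y i" m 0 k] C.cf_co_F[of "x i" n] by (auto simp: pX_def)

lemma inc_set_sets:
  assumes I: "finite I" and "n \<le> k"
  shows "{x \<in> pX I n. Q (\<lambda>i\<in>I. inc k (x i))} \<in> sets (pB I)"
proof (rule pX_open_sets[OF I])
  fix x assume x: "x \<in> {x \<in> pX I n. Q (\<lambda>i\<in>I. inc k (x i))}"
  have "y \<in> {x \<in> pX I n. Q (\<lambda>i\<in>I. inc k (x i))}"
    if y: "y \<in> pX I (Suc k)" "\<forall>i\<in>I. co (Suc k) (y i) = co (Suc k) (x i)" for y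
  proof -
    have "(\<lambda>i\<in>I. inc k (y i)) = (\<lambda>i\<in>I. inc k (x i))"
      using pX_agree(2)[of x I n y "Suc k" k] x y \<open>n \<le> k\<close> by (auto simp: inc_def restrict_def fun_eq_iff)
    moreover have "y \<in> pX I n"
      using pX_agree(1)[of x I n y "Suc k" n] x y \<open>n \<le> k\<close> by (auto simp: pX_def)
    ultimately show ?thesis using x by simp
  qed
  then show "\<exists>n'. x \<in> pX I n' \<and> (\<forall>y\<in>pX I n'. (\<forall>i\<in>I. co n' (y i) = co n' (x i)) \<longrightarrow>
      y \<in> {x \<in> pX I n. Q (\<lambda>i\<in>I. inc k (x i))})"
    using x pX_mono[of n "Suc k" I] \<open>n \<le> k\<close> by (intro exI[of _ "Suc k"]) auto
qed (auto simp: pX_def)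

lemma pX_sets: "finite I \<Longrightarrow> pX I n \<in> sets (pB I)"
  using inc_set_sets[of I n n "\<lambda>_. True"] by simp

text \<open>Eventually the coordinates at n and at n + 1 both move by v, so a translation alters
  only finitely many increments. Tail events of increments are thus invariant.\<close>

lemma inc_pT_ev:
  assumes "finite I" "x \<in> pS I"
  shows "\<forall>\<^sub>F n in sequentially. \<forall>i\<in>I. inc n (pT I v x i) = inc n (x i)"
proof -
  have "\<forall>\<^sub>F n in sequentially. \<forall>i\<in>I. co n (pT I v x i) = co n (x i) + v i"
    using assms C.cf_T_ev by (intro eventually_ball_finite) (auto simp: pT_def pS_def)
  then have "\<forall>\<^sub>F n in sequentially. (\<forall>i\<in>I. co n (pT I v x i) = co n (x i) + v i) \<and>
      (\<forall>i\<in>I. co (Suc n) (pT I v x i) = co (Suc n) (x i) + v i)"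
    unfolding eventually_conj_iff by (subst eventually_sequentially_Suc) simp
  then show ?thesis by eventually_elim (auto simp: inc_def)
qed

section \<open>Measures finite on boxes and their translation factors\<close>

locale power_measure =
  fixes I :: "nat set" and L :: "(nat \<Rightarrow> cf_point) measure"
  assumes finI: "finite I"
    and setsL: "sets L = sets (pB I)"
    and finL: "\<And>n f. \<forall>i\<in>I. f i \<in> chacon_F n \<Longrightarrow> emeasure L (pbox I n f) \<noteq> \<infinity>"
begin

lemma spaceL: "space L = pS I"
  using sets_eq_imp_space_eq[OF setsL] by (simp add: space_pB)

lemma pX_L: "pX I n \<in> sets L"
  using pX_sets[OF finI] setsL by simp

lemma fin_pX: "emeasure L (pX I n) \<noteq> \<infinity>"
proof -
  have "finite (PiE I (\<lambda>_. chacon_F n))" using finI finite_chacon_F by (intro finite_PiE) auto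
  then have "emeasure L (pX I n) \<le> (\<Sum>f\<in>PiE I (\<lambda>_. chacon_F n). emeasure L (pbox I n f))"
    unfolding pX_eq using box_sets[OF finI] setsL by (intro emeasure_subadditive_finite) auto
  also have "\<dots> < \<infinity>"
    using finL \<open>finite _\<close> by (auto simp: less_top PiE_iff)
  finally show ?thesis by simp
qed

lemma sigma_finite_L: "sigma_finite_measure L"
proof
  show "\<exists>A. countable A \<and> A \<subseteq> sets L \<and> \<Union> A = space L \<and> (\<forall>a\<in>A. emeasure L a \<noteq> \<infinity>)"
    using pX_L fin_pX Union_pX[OF finI] by (intro exI[of _ "range (pX I)"]) (auto simp: spaceL)
qed

lemma pT_L: "pT I v \<in> measurable L L"
  using pT_measurable[OF finI] measurable_cong_sets[OF setsL setsL] by simp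

lemma pre_sets: "A \<in> sets L \<Longrightarrow> pT I v -` A \<inter> pS I \<in> sets L"
  using measurable_sets[OF pT_L, of A v] by (simp add: spaceL)

lemma sub_space: "A \<in> sets L \<Longrightarrow> A \<subseteq> pS I"
  using sets.sets_into_space[of A L] by (simp add: spaceL)

text \<open>Translation by v multiplies the measure by the constant r. Such vectors form a group on
  which the factor is multiplicative; for an ergodic measure the constant vectors have factor
  1.\<close>

definition scl :: "(nat \<Rightarrow> int) \<Rightarrow> real \<Rightarrow> bool" where
  "scl v r \<longleftrightarrow> r > 0 \<and> (\<forall>A\<in>sets L. emeasure L (pT I v -` A \<inter> pS I) = ennreal r * emeasure L A)"

lemma sclD: "scl v r \<Longrightarrow> A \<in> sets L \<Longrightarrow> emeasure L (pT I v -` A \<inter> pS I) = ennreal r * emeasure L A"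
  by (simp add: scl_def)

lemma scl_cong: "(\<And>i. i \<in> I \<Longrightarrow> v i = w i) \<Longrightarrow> scl v r = scl w r"
proof -
  assume "\<And>i. i \<in> I \<Longrightarrow> v i = w i"
  then have "pT I v = pT I w" by (auto simp: pT_def fun_eq_iff restrict_def)
  then show ?thesis by (simp add: scl_def)
qed

lemma scl_0: "scl (\<lambda>_. 0) 1"
proof -
  have "pT I (\<lambda>_. 0) -` A \<inter> pS I = A" if "A \<in> sets L" for A
    using sub_space[OF that] pT_0 by auto
  then show ?thesis by (simp add: scl_def)
qed

lemma scl_add: "scl v r \<Longrightarrow> scl w s \<Longrightarrow> scl (\<lambda>i. v i + w i) (r * s)"
proof -
  assume v: "scl v r" and w: "scl w s"
  have "emeasure L (pT I (\<lambda>i. v i + w i) -` A \<inter> pS I) = ennreal (r * s) * emeasure L A" if A: "A \<in> sets L" for A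
  proof -
    have e: "pT I (\<lambda>i. v i + w i) -` A \<inter> pS I = pT I w -` (pT I v -` A \<inter> pS I) \<inter> pS I"
      using pT_add[of _ I v w] pT_pS[of _ I w] by auto
    have "emeasure L (pT I (\<lambda>i. v i + w i) -` A \<inter> pS I) = ennreal s * (ennreal r * emeasure L A)"
      unfolding e sclD[OF w pre_sets[OF A]] sclD[OF v A] ..
    then show ?thesis using v w by (simp add: scl_def ennreal_mult' mult_ac)
  qed
  then show ?thesis using v w by (simp add: scl_def)
qed

lemma scl_neg: "scl v r \<Longrightarrow> scl (\<lambda>i. - v i) (1 / r)"
proof -
  assume v: "scl v r"
  then have r: "r > 0" by (simp add: scl_def)
  have "emeasure L (pT I (\<lambda>i. - v i) -` A \<inter> pS I) = ennreal (1 / r) * emeasure L A" if A: "A \<in> sets L" for A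
  proof -
    let ?B = "pT I (\<lambda>i. - v i) -` A \<inter> pS I"
    have e: "pT I v -` ?B \<inter> pS I = A"
      using pT_inv[of _ I v] pT_pS[of _ I v] sub_space[OF A] by auto
    have "ennreal r * emeasure L ?B = emeasure L A"
      using sclD[OF v pre_sets[OF A, of "\<lambda>i. - v i"]] unfolding e by simp
    then have "ennreal (1 / r) * emeasure L A = (ennreal (1 / r) * ennreal r) * emeasure L ?B"
      by (simp add: mult.assoc)
    also have "ennreal (1 / r) * ennreal r = 1"
      using r by (simp add: ennreal_mult[symmetric])
    finally show ?thesis by simp
  qed
  then show ?thesis using r by (simp add: scl_def)
qed

lemma scl_int: "scl v r \<Longrightarrow> scl (\<lambda>i. t * v i) (r powi t)"
proof -
  assume v: "scl v r"
  then have r: "r > 0" by (simp add: scl_def)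
  have nat: "scl (\<lambda>i. int n * v i) (r ^ n)" for n
  proof (induction n)
    case 0
    then show ?case using scl_0 by simp
  next
    case (Suc n)
    show ?case using scl_add[OF v Suc] by (simp add: algebra_simps)
  qed
  show ?thesis
  proof (cases "t \<ge> 0")
    case True
    then show ?thesis using nat[of "nat t"] by (simp add: power_int_def)
  next
    case False
    have "scl (\<lambda>i. - (int (nat (- t)) * v i)) (1 / r ^ nat (- t))" by (rule scl_neg[OF nat])
    then show ?thesis using False by (simp add: power_int_def field_simps)
  qed
qed

lemma scl_boxes:
  assumes r: "r > 0"
    and eq: "\<And>n f. \<forall>i\<in>I. f i \<in> chacon_F n \<and> f i + v i \<in> chacon_F n \<Longrightarrow>
       emeasure L (pbox I n f) = ennreal r * emeasure L (pbox I n (\<lambda>i. f i + v i))"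
  shows "scl v r"
proof -
  have bs: "pbox I n f \<in> sets L" if "\<forall>i\<in>I. f i \<in> chacon_F n" for n f
    using box_sets[OF finI that] setsL by simp
  \<comment> \<open>The test boxes are those for - v: when both f and f - v are admissible, the
    preimage of the box at f is the box at f - v.\<close>
  have "distr L (pB I) (pT I v) = scale_measure (ennreal r) L"
  proof (rule box_measure_eqI[OF finI, where v = "\<lambda>i. - v i"])
    fix n f assume f: "\<forall>i\<in>I. f i \<in> chacon_F n \<and> f i + - v i \<in> chacon_F n"
    have m: "pT I v \<in> measurable L (pB I)"
      using pT_L measurable_cong_sets[OF refl setsL] by metis
    have "pT I v -` pbox I n (\<lambda>i. (f i + - v i) + v i) \<inter> pS I = pbox I n (\<lambda>i. f i + - v i)"
      using f by (intro pT_box) auto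
    then have "emeasure (distr L (pB I) (pT I v)) (pbox I n f) = emeasure L (pbox I n (\<lambda>i. f i + - v i))"
      using f box_sets[OF finI] by (subst emeasure_distr[OF m]) (auto simp: spaceL)
    also have "\<dots> = ennreal r * emeasure L (pbox I n f)"
      using eq[of "\<lambda>i. f i + - v i" n] f by simp
    finally show e: "emeasure (distr L (pB I) (pT I v)) (pbox I n f)
        = emeasure (scale_measure (ennreal r) L) (pbox I n f)"
      by simp
    show "emeasure (distr L (pB I) (pT I v)) (pbox I n f) \<noteq> \<infinity>"
      unfolding e using finL[of f n] f by (simp add: ennreal_mult_eq_top_iff)
  qed (simp_all add: setsL)
  moreover have "emeasure (distr L (pB I) (pT I v)) A = emeasure L (pT I v -` A \<inter> pS I)" if "A \<in> sets L" for A
    using that pT_L measurable_cong_sets[OF refl setsL] setsL by (subst emeasure_distr) (auto simp: spaceL)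
  ultimately show ?thesis using r by (auto simp: scl_def)
qed

end

locale ergodic_power = power_measure +
  assumes erg: "ergodic_measure (chacon_pow_T I) L"
    and nonzero: "emeasure L (space L) \<noteq> 0"
begin

lemma scl_1: "scl (\<lambda>_. 1) 1"
  using erg by (auto simp: scl_def ergodic_measure_def invariant_measure_def chacon_pow_T_eq spaceL)

lemma scl_const: "scl (\<lambda>_. t) 1"
  using scl_int[OF scl_1, of t] by simp

lemma box_inv:
  assumes "\<forall>i\<in>I. f i \<in> chacon_F n" "\<forall>i\<in>I. f i + t \<in> chacon_F n"
  shows "emeasure L (pbox I n (\<lambda>i. f i + t)) = emeasure L (pbox I n f)"
proof -
  have "pbox I n (\<lambda>i. f i + t) \<in> sets L" using box_sets[OF finI assms(2)] setsL by simp
  then show ?thesis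
    using sclD[OF scl_const[of t]] pT_box[OF assms(1), of "\<lambda>_. t"] assms(2) by fastforce
qed

lemma nonzero_box:
  "\<exists>n f. (\<forall>i\<in>I. f i \<in> chacon_F n \<and> f i + v i \<in> chacon_F n) \<and> emeasure L (pbox I n f) \<noteq> 0"
proof (rule ccontr)
  assume *: "\<not> ?thesis"
  have "(\<Union>b\<in>boxes I v. b) \<in> null_sets L"
  proof (rule null_sets_UN'[OF countable_boxes[OF finI]])
    fix b assume "b \<in> boxes I v"
    then obtain n f where nf: "b = pbox I n f" "\<forall>i\<in>I. f i \<in> chacon_F n \<and> f i + v i \<in> chacon_F n"
      unfolding boxes_def by blast
    then have "emeasure L b = 0" using * by blast
    then show "b \<in> null_sets L" using nf box_sets[OF finI, of f n] setsL by (auto intro!: null_setsI)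
  qed
  then show False using nonzero Union_boxes[OF finI] spaceL by auto
qed

lemma not_AE_False: "\<not> (AE x in L. False)"
  using nonzero AE_iff_measurable[OF sets.top, of L "\<lambda>_. False"] by auto

text \<open>Extremality of ergodic measures, with invariance of N required only on boxes, which is
  all that survives the passage to a cluster point.\<close>

lemma proportional:
  assumes N: "sets N = sets L" "\<And>A. A \<in> sets L \<Longrightarrow> emeasure N A \<le> emeasure L A"
    and Ninv: "\<And>n f. \<forall>i\<in>I. f i \<in> chacon_F n \<and> f i + 1 \<in> chacon_F n \<Longrightarrow>
       emeasure N (pbox I n f) = emeasure N (pbox I n (\<lambda>i. f i + 1))"
  shows "\<exists>p::real. 0 \<le> p \<and> p \<le> 1 \<and> (\<forall>A\<in>sets L. emeasure N A = ennreal p * emeasure L A)"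
proof -
  interpret N: power_measure I N
  proof
    fix n f assume f: "\<forall>i\<in>I. f i \<in> chacon_F n"
    then show "emeasure N (pbox I n f) \<noteq> \<infinity>"
      using N(2)[of "pbox I n f"] box_sets[OF finI f] finL[OF f] setsL by (auto simp: top_unique)
  qed (use finI setsL N in auto)
  have "N.scl (\<lambda>_. 1) 1" using Ninv by (intro N.scl_boxes) auto
  then have inv: "emeasure N (chacon_pow_T I -` A \<inter> space L) = emeasure N A" if "A \<in> sets L" for A
    using that N(1) by (simp add: N.scl_def chacon_pow_T_eq spaceL)
  show ?thesis
  proof (rule ergodic_measure_proportional[OF sigma_finite_L erg, of "pT I (\<lambda>_. - 1)" N])
    show "pT I (\<lambda>_. - 1) (chacon_pow_T I x) = x" "chacon_pow_T I (pT I (\<lambda>_. - 1) x) = x" if "x \<in> space L" for x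
      using pT_inv[of x I "\<lambda>_. 1"] that by (auto simp: chacon_pow_T_eq spaceL)
  next
    fix p :: real assume p: "0 \<le> p" "p \<le> 1" "\<And>A. A \<in> sets L \<Longrightarrow> emeasure N A = ennreal p * emeasure L A"
    then show ?thesis by blast
  qed (use pT_L N inv in auto)
qed

lemma io_sets:
  "{x \<in> pS I. \<exists>\<^sub>F n in sequentially. Q n (\<lambda>i\<in>I. inc n (x i))} \<in> sets L"
proof -
  have "{x \<in> pS I. \<exists>\<^sub>F n in sequentially. Q n (\<lambda>i\<in>I. inc n (x i))} =
      (\<Inter>m. \<Union>n\<in>{m..}. {x \<in> pX I n. Q n (\<lambda>i\<in>I. inc n (x i))})" (is "?A = ?B")
  proof (intro equalityI subsetI)
    fix x assume x: "x \<in> ?A"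
    have "\<forall>\<^sub>F n in sequentially. x \<in> pX I n"
      using x ev_pX[OF finI, of x "\<lambda>_. 0"] by (auto simp: pX_def elim: eventually_mono)
    then have "\<exists>\<^sub>F n in sequentially. Q n (\<lambda>i\<in>I. inc n (x i)) \<and> x \<in> pX I n"
      using x by (intro frequently_eventually_frequently) auto
    then show "x \<in> ?B" by (auto simp: frequently_sequentially)
  next
    fix x assume "x \<in> ?B"
    then have "\<forall>m. \<exists>n\<ge>m. x \<in> pX I n \<and> Q n (\<lambda>i\<in>I. inc n (x i))" by auto
    then show "x \<in> ?A" by (auto simp: frequently_sequentially pX_def) 
  qed
  also have "\<dots> \<in> sets L"
    unfolding setsL using inc_set_sets[OF finI]
    by (intro sets.countable_INT' sets.countable_UN' image_subsetI) auto
  finally show ?thesis .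
qed

text \<open>A zero-one law: whether Q holds infinitely often depends on the tail of the increments
  only and is therefore an invariant event.\<close>

lemma io_dichotomy:
  "(AE x in L. \<exists>\<^sub>F n in sequentially. Q n (\<lambda>i\<in>I. inc n (x i))) \<or>
   (AE x in L. \<forall>\<^sub>F n in sequentially. \<not> Q n (\<lambda>i\<in>I. inc n (x i)))"
proof -
  let ?A = "{x \<in> pS I. \<exists>\<^sub>F n in sequentially. Q n (\<lambda>i\<in>I. inc n (x i))}"
  have "pT I (\<lambda>_. 1) x \<in> ?A \<longleftrightarrow> x \<in> ?A" if x: "x \<in> pS I" for x
  proof -
    have "\<forall>\<^sub>F n in sequentially. Q n (\<lambda>i\<in>I. inc n (pT I (\<lambda>_. 1) x i)) \<longleftrightarrow> Q n (\<lambda>i\<in>I. inc n (x i))"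
      using inc_pT_ev[OF finI x, of "\<lambda>_. 1"]
    proof eventually_elim
      case (elim n)
      then have "(\<lambda>i\<in>I. inc n (pT I (\<lambda>_. 1) x i)) = (\<lambda>i\<in>I. inc n (x i))"
        by (auto simp: restrict_def fun_eq_iff)
      then show ?case by simp
    qed
    then have "(\<exists>\<^sub>F n in sequentially. Q n (\<lambda>i\<in>I. inc n (pT I (\<lambda>_. 1) x i))) \<longleftrightarrow>
        (\<exists>\<^sub>F n in sequentially. Q n (\<lambda>i\<in>I. inc n (x i)))"
      by (rule frequently_cong)
    then show ?thesis using x pT_pS[OF x] by auto
  qed
  then have "AE x in L. chacon_pow_T I x \<in> ?A \<longleftrightarrow> x \<in> ?A"
    by (intro AE_I2) (simp add: chacon_pow_T_eq spaceL)
  then have "(AE x in L. x \<in> ?A) \<or> (AE x in L. x \<notin> ?A)"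
    by (intro ergodic_measure_AE[OF erg io_sets])
  then show ?thesis
  proof
    assume "AE x in L. x \<in> ?A"
    then show ?thesis by (intro disjI1) (auto elim: eventually_mono)
  next
    assume "AE x in L. x \<notin> ?A"
    then have "AE x in L. \<forall>\<^sub>F n in sequentially. \<not> Q n (\<lambda>i\<in>I. inc n (x i))"
      using AE_space by eventually_elim (auto simp: frequently_def spaceL)
    then show ?thesis ..
  qed
qed

end

section \<open>Infinitely many shifts by one imply invariance\<close>

text \<open>Coordinatewise, \<open>shift_b\<close> exceeds \<open>shift_a\<close> by \<open>chacon_h n\<close>, plus \<open>1\<close> on \<open>S\<close>. So the
  diagonal translation by \<open>chacon_h n\<close> turns the increment \<open>shift_a\<close> into \<open>shift_b\<close>, at the
  price of lowering all earlier coordinates by \<open>1\<close> on \<open>S\<close>.\<close>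
definition shift_a :: "nat set \<Rightarrow> nat \<Rightarrow> nat \<Rightarrow> int" where
  "shift_a S n i = (if i \<in> S then 0 else - chacon_h n)"

definition shift_b :: "nat set \<Rightarrow> nat \<Rightarrow> nat \<Rightarrow> int" where
  "shift_b S n i = (if i \<in> S then chacon_h n + 1 else 0)"

definition is_a :: "nat set \<Rightarrow> nat set \<Rightarrow> nat \<Rightarrow> (nat \<Rightarrow> int) \<Rightarrow> bool" where
  "is_a I S n c \<longleftrightarrow> (\<forall>i\<in>I. c i = shift_a S n i)"

definition is_b :: "nat set \<Rightarrow> nat set \<Rightarrow> nat \<Rightarrow> (nat \<Rightarrow> int) \<Rightarrow> bool" where
  "is_b I S n c \<longleftrightarrow> (\<forall>i\<in>I. c i = shift_b S n i)"

text \<open>\<open>cf_hop\<close> in all coordinates at one common level n: up to n everything moves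
  by v, so the increments before n are kept, and the increment at n changes by t - v.\<close>

lemma pT_exchange:
  assumes x: "x \<in> pX I m" and v: "\<forall>i\<in>I. co m (x i) + v i \<in> chacon_F m" and n: "m \<le> n"
    and c: "\<forall>i\<in>I. inc n (x i) + t i - v i \<in> chacon_C (Suc n)"
  shows "pT I t x \<in> pX I m"
    and "i \<in> I \<Longrightarrow> co m (pT I t x i) = co m (x i) + v i"
    and "i \<in> I \<Longrightarrow> m \<le> j \<Longrightarrow> j < n \<Longrightarrow> inc j (pT I t x i) = inc j (x i)"
    and "i \<in> I \<Longrightarrow> inc n (pT I t x i) = inc n (x i) + t i - v i"
proof -
  have xi: "x i \<in> cX m" if "i \<in> I" for i using x that by (auto simp: pX_def)
  have y: "pT I t x i = chacon_T (t i) (x i)" if "i \<in> I" for i using that by (simp add: pT_def)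
  have ci: "co (Suc n) (x i) - co n (x i) + t i - v i \<in> chacon_C (Suc n)" if "i \<in> I" for i
    using c that by (auto simp: inc_def)
  have hop: "chacon_T (t i) (x i) \<in> cX m"
    "m \<le> j \<Longrightarrow> j \<le> n \<Longrightarrow> co j (chacon_T (t i) (x i)) = co j (x i) + v i"
    "n < j \<Longrightarrow> co j (chacon_T (t i) (x i)) = co j (x i) + t i" if i: "i \<in> I" for i j
    using C.cf_hop[OF xi[OF i] v[rule_format, OF i] n ci[OF i]] by auto
  show "pT I t x \<in> pX I m"
    using hop(1) pT_pS[of x I t] x by (auto simp: pX_def y)
  show "i \<in> I \<Longrightarrow> co m (pT I t x i) = co m (x i) + v i"
    using hop(2)[of i m] n by (simp add: y)
  show "i \<in> I \<Longrightarrow> m \<le> j \<Longrightarrow> j < n \<Longrightarrow> inc j (pT I t x i) = inc j (x i)"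
    using hop(2)[of i j] hop(2)[of i "Suc j"] by (simp add: y inc_def)
  show "i \<in> I \<Longrightarrow> inc n (pT I t x i) = inc n (x i) + t i - v i"
    using hop(2)[of i n] hop(3)[of i "Suc n"] n by (simp add: y inc_def)
qed

section \<open>First hits and the exchange of the two types\<close>

context ergodic_power
begin

definition hit :: "nat set \<Rightarrow> nat \<Rightarrow> (nat \<Rightarrow> cf_point) \<Rightarrow> bool" where
  "hit S n x \<longleftrightarrow> is_a I S n (\<lambda>i\<in>I. inc n (x i)) \<or> is_b I S n (\<lambda>i\<in>I. inc n (x i))"

text \<open>The points whose first hit from level k on occurs at n and is of type Q. Fixing k makes
  the event depend on increments from k on only, so it is insensitive to translations that act
  within levels up to k.\<close>

definition first :: "nat set \<Rightarrow> (nat \<Rightarrow> (nat \<Rightarrow> int) \<Rightarrow> bool) \<Rightarrow> nat \<Rightarrow> nat \<Rightarrow> (nat \<Rightarrow> cf_point) set" where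
  "first S Q k n = {x \<in> pX I k. k \<le> n \<and> Q n (\<lambda>i\<in>I. inc n (x i)) \<and> (\<forall>j\<in>{k..<n}. \<not> hit S j x)}"

lemma hit_cong: "(\<And>i. i \<in> I \<Longrightarrow> inc n (x i) = inc n (y i)) \<Longrightarrow> hit S n x = hit S n y"
  by (simp add: hit_def is_a_def is_b_def)

lemma first_sets: "first S Q k n \<in> sets L"
proof (cases "k \<le> n")
  case True
  have "first S Q k n = {x \<in> pX I k. Q n (\<lambda>i\<in>I. inc n (x i))} - (\<Union>j\<in>{k..<n}. {x \<in> pX I k. hit S j x})"
    using True by (auto simp: first_def)
  also have "\<dots> \<in> sets L"
    unfolding setsL hit_def using True
    by (intro sets.Diff sets.finite_UN inc_set_sets[OF finI]) auto
  finally show ?thesis .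
qed (simp add: first_def)

context
  fixes S assumes S: "S \<subseteq> I" "S \<noteq> {}"
    and io: "AE x in L. \<exists>\<^sub>F n in sequentially. hit S n x"
begin

definition e where "e i = (if i \<in> S then 1 else 0 :: int)"

definition "AA k = (\<Union>n. first S (is_a I S) k n)"
definition "BB k = (\<Union>n. first S (is_b I S) k n)"

lemma AA_sets: "AA k \<in> sets L" and BB_sets: "BB k \<in> sets L"
  unfolding AA_def BB_def using first_sets by auto

lemma not_both: "is_a I S n c \<Longrightarrow> \<not> is_b I S n c"
  using S chacon_h_ge_1[of n] by (force simp: is_a_def is_b_def shift_a_def shift_b_def)

text \<open>Translation by h_n turns the increment a at level n into b, as a + h + e = b
  coordinatewise, and moves earlier coordinates by - e. The increments from m to n - 1 are
  untouched, so n is still the first hit; translation by - h_n is the inverse.\<close>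

lemma first_flip:
  assumes mk: "m \<le> k" and f: "\<forall>i\<in>I. f i \<in> chacon_F m" "\<forall>i\<in>I. f i - e i \<in> chacon_F m"
  shows "pT I (\<lambda>_. chacon_h n) -` (pbox I m (\<lambda>i. f i - e i) \<inter> first S (is_b I S) k n) \<inter> pS I
    = pbox I m f \<inter> first S (is_a I S) k n" (is "?l = ?r")
proof (intro equalityI subsetI)
  fix x assume x: "x \<in> ?r"
  then have kn: "k \<le> n" and xm: "x \<in> pX I m" and xf: "\<forall>i\<in>I. co m (x i) = f i"
    and a: "\<forall>i\<in>I. inc n (x i) = shift_a S n i" and nh: "\<forall>j\<in>{k..<n}. \<not> hit S j x"
    by (auto simp: first_def is_a_def mem_box_pX)
  have c: "\<forall>i\<in>I. inc n (x i) + chacon_h n - (- e i) = shift_b S n i"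
    using a by (auto simp: shift_a_def shift_b_def e_def)
  have "shift_b S n i \<in> chacon_C (Suc n)" for i
    by (auto simp: shift_b_def mem_chacon_C_Suc_iff)
  then have cC: "\<forall>i\<in>I. inc n (x i) + chacon_h n - (- e i) \<in> chacon_C (Suc n)" using c by simp
  have vF: "\<forall>i\<in>I. co m (x i) + - e i \<in> chacon_F m" using f xf by simp
  note fl = pT_exchange[OF xm vF _ cC]
  let ?y = "pT I (\<lambda>_. chacon_h n) x"
  have mn: "m \<le> n" using mk kn by simp
  have y1: "?y \<in> pbox I m (\<lambda>i. f i - e i)" using fl(1,2)[OF mn] xf by (auto simp: mem_box_pX)
  have "hit S j ?y = hit S j x" if "j \<in> {k..<n}" for j
    using fl(3)[OF mn] that mk by (intro hit_cong) auto
  then have "?y \<in> first S (is_b I S) k n"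
    using fl(4)[OF mn] c nh kn fl(1)[OF mn] pX_mono[OF mk, of I] by (auto simp: first_def is_b_def)
  then show "x \<in> ?l" using y1 xm by (auto simp: pX_def)
next
  fix x assume x: "x \<in> ?l"
  let ?y = "pT I (\<lambda>_. chacon_h n) x"
  have xS: "x \<in> pS I" using x by auto
  have kn: "k \<le> n" and ym: "?y \<in> pX I m" and yf: "\<forall>i\<in>I. co m (?y i) = f i - e i"
    and a: "\<forall>i\<in>I. inc n (?y i) = shift_b S n i" and nh: "\<forall>j\<in>{k..<n}. \<not> hit S j ?y"
    using x by (auto simp: first_def is_b_def mem_box_pX)
  have c: "\<forall>i\<in>I. inc n (?y i) + - chacon_h n - e i = shift_a S n i"
    using a by (auto simp: shift_a_def shift_b_def e_def)
  have "shift_a S n i \<in> chacon_C (Suc n)" for i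
    by (auto simp: shift_a_def mem_chacon_C_Suc_iff)
  then have cC: "\<forall>i\<in>I. inc n (?y i) + - chacon_h n - e i \<in> chacon_C (Suc n)" using c by simp
  have vF: "\<forall>i\<in>I. co m (?y i) + e i \<in> chacon_F m" using f yf by simp
  have xy: "pT I (\<lambda>_. - chacon_h n) ?y = x"
    using pT_inv(1)[OF xS, of "\<lambda>_. chacon_h n"] by simp
  have mn: "m \<le> n" using mk kn by simp
  note fl = pT_exchange[OF ym vF mn cC, unfolded xy]
  have y1: "x \<in> pbox I m f" using fl(1,2) yf by (auto simp: mem_box_pX)
  have "hit S j x = hit S j ?y" if "j \<in> {k..<n}" for j
    using fl(3) that mk by (intro hit_cong) auto
  then have "x \<in> first S (is_a I S) k n"
    using fl(4) c nh kn fl(1) pX_mono[OF mk, of I] by (auto simp: first_def is_a_def)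
  then show "x \<in> ?r" using y1 by auto
qed

lemma first_disjoint: "disjoint_family (first S (is_a I S) k)" "disjoint_family (first S (is_b I S) k)"
proof -
  have "first S (is_a I S) k n \<inter> first S (is_a I S) k n' = {}"
       "first S (is_b I S) k n \<inter> first S (is_b I S) k n' = {}" if "n < n'" for n n'
    using that by (auto simp: first_def hit_def)
  then show "disjoint_family (first S (is_a I S) k)" "disjoint_family (first S (is_b I S) k)"
    unfolding disjoint_family_on_def by (metis Int_commute linorder_neqE_nat)+
qed

lemma box_L: "\<forall>i\<in>I. f i \<in> chacon_F m \<Longrightarrow> pbox I m f \<in> sets L"
  using box_sets[OF finI] setsL by simp

text \<open>The translation depends on the level n of the first hit, but each diagonal translation
  preserves L, so the identity holds on every piece and the pieces add up.\<close>

lemma AA_BB: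
  assumes mk: "m \<le> k" and f: "\<forall>i\<in>I. f i \<in> chacon_F m" "\<forall>i\<in>I. f i - e i \<in> chacon_F m"
  shows "emeasure L (pbox I m f \<inter> AA k) = emeasure L (pbox I m (\<lambda>i. f i - e i) \<inter> BB k)"
proof -
  have "emeasure L (pbox I m f \<inter> AA k) = emeasure L (\<Union>n. pbox I m f \<inter> first S (is_a I S) k n)"
    by (simp add: AA_def)
  also have "\<dots> = (\<Sum>n. emeasure L (pbox I m f \<inter> first S (is_a I S) k n))"
    using box_L[OF f(1)] first_sets
    by (intro suminf_emeasure[symmetric] disjoint_family_subset[OF first_disjoint(1)[of k]]) auto
  also have "\<dots> = (\<Sum>n. emeasure L (pbox I m (\<lambda>i. f i - e i) \<inter> first S (is_b I S) k n))"
  proof (rule suminf_cong)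
    fix n
    have "pbox I m (\<lambda>i. f i - e i) \<inter> first S (is_b I S) k n \<in> sets L"
      using box_L[OF f(2)] first_sets by auto
    then show "emeasure L (pbox I m f \<inter> first S (is_a I S) k n) =
       emeasure L (pbox I m (\<lambda>i. f i - e i) \<inter> first S (is_b I S) k n)"
      using sclD[OF scl_const[of "chacon_h n"]] unfolding first_flip[OF mk f, of n, symmetric]
      by (simp only: ennreal_1 mult_1)
  qed
  also have "\<dots> = emeasure L (\<Union>n. pbox I m (\<lambda>i. f i - e i) \<inter> first S (is_b I S) k n)"
    using box_L[OF f(2)] first_sets
    by (intro suminf_emeasure disjoint_family_subset[OF first_disjoint(2)[of k]]) auto
  finally show ?thesis by (simp add: BB_def)
qed

lemma AA_plus_BB:
  assumes mk: "m \<le> k" and f: "\<forall>i\<in>I. f i \<in> chacon_F m"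
  shows "emeasure L (pbox I m f \<inter> AA k) + emeasure L (pbox I m f \<inter> BB k) = emeasure L (pbox I m f)"
proof -
  have "first S (is_a I S) k n \<inter> first S (is_b I S) k n' = {}" for n n'
    using not_both by (cases n n' rule: linorder_cases) (auto simp: first_def hit_def)
  then have dis: "AA k \<inter> BB k = {}" by (auto simp: AA_def BB_def)
  have "emeasure L (pbox I m f \<inter> AA k) + emeasure L (pbox I m f \<inter> BB k) = emeasure L (pbox I m f \<inter> AA k \<union> pbox I m f \<inter> BB k)"
    using box_L[OF f] AA_sets BB_sets dis by (intro plus_emeasure) auto
  also have "\<dots> = emeasure L (pbox I m f)"
  proof (rule emeasure_eq_AE)
    show "AE x in L. x \<in> pbox I m f \<inter> AA k \<union> pbox I m f \<inter> BB k \<longleftrightarrow> x \<in> pbox I m f"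
      using io
    proof eventually_elim
      case (elim x)
      have "x \<in> AA k \<union> BB k" if x: "x \<in> pbox I m f"
      proof -
        have "\<exists>n\<ge>k. hit S n x" using elim by (auto simp: frequently_sequentially)
        then obtain n where n: "n \<ge> k" "hit S n x" "\<And>j. j < n \<Longrightarrow> \<not> (j \<ge> k \<and> hit S j x)"
          using exists_least_iff[of "\<lambda>n. n \<ge> k \<and> hit S n x"] by blast
        have "x \<in> pX I k" using x box_sub_pX[OF mk] by auto
        then have "x \<in> first S (is_a I S) k n \<or> x \<in> first S (is_b I S) k n"
          using n by (auto simp: first_def hit_def)
        then show ?thesis by (auto simp: AA_def BB_def)
      qed
      then show ?case by auto
    qed
  qed (use box_L[OF f] AA_sets BB_sets in auto)
  finally show ?thesis .
qed

text \<open>A translation by 1 inside boxes of level m \<le> k keeps all increments from k on, hence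
  the type of the first hit. Invariance is exact on boxes of any fixed level once k has passed
  it.\<close>

lemma AA_inv:
  assumes mk: "m \<le> k" and f: "\<forall>i\<in>I. f i \<in> chacon_F m" "\<forall>i\<in>I. f i + 1 \<in> chacon_F m"
  shows "emeasure L (pbox I m f \<inter> AA k) = emeasure L (pbox I m (\<lambda>i. f i + 1) \<inter> AA k)"
proof -
  have "pT I (\<lambda>_. 1) -` (pbox I m (\<lambda>i. f i + 1) \<inter> AA k) \<inter> pS I = pbox I m f \<inter> AA k"
  proof -
    have "pT I (\<lambda>_. 1) x \<in> AA k \<longleftrightarrow> x \<in> AA k" if x: "x \<in> pbox I m f" for x
    proof -
      have xm: "x \<in> pX I m" "\<forall>i\<in>I. x i \<in> cX m" "\<forall>i\<in>I. co m (x i) + 1 \<in> chacon_F m"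
        using x f by (auto simp: mem_box_pX pX_def)
      have y: "pT I (\<lambda>_. 1) x \<in> pX I m"
        using pT_co(1)[OF xm(2,3)] pT_pS[of x I] xm(1) by (auto simp: pX_def)
      have "inc n (pT I (\<lambda>_. 1) x i) = inc n (x i)" if "m \<le> n" "i \<in> I" for n i
        using pT_co(2)[OF xm(2,3) \<open>i \<in> I\<close>] that by (simp add: inc_def)
      then have *: "(\<lambda>i\<in>I. inc n (pT I (\<lambda>_. 1) x i)) = (\<lambda>i\<in>I. inc n (x i))" if "k \<le> n" for n
        using that mk by (auto simp: restrict_def fun_eq_iff)
      then have "pT I (\<lambda>_. 1) x \<in> first S (is_a I S) k n \<longleftrightarrow> x \<in> first S (is_a I S) k n" for n
        using xm(1) y pX_mono[OF mk, of I] by (auto simp: first_def hit_def)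
      then show ?thesis by (simp add: AA_def)
    qed
    then show ?thesis using pT_box[OF f(1), of "\<lambda>_. 1"] f(2) by auto
  qed
  moreover have "pbox I m (\<lambda>i. f i + 1) \<inter> AA k \<in> sets L" using box_L[OF f(2)] AA_sets by auto
  ultimately show ?thesis using sclD[OF scl_1] by fastforce
qed

text \<open>A cluster point N of the restrictions of L to \<open>AA k\<close> is invariant and
  dominated by L, so it equals p L. Comparing p L on a box with the exchange relation gives the
  factor (1 - p) / p for - e.\<close>

lemma scl_e_exists: "\<exists>r. scl e r"
proof (rule cluster_measure[where A = AA and X = "pX I" and L = L], goal_cases)
  case 2
  show ?case using pX_mono by (simp add: incseq_def)
next
  case 3
  show ?case using Union_pX[OF finI] spaceL by simp
next
  case (6 N)
  note N = 6(1,2) and N1 = 6(3) and N2 = 6(4)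
  have "\<exists>p::real. 0 \<le> p \<and> p \<le> 1 \<and> (\<forall>A\<in>sets L. emeasure N A = ennreal p * emeasure L A)"
  proof (rule proportional[OF N])
    fix n f assume f: "\<forall>i\<in>I. f i \<in> chacon_F n \<and> f i + 1 \<in> chacon_F n"
    have "\<forall>\<^sub>F k in sequentially. emeasure L (pbox I n f \<inter> AA k) = emeasure L (pbox I n (\<lambda>i. f i + 1) \<inter> AA k)"
      using eventually_ge_at_top[of n] by eventually_elim (rule AA_inv, use f in auto)
    then show "emeasure N (pbox I n f) = emeasure N (pbox I n (\<lambda>i. f i + 1))"
      using f by (intro N1[of _ _ n] box_L box_sub_pX) auto
  qed
  then obtain p :: real where p: "0 \<le> p" "p \<le> 1" "\<And>A. A \<in> sets L \<Longrightarrow> emeasure N A = ennreal p * emeasure L A"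
    by blast
  \<comment> \<open>On C, the box shifted by - e, the events \<open>AA k\<close> and
    \<open>BB k\<close> exhaust L, and the part in \<open>BB k\<close> has the mass of the part of B
    in \<open>AA k\<close>. In the limit p L B + p L C = L C.\<close>
  have rel: "ennreal p * emeasure L (pbox I n f) = ennreal (1 - p) * emeasure L (pbox I n (\<lambda>i. f i - e i))"
    if f: "\<forall>i\<in>I. f i \<in> chacon_F n" "\<forall>i\<in>I. f i - e i \<in> chacon_F n" for n f
  proof -
    let ?B = "pbox I n f" and ?C = "pbox I n (\<lambda>i. f i - e i)"
    have "\<forall>\<^sub>F k in sequentially. emeasure L (?B \<inter> AA k) + emeasure L (?C \<inter> AA k) = emeasure L ?C"
      using eventually_ge_at_top[of n]
    proof eventually_elim
      case (elim k)
      then show ?case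
        using AA_BB[OF elim f] AA_plus_BB[OF elim f(2)] by (simp add: add.commute)
    qed
    then have "emeasure N ?B + emeasure N ?C = emeasure L ?C"
      using f by (intro N2[of _ _ n] box_L box_sub_pX) auto
    then have *: "ennreal p * emeasure L ?B + ennreal p * emeasure L ?C = emeasure L ?C"
      using p(3) box_L f by simp
    obtain b c where bc: "emeasure L ?B = ennreal b" "b \<ge> 0" "emeasure L ?C = ennreal c" "c \<ge> 0"
      using finL[OF f(1)] finL[OF f(2)] by (metis ennreal_cases infinity_ennreal_def)
    have "ennreal (p * b + p * c) = ennreal c"
      using * bc p(1) by (simp add: ennreal_mult'[symmetric] ennreal_plus[symmetric] del: ennreal_plus)
    then have "p * b + p * c = c" using bc p(1) by (subst (asm) ennreal_inj) auto
    then have "p * b = (1 - p) * c" by (simp add: algebra_simps)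
    then show ?thesis using bc p(1,2) by (simp add: ennreal_mult'[symmetric])
  qed
  \<comment> \<open>At either extreme value of p the relation would make L vanish on all boxes of a
    family that covers the space.\<close>
  have "p \<noteq> 0"
  proof
    assume "p = 0"
    obtain n f where f: "\<forall>i\<in>I. f i \<in> chacon_F n \<and> f i + e i \<in> chacon_F n" "emeasure L (pbox I n f) \<noteq> 0"
      using nonzero_box[of e] by blast
    show False using rel[of "\<lambda>i. f i + e i" n] f \<open>p = 0\<close> by simp
  qed
  have "p \<noteq> 1"
  proof
    assume "p = 1"
    obtain n f where f: "\<forall>i\<in>I. f i \<in> chacon_F n \<and> f i + - e i \<in> chacon_F n" "emeasure L (pbox I n f) \<noteq> 0"
      using nonzero_box[of "\<lambda>i. - e i"] by blast
    show False using rel[of f n] f \<open>p = 1\<close> by simp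
  qed
  have "scl (\<lambda>i. - e i) ((1 - p) / p)"
  proof (rule scl_boxes)
    show "(1 - p) / p > 0" using p \<open>p \<noteq> 0\<close> \<open>p \<noteq> 1\<close> by auto
    fix n f assume f: "\<forall>i\<in>I. f i \<in> chacon_F n \<and> f i + - e i \<in> chacon_F n"
    have "ennreal (1 / p) * (ennreal p * emeasure L (pbox I n f)) =
        ennreal (1 / p) * (ennreal (1 - p) * emeasure L (pbox I n (\<lambda>i. f i + - e i)))"
      using rel[of f n] f by simp
    moreover have "ennreal (1 / p) * ennreal p = 1" "ennreal (1 / p) * ennreal (1 - p) = ennreal ((1 - p) / p)"
      using p \<open>p \<noteq> 0\<close> by (simp_all add: ennreal_mult'[symmetric])
    ultimately show "emeasure L (pbox I n f) = ennreal ((1 - p) / p) * emeasure L (pbox I n (\<lambda>i. f i + - e i))"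
      by (simp add: mult.assoc[symmetric])
  qed
  then have "scl (\<lambda>i. - (- e i)) (1 / ((1 - p) / p))" by (rule scl_neg)
  then show ?case by auto
qed (use pX_L fin_pX AA_sets in blast)+

text \<open>If \<open>r \<noteq> 1\<close>, one of the increments \<open>(h + 1, - h)\<close> and \<open>(- h, h + 1)\<close> (on \<open>S\<close>, off \<open>S\<close>) has a
  mass larger by an exponential factor than \<open>shift_a\<close> and \<open>shift_b\<close>, and the Borel-Cantelli lemma
  then contradicts infinitely many hits.\<close>
lemma hit_bound:
  assumes r: "scl e r" "r \<noteq> 1"
  shows "\<exists>q>0. q < 1 \<and> (\<forall>f m n. (\<forall>i\<in>I. f i \<in> chacon_F m) \<longrightarrow> m \<le> n \<longrightarrow>
      emeasure L {x \<in> pbox I m f. hit S n x} \<le> ennreal (2 * q ^ n) * emeasure L (pbox I m f))"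
proof -
  have r0: "r > 0" using r by (simp add: scl_def)
  have sc: "scl (\<lambda>i. t + s * e i) (r powi s)" for t s
    using scl_add[OF scl_const[of t] scl_int[OF r(1), of s]] by simp
  \<comment> \<open>Translation by t + s e with no movement before level n sends the set into the
    same box, merely replacing the increment at n by another admissible one; the preimage of the box
    has r^s times its mass.\<close>
  have bound: "emeasure L {x \<in> pbox I m f. Q n (\<lambda>i\<in>I. inc n (x i))} \<le> ennreal (r powi s) * emeasure L (pbox I m f)"
    if f: "\<forall>i\<in>I. f i \<in> chacon_F m" and mn: "m \<le> n"
      and Q: "\<And>c i. Q n c \<Longrightarrow> i \<in> I \<Longrightarrow> c i + (t + s * e i) \<in> chacon_C (Suc n)"
    for f m n t s Q
  proof -
    have "{x \<in> pbox I m f. Q n (\<lambda>i\<in>I. inc n (x i))} \<subseteq> pT I (\<lambda>i. t + s * e i) -` pbox I m f \<inter> pS I"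
    proof
      fix x assume x: "x \<in> {x \<in> pbox I m f. Q n (\<lambda>i\<in>I. inc n (x i))}"
      then have xm: "x \<in> pX I m" and xf: "\<forall>i\<in>I. co m (x i) = f i" by (auto simp: mem_box_pX)
      have "\<forall>i\<in>I. inc n (x i) + (t + s * e i) - 0 \<in> chacon_C (Suc n)"
        using Q[of "\<lambda>i\<in>I. inc n (x i)"] x by auto
      then have "pT I (\<lambda>i. t + s * e i) x \<in> pbox I m f"
        using pT_exchange(1,2)[OF xm _ mn, of "\<lambda>_. 0" "\<lambda>i. t + s * e i"] f xf by (auto simp: mem_box_pX)
      then show "x \<in> pT I (\<lambda>i. t + s * e i) -` pbox I m f \<inter> pS I" using xm by (auto simp: pX_def)
    qed
    then have "emeasure L {x \<in> pbox I m f. Q n (\<lambda>i\<in>I. inc n (x i))} \<le>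
        emeasure L (pT I (\<lambda>i. t + s * e i) -` pbox I m f \<inter> pS I)"
      using pre_sets[OF box_L[OF f]] by (intro emeasure_mono) auto
    then show ?thesis using sclD[OF sc box_L[OF f]] by simp
  qed
  define q where "q = min r (1 / r)"
  have q: "0 < q" "q < 1" using r0 r(2) by (auto simp: q_def min_less_iff_disj)
  have hn: "chacon_h n \<ge> int n" for n using chacon_h_gt[of n] by simp
  have pw1: "r powi s \<le> q ^ n" if "r < 1" "s \<ge> int n" for s n
  proof -
    have "r powi s = r ^ nat s" using that by (simp add: power_int_def)
    also have "\<dots> \<le> r ^ n" using that r0 by (intro power_decreasing) auto
    finally show ?thesis using that r0 mult_le_one[of r r] by (auto simp: q_def min_def field_simps)
  qed
  have pw2: "r powi s \<le> q ^ n" if "r > 1" "- s \<ge> int n" for s n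
  proof -
    have "r powi s = (1 / r) ^ nat (- s)" using that by (auto simp: power_int_def field_simps)
    also have "\<dots> \<le> (1 / r) ^ n" using that r0 by (intro power_decreasing) auto
    also have "1 / r = q" using that r0 mult_strict_mono[of 1 r 1 r] by (auto simp: q_def min_def field_simps)
    finally show ?thesis by simp
  qed
  \<comment> \<open>The target, written (on S, off S), is (h + 1, - h) if r < 1 and (- h, h + 1) if
    r > 1. From a = (0, - h) this requires s = h + 1 or s = - (3 h + 1), from b = (h + 1, 0) below s
    = h or s = - (3 h + 2). In all cases s has the sign that makes r^s small and modulus at least
    h_n \<ge> n.\<close>
  have "\<exists>t s. r powi s \<le> q ^ n \<and> (\<forall>c i. is_a I S n c \<longrightarrow> i \<in> I \<longrightarrow> c i + (t + s * e i) \<in> chacon_C (Suc n))" for n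
  proof (cases "r < 1")
    case True
    then show ?thesis
      using hn[of n] by (intro exI[of _ 0] exI[of _ "chacon_h n + 1"])
        (auto intro!: pw1 simp: is_a_def shift_a_def mem_chacon_C_Suc_iff e_def)
  next
    case False
    then have "r > 1" using r(2) by simp
    then show ?thesis
      using hn[of n] by (intro exI[of _ "2 * chacon_h n + 1"] exI[of _ "- (3 * chacon_h n + 1)"])
        (auto intro!: pw2 simp: is_a_def shift_a_def mem_chacon_C_Suc_iff e_def)
  qed
  then obtain ta sa where a: "\<And>n. r powi sa n \<le> q ^ n" "\<And>n c i. is_a I S n c \<Longrightarrow> i \<in> I \<Longrightarrow> c i + (ta n + sa n * e i) \<in> chacon_C (Suc n)"
    by metis
  have "\<exists>t s. r powi s \<le> q ^ n \<and> (\<forall>c i. is_b I S n c \<longrightarrow> i \<in> I \<longrightarrow> c i + (t + s * e i) \<in> chacon_C (Suc n))" for n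
  proof (cases "r < 1")
    case True
    then show ?thesis
      using hn[of n] by (intro exI[of _ "- chacon_h n"] exI[of _ "chacon_h n"])
        (auto intro!: pw1 simp: is_b_def shift_b_def mem_chacon_C_Suc_iff e_def)
  next
    case False
    then have "r > 1" using r(2) by simp
    then show ?thesis
      using hn[of n] by (intro exI[of _ "chacon_h n + 1"] exI[of _ "- (3 * chacon_h n + 2)"])
        (auto intro!: pw2 simp: is_b_def shift_b_def mem_chacon_C_Suc_iff e_def)
  qed
  then obtain tb sb where b: "\<And>n. r powi sb n \<le> q ^ n" "\<And>n c i. is_b I S n c \<Longrightarrow> i \<in> I \<Longrightarrow> c i + (tb n + sb n * e i) \<in> chacon_C (Suc n)"
    by metis
  show ?thesis
  proof (intro exI[of _ q] conjI q allI impI)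
    fix f m n assume f: "\<forall>i\<in>I. f i \<in> chacon_F m" and mn: "m \<le> n"
    let ?a = "{x \<in> pbox I m f. is_a I S n (\<lambda>i\<in>I. inc n (x i))}"
    let ?b = "{x \<in> pbox I m f. is_b I S n (\<lambda>i\<in>I. inc n (x i))}"
    have s: "{x \<in> pbox I m f. Q (\<lambda>i\<in>I. inc n (x i))} \<in> sets L" for Q
    proof -
      have "{x \<in> pbox I m f. Q (\<lambda>i\<in>I. inc n (x i))} = pbox I m f \<inter> {x \<in> pX I m. Q (\<lambda>i\<in>I. inc n (x i))}"
        by (auto simp: mem_box_pX)
      also have "\<dots> \<in> sets L" using box_L[OF f] inc_set_sets[OF finI mn] setsL by auto
      finally show ?thesis .
    qed
    have le: "ennreal (r powi t) * emeasure L (pbox I m f) \<le> ennreal (q ^ n) * emeasure L (pbox I m f)"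
      if "r powi t \<le> q ^ n" for t
      using that by (intro mult_right_mono ennreal_leI) auto
    have "{x \<in> pbox I m f. hit S n x} = ?a \<union> ?b" by (auto simp: hit_def)
    then have "emeasure L {x \<in> pbox I m f. hit S n x} \<le> emeasure L ?a + emeasure L ?b"
      using s by (simp add: emeasure_subadditive)
    also have "\<dots> \<le> ennreal (q ^ n) * emeasure L (pbox I m f) + ennreal (q ^ n) * emeasure L (pbox I m f)"
    proof (rule add_mono)
      have "emeasure L ?a \<le> ennreal (r powi sa n) * emeasure L (pbox I m f)"
        using f mn by (rule bound) (rule a(2))
      then show "emeasure L ?a \<le> ennreal (q ^ n) * emeasure L (pbox I m f)"
        using le[OF a(1)] by (rule order_trans)
      have "emeasure L ?b \<le> ennreal (r powi sb n) * emeasure L (pbox I m f)"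
        using f mn by (rule bound) (rule b(2))
      then show "emeasure L ?b \<le> ennreal (q ^ n) * emeasure L (pbox I m f)"
        using le[OF b(1)] by (rule order_trans)
    qed
    also have "\<dots> = ennreal (2 * q ^ n) * emeasure L (pbox I m f)"
      using q by (simp add: distrib_right[symmetric] ennreal_plus[symmetric] del: ennreal_plus)
    finally show "emeasure L {x \<in> pbox I m f. hit S n x} \<le> ennreal (2 * q ^ n) * emeasure L (pbox I m f)" .
  qed
qed

lemma scl_e: "scl e 1"
proof -
  obtain r where r: "scl e r" using scl_e_exists by blast
  have "r = 1"
  proof (rule ccontr)
    assume "r \<noteq> 1"
    then obtain q where q: "0 < q" "q < 1" and hb: "\<And>f m n. \<forall>i\<in>I. f i \<in> chacon_F m \<Longrightarrow> m \<le> n \<Longrightarrow>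
      emeasure L {x \<in> pbox I m f. hit S n x} \<le> ennreal (2 * q ^ n) * emeasure L (pbox I m f)"
      using hit_bound[OF r \<open>r \<noteq> 1\<close>] by blast
    obtain m f where f: "\<forall>i\<in>I. f i \<in> chacon_F m" and nz: "emeasure L (pbox I m f) \<noteq> 0"
      using nonzero_box by blast
    \<comment> \<open>The bound is available from level m on; the shift of the index by m does not
      affect what happens for all large levels.\<close>
    define A where "A n = {x \<in> pbox I m f. hit S (n + m) x}" for n
    have A_eq: "A n = pbox I m f \<inter> {x \<in> pX I m. hit S (n + m) x}" for n
      by (auto simp: A_def mem_box_pX)
    have As: "A n \<in> sets L" for n
      unfolding A_eq hit_def using box_L[OF f] inc_set_sets[OF finI, of m "n + m"] setsL by auto
    have finA: "emeasure L (A n) < \<infinity>" for n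
    proof -
      have "emeasure L (A n) \<le> emeasure L (pbox I m f)"
        using box_L[OF f] by (intro emeasure_mono) (auto simp: A_def)
      then show ?thesis using finL[OF f] by (simp add: less_top order_le_less_trans)
    qed
    have mA: "measure L (A n) \<le> 2 * q ^ n * measure L (pbox I m f)" for n
    proof -
      have "emeasure L (A n) \<le> ennreal (2 * q ^ (n + m)) * emeasure L (pbox I m f)"
        using hb[OF f, of "n + m"] by (simp add: A_def)
      also have "\<dots> = ennreal (2 * q ^ (n + m) * measure L (pbox I m f))"
        using finL[OF f] q by (simp add: emeasure_eq_ennreal_measure ennreal_mult)
      finally have "measure L (A n) \<le> 2 * q ^ (n + m) * measure L (pbox I m f)"
        using q by (simp add: measure_def enn2real_leI)
      also have "\<dots> \<le> 2 * q ^ n * measure L (pbox I m f)"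
        using q by (intro mult_right_mono mult_left_mono power_decreasing) auto
      finally show ?thesis .
    qed
    have "summable (\<lambda>n. measure L (A n))"
    proof (rule summable_comparison_test')
      show "summable (\<lambda>n. 2 * q ^ n * measure L (pbox I m f))"
        using q by (intro summable_mult summable_mult2 summable_geometric) auto
      show "norm (measure L (A n)) \<le> 2 * q ^ n * measure L (pbox I m f)" for n using mA[of n] by simp
    qed
    then have "AE x in L. \<forall>\<^sub>F n in sequentially. x \<in> space L - A n"
      using As finA by (intro borel_cantelli_AE1)
    then have "AE x in L. x \<notin> pbox I m f"
      using io
    proof eventually_elim
      case (elim x)
      show ?case
      proof
        assume x: "x \<in> pbox I m f"
        have "\<forall>\<^sub>F n in sequentially. \<not> hit S (n + m) x"
          using elim(1) by eventually_elim (auto simp: A_def x)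
        then have "\<forall>\<^sub>F n in sequentially. \<not> hit S n x"
          by (subst (asm) eventually_sequentially_seg)
        then show False using elim(2) by (simp add: frequently_def)
      qed
    qed
    then have "emeasure L (pbox I m f) = 0"
      using box_L[OF f] AE_iff_measurable[of "pbox I m f" L "\<lambda>x. x \<notin> pbox I m f"] box_sub spaceL by auto
    then show False using nz by simp
  qed
  then show ?thesis using r by simp
qed

end

end

section \<open>Splitting off a factor\<close>

lemma restrict_pS: "J \<subseteq> I \<Longrightarrow> x \<in> pS I \<Longrightarrow> restrict x J \<in> pS J"
  by (auto simp: pS_def)

lemma restrict_pT: "J \<subseteq> I \<Longrightarrow> restrict (pT I v x) J = pT J v (restrict x J)"
  by (auto simp: pT_def restrict_def fun_eq_iff)

lemma pT_cong: "(\<And>i. i \<in> I \<Longrightarrow> v i = w i) \<Longrightarrow> pT I v = pT I w"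
  by (auto simp: pT_def fun_eq_iff restrict_def)

lemma box_iff_restrict:
  assumes "x \<in> pS (J \<union> K)"
  shows "x \<in> pbox (J \<union> K) n f \<longleftrightarrow> restrict x J \<in> pbox J n f \<and> restrict x K \<in> pbox K n f"
  using assms by (auto simp: mem_box_iff pS_extensional)

lemma restrict_measurable:
  assumes I: "finite I" and J: "J \<subseteq> I"
  shows "(\<lambda>x. restrict x J) \<in> measurable (pB I) (pB J)"
proof -
  have fJ: "finite J" using I J finite_subset by blast
  show ?thesis
  proof (rule measurable_sigma_sets[OF sets_pB[OF fJ, of "\<lambda>_. 0"]])
    show "boxes J (\<lambda>_. 0) \<subseteq> Pow (pS J)" using Union_boxes[OF fJ, of "\<lambda>_. 0"] by auto
    show "(\<lambda>x. restrict x J) \<in> space (pB I) \<rightarrow> pS J" using restrict_pS[OF J] by (auto simp: space_pB)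
    fix B assume "B \<in> boxes J (\<lambda>_. 0)"
    then obtain n f where B: "B = pbox J n f" by (auto simp: boxes_def)
    show "(\<lambda>x. restrict x J) -` B \<inter> space (pB I) \<in> sets (pB I)"
    proof (rule pX_open_sets[OF I])
      fix x assume x: "x \<in> (\<lambda>x. restrict x J) -` B \<inter> space (pB I)"
      then have xS: "x \<in> pS I" by (simp add: space_pB)
      obtain m where m: "m \<ge> n" "\<forall>i\<in>I. x i \<in> cX m" using pX_level[OF I xS] by metis
      have "y \<in> (\<lambda>x. restrict x J) -` B \<inter> space (pB I)"
        if y: "y \<in> pX I m" "\<forall>i\<in>I. co m (y i) = co m (x i)" for y
      proof -
        have 1: "restrict x J \<in> pbox J m (\<lambda>i. co m (x i))" "restrict y J \<in> pbox J m (\<lambda>i. co m (x i))"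
          using m y J by (auto simp: mem_box_iff pX_def)
        have 2: "restrict x J \<in> pbox J n f" using x by (simp add: B)
        show ?thesis using box_sub_if_meet[OF 2 1(1) m(1)] 1(2) y(1) by (auto simp: B space_pB pX_def)
      qed
      then show "\<exists>n. x \<in> pX I n \<and> (\<forall>y\<in>pX I n. (\<forall>i\<in>I. co n (y i) = co n (x i)) \<longrightarrow>
          y \<in> (\<lambda>x. restrict x J) -` B \<inter> space (pB I))"
        using m xS by (intro exI[of _ m]) (auto simp: pX_def)
    qed (simp add: space_pB)
  qed
qed

lemma ergodic_measure_scale:
  assumes "ergodic_measure T M"
  shows "ergodic_measure T (scale_measure c M)"
proof -
  have T: "T \<in> measurable M M" "\<And>A. A \<in> sets M \<Longrightarrow> emeasure M (T -` A \<inter> space M) = emeasure M A"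
    and E: "\<And>A. A \<in> sets M \<Longrightarrow> T -` A \<inter> space M = A \<Longrightarrow> emeasure M A = 0 \<or> emeasure M (space M - A) = 0"
    using assms by (auto simp: ergodic_measure_def invariant_measure_def)
  have "T \<in> measurable (scale_measure c M) (scale_measure c M)"
    using T(1) measurable_cong_sets[of "scale_measure c M" M "scale_measure c M" M] by simp
  then show ?thesis
    unfolding ergodic_measure_def invariant_measure_def space_scale_measure sets_scale_measure
    using T(2) E by simp blast
qed

section \<open>Slices of an ergodic measure\<close>

context ergodic_power
begin

definition sec :: "nat set \<Rightarrow> (nat \<Rightarrow> cf_point) set \<Rightarrow> (nat \<Rightarrow> cf_point) measure" where
  "sec J D = distr (density L (indicator D)) (pB J) (\<lambda>x. restrict x J)"

lemma restrict_L: "J \<subseteq> I \<Longrightarrow> (\<lambda>x. restrict x J) \<in> measurable L (pB J)"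
  using restrict_measurable[OF finI] measurable_cong_sets[OF setsL refl] by metis

lemma restrict_pre: "J \<subseteq> I \<Longrightarrow> A \<in> sets (pB J) \<Longrightarrow> {x \<in> pS I. restrict x J \<in> A} \<in> sets L"
  using measurable_sets[OF restrict_L, of J A] by (simp add: spaceL vimage_def Int_def conj_commute)

lemma emeasure_sec:
  assumes J: "J \<subseteq> I" and D: "D \<in> sets L" and A: "A \<in> sets (pB J)"
  shows "emeasure (sec J D) A = emeasure L {x \<in> D. restrict x J \<in> A}"
proof -
  have "emeasure (sec J D) A = emeasure (density L (indicator D)) ((\<lambda>x. restrict x J) -` A \<inter> space L)"
    unfolding sec_def using restrict_L[OF J] A by (subst emeasure_distr) auto
  also have "\<dots> = emeasure L (D \<inter> ((\<lambda>x. restrict x J) -` A \<inter> space L))"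
    using D measurable_sets[OF restrict_L[OF J] A]
    by (subst emeasure_density) (auto simp: nn_integral_indicator[symmetric] indicator_inter_arith[symmetric] simp del: nn_integral_indicator)
  also have "D \<inter> ((\<lambda>x. restrict x J) -` A \<inter> space L) = {x \<in> D. restrict x J \<in> A}"
    using sub_space[OF D] spaceL by auto
  finally show ?thesis .
qed

lemma sets_sec: "sets (sec J D) = sets (pB J)"
  by (simp add: sec_def)

lemma sec_power:
  assumes J: "J \<subseteq> I" and C: "C \<in> sets (pB (I - J))" "C \<subseteq> pX (I - J) n"
  shows "power_measure J (sec J {x \<in> pS I. restrict x (I - J) \<in> C})" (is "power_measure J (sec J ?D)")
proof
  have D: "?D \<in> sets L" using C by (intro restrict_pre) auto
  show fJ: "finite J" using J finI finite_subset by blast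
  show "sets (sec J ?D) = sets (pB J)" by (rule sets_sec)
  fix m f assume f: "\<forall>i\<in>J. f i \<in> chacon_F m"
  have "{x \<in> ?D. restrict x J \<in> pbox J m f} \<subseteq> pX I (max n m)"
  proof
    fix x assume x: "x \<in> {x \<in> ?D. restrict x J \<in> pbox J m f}"
    have "x i \<in> cX (max n m)" if i: "i \<in> I" for i
    proof (cases "i \<in> J")
      case True
      then have "x i \<in> cX m" using x by (auto simp: mem_box_iff)
      then show ?thesis using C.cf_X_mono[of m "max n m"] by auto
    next
      case False
      then have "restrict x (I - J) \<in> pX (I - J) n" using x C(2) by auto
      then have "x i \<in> cX n" using False i by (auto simp: pX_def)
      then show ?thesis using C.cf_X_mono[of n "max n m"] by auto
    qed
    then show "x \<in> pX I (max n m)" using x by (auto simp: pX_def)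
  qed
  then have "emeasure L {x \<in> ?D. restrict x J \<in> pbox J m f} \<le> emeasure L (pX I (max n m))"
    using pX_L by (intro emeasure_mono) auto
  then show "emeasure (sec J ?D) (pbox J m f) \<noteq> \<infinity>"
    using fin_pX[of "max n m"] emeasure_sec[OF J D box_sets[OF fJ f]] by (auto simp: top_unique)
qed

lemma sec_inv:
  assumes J: "J \<subseteq> I" and inv: "scl (\<lambda>i. if i \<in> J then 1 else 0) 1" and C: "C \<in> sets (pB (I - J))"
    and A: "A \<in> sets (pB J)"
  shows "emeasure (sec J {x \<in> pS I. restrict x (I - J) \<in> C}) (pT J (\<lambda>_. 1) -` A \<inter> pS J) =
     emeasure (sec J {x \<in> pS I. restrict x (I - J) \<in> C}) A" (is "emeasure (sec J ?D) _ = _")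
proof -
  let ?v = "\<lambda>i. if i \<in> J then 1 else 0 :: int"
  have fJ: "finite J" using J finI finite_subset by blast
  have D: "?D \<in> sets L" using C by (intro restrict_pre) auto
  have A': "pT J (\<lambda>_. 1) -` A \<inter> pS J \<in> sets (pB J)"
    using measurable_sets[OF pT_measurable[OF fJ] A] by (simp add: space_pB)
  have 1: "restrict (pT I ?v x) J = pT J (\<lambda>_. 1) (restrict x J)" for x
    unfolding restrict_pT[OF J] by (intro fun_cong[OF pT_cong]) auto
  have 2: "restrict (pT I ?v x) (I - J) = restrict x (I - J)" if "x \<in> pS I" for x
  proof -
    have "restrict (pT I ?v x) (I - J) = pT (I - J) (\<lambda>_. 0) (restrict x (I - J))"
      unfolding restrict_pT[of "I - J" I, OF Diff_subset] by (intro fun_cong[OF pT_cong]) auto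
    then show ?thesis using pT_0[OF restrict_pS[of "I - J" I x]] that by auto
  qed
  have e: "{x \<in> ?D. restrict x J \<in> pT J (\<lambda>_. 1) -` A \<inter> pS J} = pT I ?v -` {x \<in> ?D. restrict x J \<in> A} \<inter> pS I"
    using 1 2 pT_pS[of _ I ?v] restrict_pS[OF J] by auto
  have "{x \<in> ?D. restrict x J \<in> A} = ?D \<inter> {x \<in> pS I. restrict x J \<in> A}" by auto
  also have "\<dots> \<in> sets L" using D restrict_pre[OF J A] by auto
  finally have s: "{x \<in> ?D. restrict x J \<in> A} \<in> sets L" .
  have "emeasure L {x \<in> ?D. restrict x J \<in> pT J (\<lambda>_. 1) -` A \<inter> pS J} = emeasure L {x \<in> ?D. restrict x J \<in> A}"
    unfolding e sclD[OF inv s] by simp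
  then show ?thesis using emeasure_sec[OF J D] A A' by simp
qed

text \<open>An invariant set A in the coordinates J lifts to the set of x whose restriction lies in
  A. The lift is invariant under the full diagonal translation, so ergodicity of L decides it and
  the slice inherits the decision.\<close>

lemma sec_ergodic:
  assumes J: "J \<subseteq> I" and inv: "scl (\<lambda>i. if i \<in> J then 1 else 0) 1"
    and C: "C \<in> sets (pB (I - J))" "C \<subseteq> pX (I - J) n"
    and nz: "emeasure (sec J {x \<in> pS I. restrict x (I - J) \<in> C}) (pS J) \<noteq> 0" 
  shows "ergodic_power J (sec J {x \<in> pS I. restrict x (I - J) \<in> C})" (is "ergodic_power J (sec J ?D)")
proof -
  interpret D: power_measure J "sec J ?D" by (rule sec_power[OF J C])
  have Ds: "?D \<in> sets L" using C by (intro restrict_pre) auto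
  show ?thesis
  proof
    show "emeasure (sec J ?D) (space (sec J ?D)) \<noteq> 0" using nz by (simp add: D.spaceL)
    show "ergodic_measure (chacon_pow_T J) (sec J ?D)"
      unfolding ergodic_measure_def chacon_pow_T_eq D.spaceL
    proof (intro conjI ballI impI)
      show "invariant_measure (pT J (\<lambda>_. 1)) (sec J ?D)"
        using D.pT_L sec_inv[OF J inv C(1)] by (auto simp: invariant_measure_def D.spaceL D.setsL)
      fix A assume A: "A \<in> sets (sec J ?D)" and Ainv: "pT J (\<lambda>_. 1) -` A \<inter> pS J = A"
      have As: "A \<in> sets (pB J)" using A D.setsL by simp
      define E where "E = {x \<in> pS I. restrict x J \<in> A}"
      have E: "E \<in> sets L" unfolding E_def by (rule restrict_pre[OF J As])
      have "pT I (\<lambda>_. 1) -` E \<inter> pS I = E"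
        using Ainv pT_pS[of _ I "\<lambda>_. 1"] restrict_pT[OF J] restrict_pS[OF J] by (auto simp: E_def)
      then have "emeasure L E = 0 \<or> emeasure L (pS I - E) = 0"
        using erg E by (auto simp: ergodic_measure_def chacon_pow_T_eq spaceL)
      moreover have "emeasure (sec J ?D) A \<le> emeasure L E"
        unfolding emeasure_sec[OF J Ds As] using E by (intro emeasure_mono) (auto simp: E_def)
      moreover have "emeasure (sec J ?D) (pS J - A) \<le> emeasure L (pS I - E)"
      proof -
        have s: "pS J - A \<in> sets (pB J)" using As sets.compl_sets[OF As] by (simp add: space_pB)
        have "pS I - E \<in> sets L" using E sets.compl_sets[of E L] by (simp add: spaceL)
        then show ?thesis
          unfolding emeasure_sec[OF J Ds s] by (intro emeasure_mono) (auto simp: E_def)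
      qed
      ultimately show "emeasure (sec J ?D) A = 0 \<or> emeasure (sec J ?D) (pS J - A) = 0" by auto
    qed
  qed
qed

text \<open>Both slices are dominated by the slice over the union of C and C0, which is ergodic, so
  both are multiples of it. Cross-multiplication avoids dividing by the factors.\<close>

lemma sec_proportional:
  assumes J: "J \<subseteq> I" and inv: "scl (\<lambda>i. if i \<in> J then 1 else 0) 1"
    and C: "C \<in> sets (pB (I - J))" "C \<subseteq> pX (I - J) n"
    and C0: "C0 \<in> sets (pB (I - J))" "C0 \<subseteq> pX (I - J) n"
    and A: "A \<in> sets (pB J)" and A0: "A0 \<in> sets (pB J)"
    and nz: "emeasure (sec J {x \<in> pS I. restrict x (I - J) \<in> C0}) A0 \<noteq> 0" 
  shows "emeasure (sec J {x \<in> pS I. restrict x (I - J) \<in> C}) A * emeasure (sec J {x \<in> pS I. restrict x (I - J) \<in> C0}) A0 =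
    emeasure (sec J {x \<in> pS I. restrict x (I - J) \<in> C}) A0 * emeasure (sec J {x \<in> pS I. restrict x (I - J) \<in> C0}) A"
proof -
  define D where "D C = {x \<in> pS I. restrict x (I - J) \<in> C}" for C
  define M where "M = sec J (D (C \<union> C0))"
  have CC: "C \<union> C0 \<in> sets (pB (I - J))" "C \<union> C0 \<subseteq> pX (I - J) n" using C C0 by auto
  have Ds: "D C \<in> sets L" if "C \<in> sets (pB (I - J))" for C
    unfolding D_def using that by (intro restrict_pre) auto
  have le: "emeasure (sec J (D C')) B \<le> emeasure M B" if "C' \<in> {C, C0}" "B \<in> sets (pB J)" for C' B
  proof -
    have "{x \<in> D (C \<union> C0). restrict x J \<in> B} = D (C \<union> C0) \<inter> {x \<in> pS I. restrict x J \<in> B}"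
      by (auto simp: D_def)
    also have "\<dots> \<in> sets L" using Ds[OF CC(1)] restrict_pre[OF J that(2)] by auto
    finally have s: "{x \<in> D (C \<union> C0). restrict x J \<in> B} \<in> sets L" .
    have "C' \<in> sets (pB (I - J))" using that(1) C C0 by auto
    then have "emeasure (sec J (D C')) B = emeasure L {x \<in> D C'. restrict x J \<in> B}"
      by (intro emeasure_sec[OF J Ds that(2)])
    also have "\<dots> \<le> emeasure L {x \<in> D (C \<union> C0). restrict x J \<in> B}"
      using s that(1) by (intro emeasure_mono) (auto simp: D_def)
    also have "\<dots> = emeasure M B"
      unfolding M_def by (rule emeasure_sec[OF J Ds[OF CC(1)] that(2), symmetric])
    finally show ?thesis .
  qed
  have "emeasure M A0 \<noteq> 0" using le[of C0 A0] nz A0 by (auto simp: D_def)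
  moreover have "emeasure M A0 \<le> emeasure M (pS J)"
    using sets.sets_into_space[OF A0] emeasure_space[of M A0] by (simp add: M_def sec_def space_pB)
  ultimately have "emeasure M (pS J) \<noteq> 0" by auto
  then interpret M: ergodic_power J M
    unfolding M_def D_def by (rule sec_ergodic[OF J inv CC])
  have ex: "\<exists>p::real. 0 \<le> p \<and> p \<le> 1 \<and> (\<forall>B\<in>sets M. emeasure (sec J (D C')) B = ennreal p * emeasure M B)"
    if C': "C' \<in> {C, C0}" for C'
  proof (rule M.proportional)
    show "sets (sec J (D C')) = sets M" by (simp add: M_def sets_sec)
    show "emeasure (sec J (D C')) B \<le> emeasure M B" if "B \<in> sets M" for B
      using le[OF C', of B] that by (simp add: M_def sets_sec)
    fix m f assume f: "\<forall>i\<in>J. f i \<in> chacon_F m \<and> f i + 1 \<in> chacon_F m"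
    have "C' \<in> sets (pB (I - J))" using C' C C0 by auto
    then have "emeasure (sec J (D C')) (pT J (\<lambda>_. 1) -` pbox J m (\<lambda>i. f i + 1) \<inter> pS J) = emeasure (sec J (D C')) (pbox J m (\<lambda>i. f i + 1))"
      unfolding D_def using f M.finI by (intro sec_inv[OF J inv] box_sets) auto
    then show "emeasure (sec J (D C')) (pbox J m f) = emeasure (sec J (D C')) (pbox J m (\<lambda>i. f i + 1))"
      using pT_box[of J f m "\<lambda>_. 1"] f by simp
  qed
  obtain p q where "\<And>B. B \<in> sets M \<Longrightarrow> emeasure (sec J (D C)) B = ennreal p * emeasure M B"
    "\<And>B. B \<in> sets M \<Longrightarrow> emeasure (sec J (D C0)) B = ennreal q * emeasure M B"
    using ex[of C] ex[of C0] by blast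
  moreover have "A \<in> sets M" "A0 \<in> sets M" using A A0 by (auto simp: M_def sets_sec)
  ultimately show ?thesis unfolding D_def[symmetric] by (simp add: mult_ac)
qed

text \<open>Fix a box of positive mass l and slice L over each of its two halves. Proportionality
  gives L(A x C) l = L(A x C0) L(A0 x C) for boxes, so L1 is the slice over C0 and L2 the slice over
  A0 divided by l. The translation on the complement of J preserves L as well, being the diagonal
  one composed with the inverse of that on J; hence both factors are ergodic.\<close>

lemma split_product:
  assumes J: "J \<subseteq> I" and inv: "scl (\<lambda>i. if i \<in> J then 1 else 0) 1"
  obtains L1 L2 where "ergodic_power J L1" "ergodic_power (I - J) L2"
    "\<And>n f. \<forall>i\<in>I. f i \<in> chacon_F n \<Longrightarrow>
       emeasure L (pbox I n f) = emeasure L1 (pbox J n f) * emeasure L2 (pbox (I - J) n f)"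
proof -
  let ?K = "I - J"
  have K: "?K \<subseteq> I" "I - ?K = J" "I = J \<union> ?K" using J by auto
  have fin: "finite J" "finite ?K" using finI J finite_subset by auto
  have inv': "scl (\<lambda>i. if i \<in> ?K then 1 else 0) 1"
  proof -
    have "scl (\<lambda>i. 1 + - (if i \<in> J then 1 else 0)) (1 * (1 / 1))"
      by (rule scl_add[OF scl_1 scl_neg[OF inv]])
    then have "scl (\<lambda>i. 1 + - (if i \<in> J then 1 else 0)) 1" by simp
    also have "scl (\<lambda>i. 1 + - (if i \<in> J then 1 else 0)) 1 = scl (\<lambda>i. if i \<in> ?K then 1 else 0) 1"
      by (rule scl_cong) auto
    finally show ?thesis .
  qed
  obtain n0 f0 where f0: "\<forall>i\<in>I. f0 i \<in> chacon_F n0" and nz: "emeasure L (pbox I n0 f0) \<noteq> 0"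
    using nonzero_box by blast
  define D where "D C = {x \<in> pS I. restrict x ?K \<in> C}" for C
  define E where "E A = {x \<in> pS I. restrict x J \<in> A}" for A
  have Ds: "D C \<in> sets L" if "C \<in> sets (pB ?K)" for C
    unfolding D_def using that K by (intro restrict_pre) auto
  have Es: "E A \<in> sets L" if "A \<in> sets (pB J)" for A
    unfolding E_def using that J by (intro restrict_pre) auto
  have bJ: "pbox J n f \<in> sets (pB J)" and bK: "pbox ?K n f \<in> sets (pB ?K)" if "\<forall>i\<in>I. f i \<in> chacon_F n" for n f
    using that J fin by (auto intro!: box_sets)
  have DJ: "emeasure (sec J (D C)) A = emeasure L (D C \<inter> E A)" if "A \<in> sets (pB J)" "C \<in> sets (pB ?K)" for A C
    using that by (subst emeasure_sec[OF J Ds]) (auto simp: D_def E_def intro!: arg_cong[where f = "emeasure L"])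
  have EK: "emeasure (sec ?K (E A)) C = emeasure L (D C \<inter> E A)" if "A \<in> sets (pB J)" "C \<in> sets (pB ?K)" for A C
    using that by (subst emeasure_sec[OF K(1) Es]) (auto simp: D_def E_def intro!: arg_cong[where f = "emeasure L"])
  have bI: "pbox I n f = D (pbox ?K n f) \<inter> E (pbox J n f)" for n f
  proof -
    have "x \<in> pbox I n f \<longleftrightarrow> restrict x J \<in> pbox J n f \<and> restrict x ?K \<in> pbox ?K n f" if "x \<in> pS I" for x
      using box_iff_restrict[of x J ?K n f] that K(3) by simp
    then show ?thesis using box_sub[of I n f] by (auto simp: D_def E_def)
  qed
  define L1 where "L1 = sec J (D (pbox ?K n0 f0))"
  define L2' where "L2' = sec ?K (E (pbox J n0 f0))"
  have nz1: "emeasure L1 (pbox J n0 f0) \<noteq> 0" "emeasure L2' (pbox ?K n0 f0) \<noteq> 0"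
    using nz DJ EK bJ bK f0 bI by (auto simp: L1_def L2'_def)
  interpret L1: ergodic_power J L1
    unfolding L1_def D_def
  proof (rule sec_ergodic[OF J inv bK[OF f0] box_sub_pX[OF order_refl]])
    show "emeasure (sec J {x \<in> pS I. restrict x ?K \<in> pbox ?K n0 f0}) (pS J) \<noteq> 0"
      using nz1(1) emeasure_space[of L1 "pbox J n0 f0"] by (auto simp: L1_def D_def sec_def space_pB)
  qed
  interpret L2: ergodic_power ?K L2'
  proof -
    have "ergodic_power ?K (sec ?K {x \<in> pS I. restrict x (I - ?K) \<in> pbox J n0 f0})"
    proof (rule sec_ergodic[OF K(1) inv'])
      show "pbox J n0 f0 \<in> sets (pB (I - ?K))" "pbox J n0 f0 \<subseteq> pX (I - ?K) n0"
        using bJ[OF f0] box_sub_pX K(2) by auto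
      show "emeasure (sec ?K {x \<in> pS I. restrict x (I - ?K) \<in> pbox J n0 f0}) (pS ?K) \<noteq> 0"
        using nz1(2) emeasure_space[of L2' "pbox ?K n0 f0"] K(2) by (auto simp: L2'_def E_def sec_def space_pB)
    qed
    then show "ergodic_power ?K L2'" using K(2) by (simp add: L2'_def E_def)
  qed
  define l where "l = measure L (pbox I n0 f0)"
  have l: "emeasure L (pbox I n0 f0) = ennreal l" "l > 0"
    using nz finL[OF f0] by (auto simp: l_def emeasure_eq_ennreal_measure zero_less_measure_iff)
  define L2 where "L2 = scale_measure (ennreal (1 / l)) L2'"
  have L2: "ergodic_power ?K L2"
  proof
    show "ergodic_measure (chacon_pow_T ?K) L2" unfolding L2_def by (rule ergodic_measure_scale[OF L2.erg])
    show "emeasure L2 (space L2) \<noteq> 0" using L2.nonzero l by (simp add: L2_def space_scale_measure)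
    show "emeasure L2 (pbox ?K n f) \<noteq> \<infinity>" if "\<forall>i\<in>?K. f i \<in> chacon_F n" for n f
      using L2.finL[OF that] by (simp add: L2_def ennreal_mult_eq_top_iff)
  qed (use L2.finI L2.setsL in \<open>auto simp: L2_def\<close>)
  show ?thesis
  proof (rule that[OF L1.ergodic_power_axioms L2])
    fix n f assume f: "\<forall>i\<in>I. f i \<in> chacon_F n"
    let ?m = "max n n0"
    have "emeasure (sec J (D (pbox ?K n f))) (pbox J n f) * emeasure (sec J (D (pbox ?K n0 f0))) (pbox J n0 f0) =
      emeasure (sec J (D (pbox ?K n f))) (pbox J n0 f0) * emeasure (sec J (D (pbox ?K n0 f0))) (pbox J n f)"
      unfolding D_def
    proof (rule sec_proportional[OF J inv bK[OF f] _ bK[OF f0] _ bJ[OF f] bJ[OF f0]])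
      show "pbox ?K n f \<subseteq> pX ?K ?m" "pbox ?K n0 f0 \<subseteq> pX ?K ?m" by (auto intro!: box_sub_pX)
      show "emeasure (sec J {x \<in> pS I. restrict x ?K \<in> pbox ?K n0 f0}) (pbox J n0 f0) \<noteq> 0"
        using nz1(1) by (simp add: L1_def D_def)
    qed
    then have "emeasure L (pbox I n f) * ennreal l = emeasure L2' (pbox ?K n f) * emeasure L1 (pbox J n f)"
      using DJ EK bJ bK f f0 bI l(1) by (simp add: L1_def L2'_def)
    then have "emeasure L (pbox I n f) * (ennreal l * ennreal (1 / l)) =
        emeasure L1 (pbox J n f) * (ennreal (1 / l) * emeasure L2' (pbox ?K n f))"
      by (metis mult.assoc mult.commute)
    moreover have "ennreal l * ennreal (1 / l) = 1" using l(2) by (simp add: ennreal_mult'[symmetric])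
    ultimately show "emeasure L (pbox I n f) = emeasure L1 (pbox J n f) * emeasure L2 (pbox ?K n f)"
      by (simp add: L2_def)
  qed
qed

end

section \<open>Quasi-graph maps\<close>

context cut_sets
begin

text \<open>Invariance makes all cylinders of one level equally heavy, and splitting divides the
  mass by the number of cuts. So M is c times the normalised measure with c the mass at level 0,
  which settles existence in the description of \<open>cf_measure\<close>; uniqueness is
  \<open>cyl_measure_eqI\<close>.\<close>

lemma cf_measure_eq:
  assumes M: "sets M = sets (borel_of (cf_top D))"
    and ne: "\<And>k. D (Suc k) \<noteq> {}"
    and inv: "\<And>m f. f \<in> chacon_F m \<Longrightarrow> f + 1 \<in> chacon_F m \<Longrightarrow>
        emeasure M (cf_cyl D m f) = emeasure M (cf_cyl D m (f + 1))"
    and fin: "f0 \<in> chacon_F m0" "emeasure M (cf_cyl D m0 f0) \<noteq> \<infinity>"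
    and nz: "emeasure M (space M) \<noteq> 0"
  shows "\<exists>c::real>0. cf_measure D = scale_measure (ennreal (1 / c)) M"
proof -
  define v where "v m = emeasure M (cf_cyl D m 0)" for m
  have const: "emeasure M (cf_cyl D m f) = v m" if "f \<in> chacon_F m" for m f
  proof -
    have up: "emeasure M (cf_cyl D m (a + int k)) = emeasure M (cf_cyl D m a)"
      if "a \<in> chacon_F m" "a + int k \<in> chacon_F m" for a k
      using that
    proof (induction k)
      case (Suc k)
      have "a + int k \<in> chacon_F m"
        using Suc.prems by (auto simp: mem_chacon_F_iff abs_if split: if_splits)
      then show ?case using Suc inv[of "a + int k" m] by (simp add: algebra_simps)
    qed simp
    have z: "0 \<in> chacon_F m" using chacon_h_ge_1[of m] by (simp add: mem_chacon_F_iff)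
    show ?thesis
      using up[of 0 "nat f"] up[of f "nat (- f)"] that z by (cases "f \<ge> 0") (auto simp: v_def)
  qed
  have step: "v m = of_nat (card (D (Suc m))) * v (Suc m)" for m
  proof -
    have z: "0 \<in> chacon_F m" using chacon_h_ge_1[of m] by (simp add: mem_chacon_F_iff)
    have cF: "0 + c \<in> chacon_F (Suc m)" if "c \<in> D (Suc m)" for c
      using chacon_F_add_C[OF z, of c] D_sub that by auto
    have "v m = emeasure M (\<Union>c\<in>D (Suc m). cf_cyl D (Suc m) (0 + c))"
      unfolding v_def cf_cyl_split[OF z] ..
    also have "\<dots> = (\<Sum>c\<in>D (Suc m). emeasure M (cf_cyl D (Suc m) (0 + c)))"
    proof (rule sum_emeasure[symmetric])
      show "(\<lambda>c. cf_cyl D (Suc m) (0 + c)) ` D (Suc m) \<subseteq> sets M"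
        using cf_cyl_sets[OF cF] M by auto
    qed (use finite_D in \<open>auto simp: disjoint_family_on_def cf_cyl_eq\<close>)
    also have "\<dots> = (\<Sum>c\<in>D (Suc m). v (Suc m))"
      using cF const by (intro sum.cong) auto
    finally show ?thesis by simp
  qed
  define P where "P m = (\<Prod>k=1..m. real (card (D k)))" for m
  have cpos: "real (card (D k)) > 0" if "k \<ge> 1" for k
    using ne[of "k - 1"] finite_D[of k] that by (cases k) (auto simp: card_gt_0_iff)
  have Ppos: "P m > 0" for m unfolding P_def using cpos by (intro prod_pos) auto
  have v0: "v 0 = ennreal (P m) * v m" for m
  proof (induction m)
    case (Suc m)
    have "P (Suc m) = P m * real (card (D (Suc m)))" by (simp add: P_def)
    then show ?case using Suc step[of m] Ppos[of m]
      by (simp add: ennreal_mult' mult.assoc ennreal_of_nat_eq_real_of_nat)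
  qed (simp add: P_def)
  have "v 0 \<noteq> \<infinity>"
    using v0[of m0] const[OF fin(1)] fin(2) by (simp add: ennreal_mult_eq_top_iff)
  then obtain c where c: "v 0 = ennreal c" "c \<ge> 0" by (cases "v 0") auto
  have vm: "v m = ennreal (c / P m)" for m
  proof -
    have "ennreal (1 / P m) * v 0 = (ennreal (1 / P m) * ennreal (P m)) * v m"
      unfolding v0[of m] by (simp add: mult.assoc)
    also have "ennreal (1 / P m) * ennreal (P m) = 1" using Ppos[of m] by (simp add: ennreal_mult[symmetric])
    finally show ?thesis using c Ppos[of m] by (simp add: ennreal_mult'[symmetric])
  qed
  have "c \<noteq> 0"
  proof
    assume "c = 0"
    have "(\<Union>b\<in>cyls. b) \<in> null_sets M"
    proof (rule null_sets_UN'[OF countable_cyls])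
      fix b assume "b \<in> cyls"
      then obtain m f where b: "b = cf_cyl D m f" "f \<in> chacon_F m" by (auto simp: cyls_def)
      then show "b \<in> null_sets M"
        using const[OF b(2)] vm[of m] \<open>c = 0\<close> cf_cyl_sets[OF b(2)] M by (auto intro!: null_setsI)
    qed
    moreover have "space M = cf_space D"
      using sets_eq_imp_space_eq[OF M] by (simp add: space_borel_of topspace_cf_top)
    ultimately show False using nz Union_cyls by auto
  qed
  then have c0: "c > 0" using c by simp
  have val: "emeasure (scale_measure (ennreal (1 / c)) M) (cf_cyl D m f) = ennreal (1 / P m)"
    if "f \<in> chacon_F m" for m f
    using const[OF that] vm[of m] c0 Ppos[of m] by (simp add: ennreal_mult'[symmetric])
  have "cf_measure D = scale_measure (ennreal (1 / c)) M"
    unfolding cf_measure_def P_def[symmetric]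
  proof (rule the_equality)
    fix N assume N: "sets N = sets (borel_of (cf_top D)) \<and>
      (\<forall>n. \<forall>f\<in>chacon_F n. emeasure N (cf_cyl D n f) = ennreal (1 / P n))"
    then show "N = scale_measure (ennreal (1 / c)) M"
      using M val by (intro cyl_measure_eqI) auto
  qed (use M val in auto)
  then show ?thesis using c0 by blast
qed

lemma cyl_open_sets:
  assumes A: "A \<subseteq> cf_space D"
    and loc: "\<And>x. x \<in> A \<Longrightarrow> \<exists>n. x \<in> cf_X D n \<and> cf_cyl D n (cf_co D n x) \<subseteq> A"
  shows "A \<in> sets (borel_of (cf_top D))"
proof -
  have "A = \<Union>{b \<in> cyls. b \<subseteq> A}"
  proof (intro equalityI subsetI)
    fix x assume x: "x \<in> A"
    then obtain n where n: "x \<in> cf_X D n" "cf_cyl D n (cf_co D n x) \<subseteq> A" using loc by blast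
    moreover have "cf_cyl D n (cf_co D n x) \<in> cyls" using cf_co_F[OF n(1)] by (auto simp: cyls_def)
    moreover have "x \<in> cf_cyl D n (cf_co D n x)" using n(1) by (simp add: cf_cyl_eq)
    ultimately show "x \<in> \<Union>{b \<in> cyls. b \<subseteq> A}" by blast
  qed auto
  also have "\<dots> \<in> sets (borel_of (cf_top D))"
  proof (rule sets.countable_Union)
    show "countable {b \<in> cyls. b \<subseteq> A}" by (rule countable_subset[OF _ countable_cyls]) blast
  qed (auto simp: cyls_def cf_cyl_sets)
  finally show ?thesis .
qed

text \<open>\<open>cf_rep z x\<close> says that \<open>x\<close> is the image of \<open>z\<close> under the embedding of the space
  with cut sets \<open>D\<close> into the Chacon space.\<close>
definition cf_rep :: "cf_point \<Rightarrow> cf_point \<Rightarrow> bool" where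
  "cf_rep z x \<longleftrightarrow> z \<in> cf_space D \<and> x \<in> chacon_space \<and>
     (\<forall>\<^sub>F k in sequentially. cf_co D k z = co k x)"

lemma cf_rep_unique: "cf_rep z x \<Longrightarrow> cf_rep z x' \<Longrightarrow> x = x'"
proof -
  assume z: "cf_rep z x" "cf_rep z x'"
  have "\<forall>\<^sub>F k in sequentially. co k x = co k x'"
    using z[unfolded cf_rep_def, THEN conjunct2, THEN conjunct2] by eventually_elim simp
  then show ?thesis using z by (intro C.cf_ev_eqI) (auto simp: cf_rep_def)
qed

lemma cf_rep_unique': "cf_rep z x \<Longrightarrow> cf_rep z' x \<Longrightarrow> z = z'"
proof -
  assume z: "cf_rep z x" "cf_rep z' x"
  have "\<forall>\<^sub>F k in sequentially. cf_co D k z = cf_co D k z'"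
    using z[unfolded cf_rep_def, THEN conjunct2, THEN conjunct2] by eventually_elim simp
  then show ?thesis using z by (intro cf_ev_eqI) (auto simp: cf_rep_def)
qed

lemma cf_level_C: "p \<in> cf_level D n \<Longrightarrow> p \<in> cf_level chacon_C n"
proof (cases p)
  case (Pair f c)
  assume "p \<in> cf_level D n"
  then have "f \<in> chacon_F n" "c \<in> PiE {n<..} D" by (auto simp: Pair mem_cf_level)
  moreover have "PiE {n<..} D \<subseteq> PiE {n<..} chacon_C"
    by (intro PiE_mono D_sub') auto
  ultimately show ?thesis by (auto simp: Pair C.mem_cf_level)
qed

lemma cf_rep_pt:
  assumes "p \<in> cf_level D n"
  shows "cf_rep (cf_pt D n p) (cf_pt chacon_C n p)"
proof -
  obtain f c where p: "p = (f, c)" by (cases p)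
  have "\<forall>\<^sub>F k in sequentially. cf_co D k (cf_pt D n p) = co k (cf_pt chacon_C n p)"
    using eventually_ge_at_top[of n]
    by eventually_elim (use assms cf_level_C[OF assms] in \<open>simp add: p cf_co_pt C.cf_co_pt\<close>)
  then show ?thesis
    using assms cf_level_C[OF assms] cf_X_sub_space[of n] C.cf_X_sub_space[of n] by (auto simp: cf_rep_def cf_X_def)
qed

lemma cf_rep_exists:
  assumes "z \<in> cf_X D m"
  shows "\<exists>x\<in>cX m. cf_rep z x \<and> (\<forall>k\<ge>m. co k x = cf_co D k z)"
proof -
  obtain f c where fc: "(f, c) \<in> cf_level D m" "z = cf_pt D m (f, c)" using assms by (auto simp: cf_X_def)
  have l: "(f, c) \<in> cf_level chacon_C m" by (rule cf_level_C[OF fc(1)])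
  show ?thesis
    using cf_rep_pt[OF fc(1)] fc l cf_co_pt[OF fc(1)] C.cf_co_pt[OF l]
    by (intro bexI[of _ "cf_pt chacon_C m (f, c)"]) (auto simp: cf_X_def)
qed

lemma cf_rep_X:
  assumes "z \<in> cf_X D m" "cf_rep z x"
  shows "x \<in> cX m" "k \<ge> m \<Longrightarrow> co k x = cf_co D k z"
  using cf_rep_exists[OF assms(1)] cf_rep_unique[OF assms(2)] by auto

text \<open>Describes the image of the embedding: x comes from the smaller space as soon as its
  increments from some level on lie in the cut sets D.\<close>

lemma cf_rep_X':
  assumes "x \<in> cX m" "\<And>k. k \<ge> m \<Longrightarrow> inc k x \<in> D (Suc k)"
  shows "\<exists>z\<in>cf_X D m. cf_rep z x \<and> (\<forall>k\<ge>m. cf_co D k z = co k x)"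
proof -
  have "\<exists>z\<in>cf_X D m. \<forall>k\<ge>m. cf_co D k z = co k x"
  proof (rule cf_X_exists)
    fix k assume "k > m"
    then show "co k x - co (k - 1) x \<in> D k" using assms(2)[of "k - 1"] by (simp add: inc_def)
  qed (use assms C.cf_co_F in auto)
  then obtain z where z: "z \<in> cf_X D m" "\<forall>k\<ge>m. cf_co D k z = co k x" by blast
  then have "cf_rep z x"
    using cf_X_sub_space[of m] cX_space[OF assms(1)] by (auto simp: cf_rep_def eventually_sequentially)
  then show ?thesis using z by blast
qed

end

section \<open>The maps between quasi-graph spaces in coordinates\<close>

lemma quasi_phi_eq:
  assumes "cut_sets (quasi_C J \<alpha>)" "cut_sets.cf_rep (quasi_C J \<alpha>) z x"
  shows "quasi_phi J \<alpha> z = x"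
proof -
  interpret cut_sets "quasi_C J \<alpha>" by fact
  have z: "z \<in> cf_space (quasi_C J \<alpha>)" using assms(2) by (simp add: cf_rep_def)
  then obtain n p where np: "p \<in> cf_level (quasi_C J \<alpha>) n" "z = cf_pt (quasi_C J \<alpha>) n p"
    by (auto simp: cf_space_eq cf_X_def)
  show ?thesis
    unfolding quasi_phi_def
  proof (rule the_equality)
    show "\<exists>n p. p \<in> cf_level (quasi_C J \<alpha>) n \<and> z = cf_pt (quasi_C J \<alpha>) n p \<and> x = cf_pt chacon_C n p"
      using np cf_rep_unique[OF assms(2)] cf_rep_pt[OF np(1)] by blast
  next
    fix y assume "\<exists>n p. p \<in> cf_level (quasi_C J \<alpha>) n \<and> z = cf_pt (quasi_C J \<alpha>) n p \<and> y = cf_pt chacon_C n p"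
    then show "y = x" using cf_rep_unique[OF assms(2)] cf_rep_pt by blast
  qed
qed

text \<open>Two elements of C_(n+1) differ by at most 2 h_n + 1, and (h_n - 1) + (2 h_n + 1) = 3 h_n
  is below h_(n+1) - 1 = 6 h_n.\<close>

lemma sum_diff_bound:
  fixes \<alpha> \<beta> :: "nat \<Rightarrow> int"
  assumes "\<And>j. j \<notin> J \<Longrightarrow> j > 0 \<Longrightarrow> \<alpha> j \<in> chacon_C j" "\<And>j. j \<notin> J \<Longrightarrow> j > 0 \<Longrightarrow> \<beta> j \<in> chacon_C j"
  shows "\<bar>\<Sum>j\<in>{1..n} - J. \<beta> j - \<alpha> j\<bar> \<le> chacon_h n - 1"
proof (induction n)
  case (Suc n)
  have h: "chacon_h n \<ge> 1" by (rule chacon_h_ge_1)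
  show ?case
  proof (cases "Suc n \<in> J")
    case True
    then have "{1..Suc n} - J = {1..n} - J" by (auto simp: le_Suc_eq)
    then show ?thesis using Suc h by simp
  next
    case False
    then have "{1..Suc n} - J = insert (Suc n) ({1..n} - J)" by auto
    then have "(\<Sum>j\<in>{1..Suc n} - J. \<beta> j - \<alpha> j) = (\<beta> (Suc n) - \<alpha> (Suc n)) + (\<Sum>j\<in>{1..n} - J. \<beta> j - \<alpha> j)"
      by simp
    moreover have "\<bar>\<beta> (Suc n) - \<alpha> (Suc n)\<bar> \<le> 2 * chacon_h n + 1"
      using assms(1)[OF False] assms(2)[OF False] h by (auto simp: mem_chacon_C_Suc_iff)
    ultimately show ?thesis using Suc h by simp
  qed
qed simp

text \<open>The reason why the map from alpha to beta starts from a point of level n - 1: its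
  coordinate at level n keeps enough room for the accumulated differences up to n - 1, the
  difference at n being a mere exchange of increments.\<close>

lemma chacon_F_add_C_add:
  assumes "g \<in> chacon_F m" "c \<in> chacon_C (Suc m)" "\<bar>s\<bar> \<le> chacon_h m - 1"
  shows "g + c + s \<in> chacon_F (Suc m)"
  using assms by (auto simp: mem_chacon_F_iff mem_chacon_C_Suc_iff)

locale two_cuts = A: cut_sets "quasi_C J \<alpha>" + B: cut_sets "quasi_C J \<beta>" for J \<alpha> \<beta>
begin

abbreviation (input) "sdiff n \<equiv> (\<Sum>j\<in>{1..n} - J. \<beta> j - \<alpha> j)"

lemma \<alpha>_C: "j \<notin> J \<Longrightarrow> j > 0 \<Longrightarrow> \<alpha> j \<in> chacon_C j"
  using A.D_sub'[of j] by (simp add: quasi_C_def)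

lemma \<beta>_C: "j \<notin> J \<Longrightarrow> j > 0 \<Longrightarrow> \<beta> j \<in> chacon_C j"
  using B.D_sub'[of j] by (simp add: quasi_C_def)

lemma sdiff_Suc: "sdiff (Suc n) = sdiff n + (if Suc n \<in> J then 0 else \<beta> (Suc n) - \<alpha> (Suc n))"
proof -
  have "{1..Suc n} - J = (if Suc n \<in> J then {1..n} - J else insert (Suc n) ({1..n} - J))"
    by (auto simp: le_Suc_eq)
  then show ?thesis by simp
qed

lemma image_level:
  assumes z: "z \<in> cf_X (quasi_C J \<alpha>) m" and n: "n = Suc m"
    and fc: "(f, c) \<in> cf_level (quasi_C J \<alpha>) n" "z = cf_pt (quasi_C J \<alpha>) n (f, c)"
  defines "q \<equiv> (f + sdiff n, \<lambda>l\<in>{n<..}. if l \<in> J then c l else \<beta> l)"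
  shows "q \<in> cf_level (quasi_C J \<beta>) n"
    and "k \<ge> n \<Longrightarrow> cf_co (quasi_C J \<beta>) k (cf_pt (quasi_C J \<beta>) n q) = cf_co (quasi_C J \<alpha>) k z + sdiff k"
proof -
  let ?A = "quasi_C J \<alpha>" and ?B = "quasi_C J \<beta>"
  have f: "f = cf_co ?A n z" using A.cf_co_pt_same[OF fc(1)] fc(2) by simp
  define g where "g = cf_co ?A m z"
  have g: "g \<in> chacon_F m" unfolding g_def by (rule A.cf_co_F[OF z])
  have d: "f - g \<in> ?A (Suc m)" using A.cf_co_D[OF z, of "Suc m"] f n by (simp add: g_def)
  have h: "chacon_h m \<ge> 1" by (rule chacon_h_ge_1)
  have e: "f + sdiff n = g + (if Suc m \<in> J then f - g else \<beta> (Suc m)) + sdiff m"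
    using d sdiff_Suc[of m] n by (auto simp: quasi_C_def)
  have "(if Suc m \<in> J then f - g else \<beta> (Suc m)) \<in> chacon_C (Suc m)"
    using d \<beta>_C[of "Suc m"] by (auto simp: quasi_C_def)
  moreover have "\<bar>sdiff m\<bar> \<le> chacon_h m - 1"
    using \<alpha>_C \<beta>_C by (intro sum_diff_bound) auto
  ultimately have "f + sdiff n \<in> chacon_F (Suc m)"
    by (subst e) (rule chacon_F_add_C_add[OF g])
  then have "f + sdiff n \<in> chacon_F n" using n by simp
  then show q: "q \<in> cf_level ?B n"
    using fc(1) by (auto simp: q_def A.mem_cf_level B.mem_cf_level quasi_C_def PiE_iff split: if_splits)
  show "cf_co ?B k (cf_pt ?B n q) = cf_co ?A k z + sdiff k" if "k \<ge> n"
    using that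
  proof (induction k rule: dec_induct)
    case base
    then show ?case using B.cf_co_pt_same q f by (simp add: q_def)
  next
    case (step k)
    have a: "cf_co ?A (Suc k) z - cf_co ?A k z = c (Suc k)"
      using A.cf_co_step[OF fc(1), of "Suc k"] fc(2) step by simp
    have "c \<in> PiE {n<..} ?A" using fc(1) by (simp add: A.mem_cf_level)
    then have "c (Suc k) \<in> ?A (Suc k)" by (rule PiE_mem) (use step.hyps in simp)
    then have a': "Suc k \<notin> J \<Longrightarrow> c (Suc k) = \<alpha> (Suc k)" by (simp add: quasi_C_def)
    have "cf_co ?B (Suc k) (cf_pt ?B n q) - cf_co ?B k (cf_pt ?B n q) = (if Suc k \<in> J then c (Suc k) else \<beta> (Suc k))"
      using B.cf_co_step[of "fst q" "snd q" n "Suc k"] q step by (simp add: q_def)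
    then show ?case using a a' step sdiff_Suc[of k] by (auto split: if_splits)
  qed
qed

text \<open>At every level k the map adds the partial sum of \<beta> - \<alpha> up to k, whichever
  admissible n was used to evaluate it. All candidates thus have the same late coordinates, which
  makes the description well defined.\<close>

lemma quasi_phi2:
  assumes z: "z \<in> cf_X (quasi_C J \<alpha>) m" and n: "n = Suc m"
  shows "quasi_phi2 J \<beta> \<alpha> z \<in> cf_X (quasi_C J \<beta>) n"
    and "k \<ge> n \<Longrightarrow> cf_co (quasi_C J \<beta>) k (quasi_phi2 J \<beta> \<alpha> z) = cf_co (quasi_C J \<alpha>) k z + sdiff k"
proof -
  let ?A = "quasi_C J \<alpha>" and ?B = "quasi_C J \<beta>"
  define Q where "Q n f c = (f + sdiff n, \<lambda>l\<in>{n<..}. if l \<in> J then c l else \<beta> l)" for n f and c :: "nat \<Rightarrow> int"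
  have zn: "z \<in> cf_X ?A n" using z n A.cf_X_mono[of m n] by auto
  obtain f c where fc: "(f, c) \<in> cf_level ?A n" "z = cf_pt ?A n (f, c)"
    using zn by (auto simp: cf_X_def)
  have w: "cf_pt ?B n (Q n f c) \<in> cf_X ?B n"
    "k \<ge> n \<Longrightarrow> cf_co ?B k (cf_pt ?B n (Q n f c)) = cf_co ?A k z + sdiff k" for k
    using image_level[OF z n fc] by (auto simp: cf_X_def Q_def)
  have "quasi_phi2 J \<beta> \<alpha> z = cf_pt ?B n (Q n f c)"
    unfolding quasi_phi2_def Q_def[symmetric] cf_X_def[symmetric]
  proof (rule the_equality)
    show "\<exists>n'>0. \<exists>f' c'. z \<in> cf_X ?A (n' - 1) \<and> (f', c') \<in> cf_level ?A n' \<and> z = cf_pt ?A n' (f', c') \<and>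
        cf_pt ?B n (Q n f c) = cf_pt ?B n' (Q n' f' c')"
      using z n fc by (intro exI[of _ n]) auto
  next
    fix y assume "\<exists>n'>0. \<exists>f' c'. z \<in> cf_X ?A (n' - 1) \<and> (f', c') \<in> cf_level ?A n' \<and> z = cf_pt ?A n' (f', c') \<and>
        y = cf_pt ?B n' (Q n' f' c')"
    then obtain n' f' c' where n': "n' > 0" "z \<in> cf_X ?A (n' - 1)" "(f', c') \<in> cf_level ?A n'"
      "z = cf_pt ?A n' (f', c')" "y = cf_pt ?B n' (Q n' f' c')" by blast
    have y: "y \<in> cf_X ?B n'" "\<And>k. k \<ge> n' \<Longrightarrow> cf_co ?B k y = cf_co ?A k z + sdiff k"
      using image_level[OF n'(2) _ n'(3,4)] n'(1,5) by (auto simp: cf_X_def Q_def)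
    have "\<forall>\<^sub>F k in sequentially. cf_co ?B k y = cf_co ?B k (cf_pt ?B n (Q n f c))"
      using eventually_ge_at_top[of "max n n'"] by eventually_elim (use y w in auto)
    then show "y = cf_pt ?B n (Q n f c)"
      using y(1) w(1) B.cf_X_sub_space by (intro B.cf_ev_eqI) auto
  qed
  then show "quasi_phi2 J \<beta> \<alpha> z \<in> cf_X ?B n"
    "k \<ge> n \<Longrightarrow> cf_co ?B k (quasi_phi2 J \<beta> \<alpha> z) = cf_co ?A k z + sdiff k"
    using w by auto
qed

end

text \<open>Turns both definite descriptions into one formula for coordinates. One level is lost
  because the map from \<alpha> to \<beta> needs room one level up.\<close>

lemma quasi_psi_level:
  assumes cuts: "\<And>i. i \<in> I \<Longrightarrow> cut_sets (quasi_C J (\<alpha> i))" and I: "finite I" "I \<noteq> {}"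
    and z: "z \<in> cf_X (quasi_C J (\<alpha> (Min I))) m" and i: "i \<in> I"
  shows "quasi_psi I J \<alpha> z i \<in> cX (Suc m)"
    and "k \<ge> Suc m \<Longrightarrow> co k (quasi_psi I J \<alpha> z i) =
      cf_co (quasi_C J (\<alpha> (Min I))) k z + (\<Sum>j\<in>{1..k} - J. \<alpha> i j - \<alpha> (Min I) j)"
proof -
  have M: "Min I \<in> I" using I by simp
  interpret A: cut_sets "quasi_C J (\<alpha> (Min I))" by (rule cuts[OF M])
  interpret B: cut_sets "quasi_C J (\<alpha> i)" by (rule cuts[OF i])
  interpret two_cuts J "\<alpha> (Min I)" "\<alpha> i" ..
  have "quasi_psi I J \<alpha> z i \<in> cX (Suc m) \<and> (\<forall>k\<ge>Suc m. co k (quasi_psi I J \<alpha> z i) =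
      cf_co (quasi_C J (\<alpha> (Min I))) k z + (\<Sum>j\<in>{1..k} - J. \<alpha> i j - \<alpha> (Min I) j))"
  proof (cases "i = Min I")
    case True
    obtain x where x: "x \<in> cX m" "A.cf_rep z x" "\<forall>k\<ge>m. co k x = cf_co (quasi_C J (\<alpha> (Min I))) k z"
      using A.cf_rep_exists[OF z] by blast
    have "quasi_psi I J \<alpha> z i = x"
      using quasi_phi_eq[OF A.cut_sets_axioms x(2)] i True by (simp add: quasi_psi_def)
    then show ?thesis using x C.cf_X_mono[of m "Suc m"] True by auto
  next
    case False
    let ?w = "quasi_phi2 J (\<alpha> i) (\<alpha> (Min I)) z"
    note w = quasi_phi2[OF z refl]
    obtain x where x: "x \<in> cX (Suc m)" "B.cf_rep ?w x" "\<forall>k\<ge>Suc m. co k x = cf_co (quasi_C J (\<alpha> i)) k ?w"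
      using B.cf_rep_exists[OF w(1)] by blast
    have "quasi_psi I J \<alpha> z i = x"
      using quasi_phi_eq[OF B.cut_sets_axioms x(2)] i False by (simp add: quasi_psi_def)
    then show ?thesis using x w(2) by auto
  qed
  then show "quasi_psi I J \<alpha> z i \<in> cX (Suc m)"
    and "k \<ge> Suc m \<Longrightarrow> co k (quasi_psi I J \<alpha> z i) =
      cf_co (quasi_C J (\<alpha> (Min I))) k z + (\<Sum>j\<in>{1..k} - J. \<alpha> i j - \<alpha> (Min I) j)"
    by auto
qed

lemma quasi_psi_measurable:
  assumes cuts: "\<And>i. i \<in> I \<Longrightarrow> cut_sets (quasi_C J (\<alpha> i))" and I: "finite I" "I \<noteq> {}"
  shows "quasi_psi I J \<alpha> \<in> measurable (borel_of (cf_top (quasi_C J (\<alpha> (Min I))))) (pB I)"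
proof -
  let ?D = "quasi_C J (\<alpha> (Min I))"
  interpret A: cut_sets ?D using I by (intro cuts) simp
  have sp: "space (borel_of (cf_top ?D)) = cf_space ?D" by (simp add: space_borel_of A.topspace_cf_top)
  have psiS: "quasi_psi I J \<alpha> z \<in> pS I" if z: "z \<in> cf_space ?D" for z
  proof -
    obtain m where m: "z \<in> cf_X ?D m" using z by (auto simp: A.cf_space_eq)
    show ?thesis
      using cX_space[OF quasi_psi_level(1)[where I = I and J = J and \<alpha> = \<alpha>, OF cuts I m]] by (auto simp: pS_def quasi_psi_def)
  qed
  show ?thesis
  proof (rule measurable_sigma_sets[OF sets_pB[OF I(1), of "\<lambda>_. 0"]])
    show "boxes I (\<lambda>_. 0) \<subseteq> Pow (pS I)" using Union_boxes[OF I(1), of "\<lambda>_. 0"] by auto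
    show "quasi_psi I J \<alpha> \<in> space (borel_of (cf_top ?D)) \<rightarrow> pS I" using psiS by (auto simp: sp)
    fix B assume "B \<in> boxes I (\<lambda>_. 0)"
    then obtain n f where B: "B = pbox I n f" by (auto simp: boxes_def)
    show "quasi_psi I J \<alpha> -` B \<inter> space (borel_of (cf_top ?D)) \<in> sets (borel_of (cf_top ?D))"
    proof (rule A.cyl_open_sets)
      fix z assume z: "z \<in> quasi_psi I J \<alpha> -` B \<inter> space (borel_of (cf_top ?D))"
      then have "z \<in> cf_space ?D" unfolding sp by blast
      then obtain m0 where m0: "z \<in> cf_X ?D m0" by (auto simp: A.cf_space_eq)
      define m where "m = max m0 n"
      have m: "z \<in> cf_X ?D m" "m \<ge> n" using m0 A.cf_X_mono[of m0 m] by (auto simp: m_def)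
      have ext: "quasi_psi I J \<alpha> y \<in> extensional I" for y by (auto simp: quasi_psi_def)
      let ?g = "\<lambda>i. cf_co ?D (Suc m) z + (\<Sum>j\<in>{1..Suc m} - J. \<alpha> i j - \<alpha> (Min I) j)"
      have inb: "quasi_psi I J \<alpha> y \<in> pbox I (Suc m) ?g"
        if y: "y \<in> cf_X ?D m" "cf_co ?D (Suc m) y = cf_co ?D (Suc m) z" for y
        using quasi_psi_level[where I = I and J = J and \<alpha> = \<alpha>, OF cuts I y(1)] ext y(2) by (auto simp: mem_box_iff)
      have sub: "pbox I (Suc m) ?g \<subseteq> B"
        unfolding B using z m inb[OF m(1) refl] by (intro box_sub_if_meet[of "quasi_psi I J \<alpha> z"]) (auto simp: B)
      have "cf_cyl ?D (Suc m) (cf_co ?D (Suc m) z) \<subseteq> quasi_psi I J \<alpha> -` B \<inter> space (borel_of (cf_top ?D))"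
      proof
        fix y assume "y \<in> cf_cyl ?D (Suc m) (cf_co ?D (Suc m) z)"
        then have y: "y \<in> cf_X ?D (Suc m)" "cf_co ?D (Suc m) y = cf_co ?D (Suc m) z"
          by (auto simp: A.cf_cyl_eq)
        then have "y \<in> cf_X ?D m"
          using A.cf_shift_down[OF m(1) y(1), of 0 m] A.cf_co_F[OF m(1)] by simp
        then show "y \<in> quasi_psi I J \<alpha> -` B \<inter> space (borel_of (cf_top ?D))"
          using inb[OF _ y(2)] sub A.cf_X_sub_space[of m] by (auto simp: sp)
      qed
      then show "\<exists>n. z \<in> cf_X ?D n \<and> cf_cyl ?D n (cf_co ?D n z) \<subseteq> quasi_psi I J \<alpha> -` B \<inter> space (borel_of (cf_top ?D))"
        using m(1) A.cf_X_mono[of m "Suc m"] by (intro exI[of _ "Suc m"]) auto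
    qed (simp add: sp)
  qed
qed

section \<open>The quasi-graph case\<close>

lemma cf_co_Suc_bounds:
  assumes "x \<in> cX p"
  shows "1 - 3 * chacon_h p \<le> 2 * co (Suc p) x" "2 * co (Suc p) x \<le> 3 * chacon_h p + 1"
proof -
  have "co p x \<in> chacon_F p" by (rule C.cf_co_F[OF assms])
  moreover have "inc p x \<in> chacon_C (Suc p)" using inc_C[OF assms, of p] by simp
  moreover have "co (Suc p) x = co p x + inc p x" by (simp add: inc_def)
  ultimately show "1 - 3 * chacon_h p \<le> 2 * co (Suc p) x" "2 * co (Suc p) x \<le> 3 * chacon_h p + 1"
    using chacon_h_ge_1[of p] by (auto simp: mem_chacon_F_iff mem_chacon_C_Suc_iff)
qed

section \<open>Offsets between coordinates\<close>

context ergodic_power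
begin

definition const_at :: "nat \<Rightarrow> (nat \<Rightarrow> cf_point) \<Rightarrow> bool" where
  "const_at k x \<longleftrightarrow> (\<forall>i\<in>I. \<forall>j\<in>I. inc k (x i) = inc k (x j))"

definition wide_at :: "nat \<Rightarrow> (nat \<Rightarrow> cf_point) \<Rightarrow> bool" where
  "wide_at k x \<longleftrightarrow> (\<exists>i\<in>I. \<exists>j\<in>I. inc k (x i) = - chacon_h k \<and> inc k (x j) = chacon_h k + 1)"

definition del :: "nat \<Rightarrow> (nat \<Rightarrow> cf_point) \<Rightarrow> nat \<Rightarrow> int" where
  "del k x i = co k (x i) - co k (x (Min I))"

text \<open>The condition starts strictly above n: controlling the increment at k uses that the
  point already lives at level k - 1 \<ge> n, where its next coordinate is confined to the middle of
  F_k.\<close>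

definition Gs :: "nat \<Rightarrow> (nat \<Rightarrow> cf_point) set" where
  "Gs n = {x \<in> pX I n. \<forall>k>n. const_at k x \<or> wide_at k x}"

lemma const_atD: "const_at k x \<Longrightarrow> i \<in> I \<Longrightarrow> j \<in> I \<Longrightarrow> inc k (x i) = inc k (x j)"
  unfolding const_at_def by blast

text \<open>If h + 1 does not occur, a nonconstant increment has entries - h and 0 and is of type a
  with S the zeros; if - h does not occur, it has entries 0 and h + 1 and is of type b with S the
  entries h + 1.\<close>

lemma const_or_wide:
  assumes x: "x \<in> pX I k" and nh: "\<And>S. S \<subseteq> I \<Longrightarrow> S \<noteq> {} \<Longrightarrow> S \<noteq> I \<Longrightarrow> \<not> hit S k x"
  shows "const_at k x \<or> wide_at k x"
proof (rule ccontr)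
  assume not: "\<not> (const_at k x \<or> wide_at k x)"
  have C: "inc k (x i) = - chacon_h k \<or> inc k (x i) = 0 \<or> inc k (x i) = chacon_h k + 1" if "i \<in> I" for i
    using inc_C[of "x i" k k] x that by (auto simp: pX_def mem_chacon_C_Suc_iff)
  show False
  proof (cases "\<exists>i\<in>I. inc k (x i) = chacon_h k + 1")
    case False
    let ?S = "{i \<in> I. inc k (x i) = 0}"
    have "hit ?S k x" unfolding hit_def is_a_def shift_a_def using C False by auto
    moreover have "?S \<noteq> {}"
    proof
      assume "?S = {}"
      then have "\<forall>i\<in>I. inc k (x i) = - chacon_h k" using C False by blast
      then show False using not by (simp add: const_at_def)
    qed
    moreover have "?S \<noteq> I"
    proof
      assume "?S = I"
      then have "\<forall>i\<in>I. inc k (x i) = 0" by blast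
      then show False using not by (simp add: const_at_def)
    qed
    ultimately show False using nh[of ?S] by auto
  next
    case True
    let ?S = "{i \<in> I. inc k (x i) = chacon_h k + 1}"
    have n: "inc k (x i) \<noteq> - chacon_h k" if "i \<in> I" for i
      using True not that unfolding wide_at_def by auto
    have "hit ?S k x" unfolding hit_def is_b_def shift_b_def using C n by auto
    moreover have "?S \<noteq> {}" using True by blast
    moreover have "?S \<noteq> I"
    proof
      assume "?S = I"
      then have "\<forall>i\<in>I. inc k (x i) = chacon_h k + 1" by blast
      then show False using not by (simp add: const_at_def)
    qed
    ultimately show False using nh[of ?S] by auto
  qed
qed

text \<open>For a wide increment the offsets are so far apart that, although the offsets \<open>del k\<close> are only
  known up to \<open>chacon_h k - 1\<close>, those of the next level determine the increment.\<close>
lemma del_down: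
  assumes xy: "x \<in> pX I p" "y \<in> pX I p" and k: "k = Suc p"
    and g: "const_at k x \<or> wide_at k x" "const_at k y \<or> wide_at k y"
    and eq: "\<forall>i\<in>I. del (Suc k) x i = del (Suc k) y i" and M: "Min I \<in> I"
  shows "\<forall>i\<in>I. del k x i = del k y i" and "const_at k x \<longleftrightarrow> const_at k y"
    and "\<not> const_at k x \<Longrightarrow> \<forall>i\<in>I. inc k (x i) = inc k (y i)"
proof -
  have hk: "chacon_h k = 6 * chacon_h p + 1" "chacon_h p \<ge> 1" using k chacon_h_ge_1[of p] by auto
  have h1: "chacon_h k \<ge> 1" by (rule chacon_h_ge_1)
  define a where "a i = inc k (x i)" for i
  define b where "b i = inc k (y i)" for i
  have bd: "1 - 3 * chacon_h p \<le> 2 * co k (x i)" "2 * co k (x i) \<le> 3 * chacon_h p + 1"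
    "1 - 3 * chacon_h p \<le> 2 * co k (y i)" "2 * co k (y i) \<le> 3 * chacon_h p + 1" if "i \<in> I" for i
    using cf_co_Suc_bounds[of "x i" p] cf_co_Suc_bounds[of "y i" p] xy that k by (auto simp: pX_def)
  have sx: "co (Suc k) (x i) = co k (x i) + a i" "co (Suc k) (y i) = co k (y i) + b i" for i
    by (simp_all add: a_def b_def inc_def)
  have e: "co k (x i) - co k (x j) + (a i - a j) = co k (y i) - co k (y j) + (b i - b j)"
    if "i \<in> I" "j \<in> I" for i j
    using eq[rule_format, OF that(1)] eq[rule_format, OF that(2)] sx by (simp add: del_def)
  \<comment> \<open>Coordinates at level k = p + 1 lie in an interval of length 3 h_p, so two
    offsets differ by at most 6 h_p = h_k - 1.\<close>
  have close: "\<bar>(a i - a j) - (b i - b j)\<bar> < chacon_h k" if "i \<in> I" "j \<in> I" for i j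
    using e[OF that] bd[OF that(1)] bd[OF that(2)] hk by linarith
  have C: "a i = - chacon_h k \<or> a i = 0 \<or> a i = chacon_h k + 1"
    "b i = - chacon_h k \<or> b i = 0 \<or> b i = chacon_h k + 1" if "i \<in> I" for i
    using inc_C[of "x i" p k] inc_C[of "y i" p k] xy k that
    by (auto simp: pX_def mem_chacon_C_Suc_iff a_def b_def)
  have cx: "const_at k x \<longleftrightarrow> (\<forall>i\<in>I. \<forall>j\<in>I. a i = a j)" "const_at k y \<longleftrightarrow> (\<forall>i\<in>I. \<forall>j\<in>I. b i = b j)"
    by (auto simp: const_at_def a_def b_def)
  have wx: "wide_at k x \<longleftrightarrow> (\<exists>i\<in>I. \<exists>j\<in>I. a i = - chacon_h k \<and> a j = chacon_h k + 1)"
     "wide_at k y \<longleftrightarrow> (\<exists>i\<in>I. \<exists>j\<in>I. b i = - chacon_h k \<and> b j = chacon_h k + 1)"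
    by (auto simp: wide_at_def a_def b_def)
  have main: "(const_at k x \<and> const_at k y) \<or> (\<not> const_at k x \<and> \<not> const_at k y \<and> (\<forall>i\<in>I. a i = b i))"
  proof (cases "const_at k x")
    case True
    have "\<not> wide_at k y"
    proof
      assume "wide_at k y"
      then obtain i j where ij: "i \<in> I" "j \<in> I" "b i = - chacon_h k" "b j = chacon_h k + 1" unfolding wx by blast
      have "a i = a j" using True ij unfolding cx by blast
      then show False using close[OF ij(1,2)] ij h1 by linarith
    qed
    then show ?thesis using True g by auto
  next
    case False
    then obtain i j where ij: "i \<in> I" "j \<in> I" "a i = - chacon_h k" "a j = chacon_h k + 1" using g(1) unfolding wx by blast
    \<comment> \<open>The difference of the entries of y is within less than h_k of - (2 h_k + 1),
      hence below - (h_k + 1); the only such difference of cut elements is - (2 h_k + 1)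
      itself.\<close>
    have b: "b i = - chacon_h k" "b j = chacon_h k + 1"
      using close[OF ij(1,2)] C(2)[OF ij(1)] C(2)[OF ij(2)] ij h1 by (elim disjE; linarith)+
    \<comment> \<open>As the entries at i already agree, those at l differ by less than h_k, the
      least distance of distinct cut elements.\<close>
    have "a l = b l" if l: "l \<in> I" for l
      using close[OF l ij(1)] C(1)[OF l] C(2)[OF l] ij b h1 by (elim disjE; linarith)
    moreover have "\<not> const_at k y"
    proof
      assume "const_at k y"
      then have "b i = b j" using ij(1,2) unfolding cx by blast
      then show False using b h1 by linarith
    qed
    ultimately show ?thesis using False by blast
  qed
  then show "const_at k x \<longleftrightarrow> const_at k y" by blast
  show "\<not> const_at k x \<Longrightarrow> \<forall>i\<in>I. inc k (x i) = inc k (y i)"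
    using main by (auto simp: a_def b_def)
  show "\<forall>i\<in>I. del k x i = del k y i"
  proof
    fix i assume i: "i \<in> I"
    have "a i - a (Min I) = b i - b (Min I)"
      using main
    proof (elim disjE conjE)
      assume "const_at k x" "const_at k y"
      then have "a i = a (Min I)" "b i = b (Min I)" using i M unfolding cx by blast+
      then show ?thesis by simp
    next
      assume "\<forall>i\<in>I. a i = b i"
      then show ?thesis using i M by simp
    qed
    then show "del k x i = del k y i" using e[OF i M] by (simp add: del_def)
  qed
qed

context
  assumes I: "I \<noteq> {}"
begin

lemma MinI: "Min I \<in> I" using I finI by simp

lemma del_down_le:
  assumes xy: "x \<in> Gs n" "y \<in> Gs n" and eq: "\<forall>i\<in>I. del M x i = del M y i" and m: "Suc n \<le> m" "m \<le> M"
  shows "\<forall>i\<in>I. del m x i = del m y i"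
  using \<open>m \<le> M\<close> m(1)
proof (induction m rule: inc_induct)
  case (step m)
  obtain p where p: "m = Suc p" "n \<le> p" using step by (cases m) auto
  have "x \<in> pX I p" "y \<in> pX I p" using xy pX_mono[OF p(2), of I] by (auto simp: Gs_def)
  moreover have "const_at m x \<or> wide_at m x" "const_at m y \<or> wide_at m y"
    using xy p by (auto simp: Gs_def)
  ultimately show ?case using step MinI by (intro del_down(1)[OF _ _ p(1)]) auto
qed (use eq in auto)

lemma ev_co_pT:
  assumes "x \<in> pS I"
  shows "\<forall>\<^sub>F k in sequentially. \<forall>i\<in>I. co k (pT I v x i) = co k (x i) + v i"
  using assms finI C.cf_T_ev by (intro eventually_ball_finite) (auto simp: pT_def pS_def)

lemma Gs_pS: "x \<in> Gs n \<Longrightarrow> x \<in> pS I"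
  by (auto simp: Gs_def pX_def)

text \<open>At a sufficiently late level the diagonal translation adds t to every coordinate and
  leaves the offsets alone; \<open>del_down_le\<close> carries this equality down to m.\<close>

lemma Gs_orbit:
  assumes x: "x \<in> Gs n" "pT I (\<lambda>_. t) x \<in> Gs n" and m: "Suc n \<le> m" and i: "i \<in> I"
  shows "del m (pT I (\<lambda>_. t) x) i = del m x i"
proof -
  obtain M where M: "M \<ge> m" "\<forall>i\<in>I. co M (pT I (\<lambda>_. t) x i) = co M (x i) + t"
    using eventually_happens[OF eventually_conj[OF ev_co_pT[OF Gs_pS[OF x(1)]] eventually_ge_at_top[of m]]]
    by auto
  have "\<forall>i\<in>I. del M (pT I (\<lambda>_. t) x) i = del M x i" using M(2) MinI by (simp add: del_def)
  then show ?thesis using del_down_le[OF x(2,1) _ m M(1)] i by blast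
qed

lemma Gs_sets: "Gs n \<in> sets L"
proof -
  have "Gs n = pX I n \<inter> (\<Inter>k\<in>{n<..}. {x \<in> pX I n. (\<lambda>c. (\<forall>i\<in>I. \<forall>j\<in>I. c i = c j) \<or>
      (\<exists>i\<in>I. \<exists>j\<in>I. c i = - chacon_h k \<and> c j = chacon_h k + 1)) (\<lambda>i\<in>I. inc k (x i))})"
    by (auto simp: Gs_def const_at_def wide_at_def)
  also have "\<dots> \<in> sets L"
    unfolding setsL using pX_sets[OF finI]
    by (intro sets.Int sets.countable_INT' image_subsetI inc_set_sets[OF finI]) auto
  finally show ?thesis .
qed

lemma Gs_pos:
  assumes nh: "\<And>S. S \<subseteq> I \<Longrightarrow> S \<noteq> {} \<Longrightarrow> S \<noteq> I \<Longrightarrow> AE x in L. \<forall>\<^sub>F n in sequentially. \<not> hit S n x"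
  shows "\<exists>n. emeasure L (Gs n) \<noteq> 0"
proof (rule ccontr)
  assume "\<not> ?thesis"
  then have "(\<Union>n. Gs n) \<in> null_sets L" using Gs_sets by (intro null_sets_UN) (auto intro!: null_setsI)
  then have null: "AE x in L. x \<notin> (\<Union>n. Gs n)" by (rule AE_not_in)
  have "finite (Pow I - {{}, I})" using finI by simp
  then have "AE x in L. \<forall>S\<in>Pow I - {{}, I}. \<forall>\<^sub>F n in sequentially. \<not> hit S n x"
    using nh by (subst AE_finite_all) auto
  then have "AE x in L. False"
    using null AE_space
  proof eventually_elim
    case (elim x)
    have "\<forall>\<^sub>F n in sequentially. \<forall>S\<in>Pow I - {{}, I}. \<not> hit S n x"
      using elim(1) finI by (intro eventually_ball_finite) auto
    then obtain n0 where n0: "\<And>n S. n \<ge> n0 \<Longrightarrow> S \<subseteq> I \<Longrightarrow> S \<noteq> {} \<Longrightarrow> S \<noteq> I \<Longrightarrow> \<not> hit S n x"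
      unfolding eventually_sequentially by blast
    have xS: "x \<in> pS I" using elim(3) by (simp add: spaceL)
    obtain n where n: "n \<ge> n0" "\<forall>i\<in>I. x i \<in> cX n" using pX_level[OF finI xS] by metis
    have xn: "x \<in> pX I n" using xS n by (auto simp: pX_def)
    have "const_at k x \<or> wide_at k x" if "k > n" for k
      using that n n0 xn pX_mono[of n k I] by (intro const_or_wide) auto
    then have "x \<in> Gs n" using xn by (auto simp: Gs_def)
    then show False using elim(2) by auto
  qed
  then show False using not_AE_False by simp
qed

text \<open>There are only countably many integer offset vectors, so one occurs with positive
  measure within \<open>Gs n\<close>; its orbit saturation is invariant and hence of full measure.
  The set itself need not be, which is why the statement passes to a translate.\<close>

lemma del_AE_const:
  assumes pos: "emeasure L (Gs n) \<noteq> 0" and m: "Suc n \<le> m"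
  shows "\<exists>\<delta>. AE y in L. \<exists>t. pT I (\<lambda>_. t) y \<in> Gs n \<and> (\<forall>i\<in>I. del m (pT I (\<lambda>_. t) y) i = \<delta> i)"
proof -
  define R where "R \<delta> = {x \<in> Gs n. \<forall>i\<in>I. del m x i = \<delta> i}" for \<delta> :: "nat \<Rightarrow> int"
  have R_sets: "R \<delta> \<in> sets L" for \<delta>
  proof -
    have "{x \<in> pX I n. \<forall>i\<in>I. del m x i = \<delta> i} \<in> sets (pB I)"
    proof (rule pX_open_sets[OF finI])
      fix x assume x: "x \<in> {x \<in> pX I n. \<forall>i\<in>I. del m x i = \<delta> i}"
      have "y \<in> {x \<in> pX I n. \<forall>i\<in>I. del m x i = \<delta> i}"
        if y: "y \<in> pX I m" "\<forall>i\<in>I. co m (y i) = co m (x i)" for y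
      proof -
        have "y \<in> pX I n" using pX_agree(1)[of x I n y m n] x y m by (auto simp: pX_def)
        then show ?thesis using x y(2) MinI by (auto simp: del_def)
      qed
      then show "\<exists>n'. x \<in> pX I n' \<and> (\<forall>y\<in>pX I n'. (\<forall>i\<in>I. co n' (y i) = co n' (x i)) \<longrightarrow>
          y \<in> {x \<in> pX I n. \<forall>i\<in>I. del m x i = \<delta> i})"
        using x pX_mono[of n m I] m by (intro exI[of _ m]) auto
    qed (auto simp: pX_def)
    moreover have "R \<delta> = Gs n \<inter> {x \<in> pX I n. \<forall>i\<in>I. del m x i = \<delta> i}" by (auto simp: R_def Gs_def)
    ultimately show ?thesis using Gs_sets setsL by auto
  qed
  have "\<exists>\<delta>. emeasure L (R \<delta>) \<noteq> 0"
  proof (rule ccontr)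
    assume "\<not> ?thesis"
    then have "(\<Union>\<delta>\<in>PiE I (\<lambda>_. UNIV). R \<delta>) \<in> null_sets L"
      using R_sets finI by (intro null_sets_UN') (auto intro!: null_setsI countable_PiE)
    moreover have "Gs n \<subseteq> (\<Union>\<delta>\<in>PiE I (\<lambda>_. UNIV). R \<delta>)"
    proof
      fix x assume "x \<in> Gs n"
      then show "x \<in> (\<Union>\<delta>\<in>PiE I (\<lambda>_. UNIV). R \<delta>)" by (intro UN_I[of "restrict (del m x) I"]) (auto simp: R_def)
    qed
    ultimately have "Gs n \<in> null_sets L" using Gs_sets null_sets_subset by blast
    then show False using pos by auto
  qed
  then obtain \<delta> where \<delta>: "emeasure L (R \<delta>) \<noteq> 0" by blast
  define H where "H = {y \<in> pS I. \<exists>t. pT I (\<lambda>_. t) y \<in> R \<delta>}"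
  have "H = (\<Union>t. pT I (\<lambda>_. t) -` R \<delta> \<inter> pS I)" by (auto simp: H_def)
  also have "\<dots> \<in> sets L" using pre_sets[OF R_sets] by (intro sets.countable_UN) auto
  finally have Hs: "H \<in> sets L" .
  have "pT I (\<lambda>_. 1) -` H \<inter> pS I = H"
  proof (intro equalityI subsetI)
    fix y assume "y \<in> pT I (\<lambda>_. 1) -` H \<inter> pS I"
    then obtain t where "y \<in> pS I" "pT I (\<lambda>_. t) (pT I (\<lambda>_. 1) y) \<in> R \<delta>" by (auto simp: H_def)
    then show "y \<in> H" by (auto simp: H_def pT_add)
  next
    fix y assume "y \<in> H"
    then obtain t where t: "y \<in> pS I" "pT I (\<lambda>_. t) y \<in> R \<delta>" by (auto simp: H_def)
    have "pT I (\<lambda>_. t - 1) (pT I (\<lambda>_. 1) y) = pT I (\<lambda>_. t) y" using t by (simp add: pT_add)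
    then show "y \<in> pT I (\<lambda>_. 1) -` H \<inter> pS I" using t pT_pS by (auto simp: H_def intro: exI[of _ "t - 1"])
  qed
  then have "emeasure L H = 0 \<or> emeasure L (pS I - H) = 0"
    using erg Hs by (auto simp: ergodic_measure_def chacon_pow_T_eq spaceL)
  moreover have "emeasure L H \<noteq> 0"
  proof
    assume "emeasure L H = 0"
    moreover have "R \<delta> \<subseteq> H"
      using pT_0 Gs_pS by (auto simp: H_def R_def intro!: exI[of _ 0])
    ultimately show False using \<delta> emeasure_mono[of "R \<delta>" H L] Hs by auto
  qed
  ultimately have "AE y in L. y \<in> H"
    using Hs by (intro AE_I[of _ _ "pS I - H"]) (auto simp: spaceL[symmetric])
  then have "AE y in L. \<exists>t. pT I (\<lambda>_. t) y \<in> Gs n \<and> (\<forall>i\<in>I. del m (pT I (\<lambda>_. t) y) i = \<delta> i)"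
    by eventually_elim (auto simp: H_def R_def)
  then show ?thesis by blast
qed

text \<open>The almost sure offsets of the countably many levels are realised simultaneously, and
  any point realising them serves as a model for almost all orbits.\<close>

lemma reference_point:
  assumes pos: "emeasure L (Gs n) \<noteq> 0"
  shows "\<exists>x0\<in>Gs n. AE y in L. \<exists>t. pT I (\<lambda>_. t) y \<in> Gs n \<and>
     (\<forall>m\<ge>Suc n. \<forall>i\<in>I. del m (pT I (\<lambda>_. t) y) i = del m x0 i)"
proof -
  have "\<forall>m. \<exists>\<delta>. Suc n \<le> m \<longrightarrow> (AE y in L. \<exists>t. pT I (\<lambda>_. t) y \<in> Gs n \<and> (\<forall>i\<in>I. del m (pT I (\<lambda>_. t) y) i = \<delta> i))"
    using del_AE_const[OF pos] by blast
  then have "\<exists>\<delta>. \<forall>m. Suc n \<le> m \<longrightarrow> (AE y in L. \<exists>t. pT I (\<lambda>_. t) y \<in> Gs n \<and> (\<forall>i\<in>I. del m (pT I (\<lambda>_. t) y) i = \<delta> m i))"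
    by (rule choice)
  then obtain \<delta> where \<delta>: "\<forall>m. Suc n \<le> m \<longrightarrow>
      (AE y in L. \<exists>t. pT I (\<lambda>_. t) y \<in> Gs n \<and> (\<forall>i\<in>I. del m (pT I (\<lambda>_. t) y) i = \<delta> m i))" ..
  have "AE y in L. \<forall>m. Suc n \<le> m \<longrightarrow> (\<exists>t. pT I (\<lambda>_. t) y \<in> Gs n \<and> (\<forall>i\<in>I. del m (pT I (\<lambda>_. t) y) i = \<delta> m i))"
    unfolding AE_all_countable using \<delta> by auto
  then have ae: "AE y in L. y \<in> pS I \<and> (\<exists>t. pT I (\<lambda>_. t) y \<in> Gs n \<and>
     (\<forall>m\<ge>Suc n. \<forall>i\<in>I. del m (pT I (\<lambda>_. t) y) i = \<delta> m i))"
    using AE_space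
  proof eventually_elim
    case (elim y)
    have yS: "y \<in> pS I" using elim(2) by (simp add: spaceL)
    obtain t where t: "pT I (\<lambda>_. t) y \<in> Gs n" using elim(1) by blast
    \<comment> \<open>Each level m comes with its own translate s, but by \<open>Gs_orbit\<close>
      all translates in \<open>Gs n\<close> have the same offsets, so one t serves all
      levels.\<close>
    have "del m (pT I (\<lambda>_. t) y) i = \<delta> m i" if m: "Suc n \<le> m" and i: "i \<in> I" for m i
    proof -
      obtain s where s: "pT I (\<lambda>_. s) y \<in> Gs n" "\<forall>i\<in>I. del m (pT I (\<lambda>_. s) y) i = \<delta> m i"
        using elim(1) m by blast
      have "pT I (\<lambda>_. s - t) (pT I (\<lambda>_. t) y) = pT I (\<lambda>_. s) y" using yS by (simp add: pT_add)
      then show ?thesis using Gs_orbit[of "pT I (\<lambda>_. t) y" n "s - t" m i] t s m i by simp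
    qed
    then show ?case using t yS by blast
  qed
  have "\<exists>y0. y0 \<in> pS I \<and> (\<exists>t. pT I (\<lambda>_. t) y0 \<in> Gs n \<and>
     (\<forall>m\<ge>Suc n. \<forall>i\<in>I. del m (pT I (\<lambda>_. t) y0) i = \<delta> m i))"
  proof (rule ccontr)
    assume not: "\<not> ?thesis"
    have "AE x in L. False" using ae
    proof eventually_elim
      case (elim y)
      then show ?case using not by blast
    qed
    then show False using not_AE_False by simp
  qed
  then obtain x0 where x0: "x0 \<in> Gs n" "\<And>m i. m \<ge> Suc n \<Longrightarrow> i \<in> I \<Longrightarrow> del m x0 i = \<delta> m i" by blast
  have "AE y in L. \<exists>t. pT I (\<lambda>_. t) y \<in> Gs n \<and>
     (\<forall>m\<ge>Suc n. \<forall>i\<in>I. del m (pT I (\<lambda>_. t) y) i = del m x0 i)"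
    using ae by eventually_elim (use x0 in auto)
  then show ?thesis using x0(1) by blast
qed

section \<open>The quasi-graph through a reference point\<close>

context
  fixes n x0
  assumes x0: "x0 \<in> Gs n"
    and ref: "AE y in L. \<exists>t. pT I (\<lambda>_. t) y \<in> Gs n \<and>
     (\<forall>m\<ge>Suc n. \<forall>i\<in>I. del m (pT I (\<lambda>_. t) y) i = del m x0 i)"
begin

definition "qJ = {k. k > Suc n \<and> const_at (k - 1) x0}"

text \<open>The value \<open>0\<close> at the first \<open>n + 1\<close> cuts loses nothing: the offsets at level \<open>n + 1\<close> are
  absorbed by the translation \<open>qk\<close>.\<close>
definition "q\<alpha> i k = (if k > Suc n \<and> k \<notin> qJ then inc (k - 1) (x0 i) else 0)"

lemma x0_pX: "x0 \<in> pX I n" using x0 by (simp add: Gs_def)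

lemma Suc_qJ: "k \<ge> Suc n \<Longrightarrow> Suc k \<in> qJ \<longleftrightarrow> const_at k x0"
  by (simp add: qJ_def)

lemma q\<alpha>_eq: "k \<ge> Suc n \<Longrightarrow> Suc k \<notin> qJ \<Longrightarrow> q\<alpha> i (Suc k) = inc k (x0 i)"
  by (simp add: q\<alpha>_def)

lemma q\<alpha>_C: "i \<in> I \<Longrightarrow> q\<alpha> i (Suc k) \<in> chacon_C (Suc k)"
  using inc_C[of "x0 i" n k] x0_pX by (auto simp: q\<alpha>_def pX_def mem_chacon_C_Suc_iff)

lemma cuts: "i \<in> I \<Longrightarrow> cut_sets (quasi_C qJ (q\<alpha> i))"
  by standard (use q\<alpha>_C in \<open>auto simp: quasi_C_def\<close>)

text \<open>From level N on y lies on the quasi-graph of x0: equal offsets at N, a free increment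
  common to all coordinates at indices in \<open>qJ\<close>, and the prescribed increments of x0 at
  the others.\<close>

definition "tame N y \<longleftrightarrow> N \<ge> Suc n \<and> y \<in> pX I N \<and> (\<forall>i\<in>I. del N y i = del N x0 i) \<and>
  (\<forall>k\<ge>N. \<forall>i\<in>I. inc k (y i) = (if Suc k \<in> qJ then inc k (y (Min I)) else q\<alpha> i (Suc k)))"

lemma tame_x0: "tame (Suc n) x0"
  unfolding tame_def
proof (intro conjI allI impI ballI)
  show "x0 \<in> pX I (Suc n)" using x0_pX pX_mono[of n "Suc n" I] by auto
  fix k i assume k: "k \<ge> Suc n" and i: "i \<in> I"
  show "inc k (x0 i) = (if Suc k \<in> qJ then inc k (x0 (Min I)) else q\<alpha> i (Suc k))"
    using Suc_qJ[OF k] q\<alpha>_eq[OF k] const_atD[OF _ i MinI, of k x0] by auto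
qed auto

lemma tame_Gs:
  assumes x: "x \<in> Gs n" and d: "\<And>m i. m \<ge> Suc n \<Longrightarrow> i \<in> I \<Longrightarrow> del m x i = del m x0 i"
  shows "tame (Suc n) x"
  unfolding tame_def
proof (intro conjI allI impI ballI)
  have xn: "x \<in> pX I n" using x by (simp add: Gs_def)
  then show "x \<in> pX I (Suc n)" using pX_mono[of n "Suc n" I] by auto
  show "del (Suc n) x i = del (Suc n) x0 i" if "i \<in> I" for i using d that by simp
  fix k i assume k: "k \<ge> Suc n" and i: "i \<in> I"
  obtain p where p: "k = Suc p" "n \<le> p" using k by (cases k) auto
  have pp: "x \<in> pX I p" "x0 \<in> pX I p" using xn x0_pX pX_mono[OF p(2), of I] by auto
  have gg: "const_at k x \<or> wide_at k x" "const_at k x0 \<or> wide_at k x0" using x x0 k by (auto simp: Gs_def)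
  have dd: "\<forall>i\<in>I. del (Suc k) x i = del (Suc k) x0 i" using d k by simp
  note dn = del_down[OF pp p(1) gg dd MinI]
  show "inc k (x i) = (if Suc k \<in> qJ then inc k (x (Min I)) else q\<alpha> i (Suc k))"
  proof (cases "Suc k \<in> qJ")
    case True
    then have "const_at k x" using dn(2) Suc_qJ[OF k] by simp
    then show ?thesis using True const_atD[OF _ i MinI] by simp
  next
    case False
    then show ?thesis using dn(2,3) Suc_qJ[OF k] q\<alpha>_eq[OF k] i by auto
  qed
qed simp

lemma tame_Suc: "tame N y \<Longrightarrow> tame (Suc N) y"
  unfolding tame_def
proof (elim conjE, intro conjI allI impI ballI)
  assume N: "N \<ge> Suc n" and y: "y \<in> pX I N" and d: "\<forall>i\<in>I. del N y i = del N x0 i"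
    and c: "\<forall>k\<ge>N. \<forall>i\<in>I. inc k (y i) = (if Suc k \<in> qJ then inc k (y (Min I)) else q\<alpha> i (Suc k))"
  show "y \<in> pX I (Suc N)" using y pX_mono[of N "Suc N" I] by auto
  show "Suc n \<le> Suc N" using N by simp
  show "inc k (y i) = (if Suc k \<in> qJ then inc k (y (Min I)) else q\<alpha> i (Suc k))" if "Suc N \<le> k" "i \<in> I" for k i
    using c that by simp
  fix i assume i: "i \<in> I"
  have s: "del (Suc N) z i = del N z i + (inc N (z i) - inc N (z (Min I)))" for z
    by (simp add: del_def inc_def)
  have "inc N (y i) - inc N (y (Min I)) = inc N (x0 i) - inc N (x0 (Min I))"
  proof (cases "Suc N \<in> qJ")
    case True
    then have "inc N (x0 i) = inc N (x0 (Min I))" using Suc_qJ[OF N] const_atD[OF _ i MinI] by simp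
    then show ?thesis using c i True by simp
  next
    case False
    then show ?thesis using c i MinI q\<alpha>_eq[OF N] by simp
  qed
  then show "del (Suc N) y i = del (Suc N) x0 i" using s d i by simp
qed

lemma tame_mono:
  assumes "tame N y" "N \<le> M" shows "tame M y"
  using assms(2) by (induction M rule: dec_induct) (auto intro: tame_Suc assms(1))

text \<open>Some translate of y is tame from level n + 1 on. Undoing the translation changes all
  late coordinates by the same t, so y itself is tame, only from a later level N depending on
  y.\<close>

lemma AE_tame: "AE y in L. y \<in> pS I \<and> (\<exists>N. tame N y)"
  using ref AE_space
proof eventually_elim
  case (elim y)
  have yS: "y \<in> pS I" using elim(2) by (simp add: spaceL)
  obtain t where t: "pT I (\<lambda>_. t) y \<in> Gs n"
    "\<And>m i. m \<ge> Suc n \<Longrightarrow> i \<in> I \<Longrightarrow> del m (pT I (\<lambda>_. t) y) i = del m x0 i" using elim(1) by blast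
  let ?x = "pT I (\<lambda>_. t) y"
  have tx: "tame (Suc n) ?x" by (rule tame_Gs[OF t])
  have "\<forall>\<^sub>F k in sequentially. \<forall>i\<in>I. y i \<in> cX k \<and> co k (y i) + 0 \<in> chacon_F k"
    by (rule ev_pX[OF finI yS])
  then have "\<forall>\<^sub>F k in sequentially. k \<ge> Suc n \<and> (\<forall>i\<in>I. y i \<in> cX k) \<and> (\<forall>i\<in>I. co k (?x i) = co k (y i) + t)"
    using ev_co_pT[OF yS, of "\<lambda>_. t"] eventually_ge_at_top[of "Suc n"] by eventually_elim auto
  then obtain N where N: "\<And>k. k \<ge> N \<Longrightarrow> k \<ge> Suc n \<and> (\<forall>i\<in>I. y i \<in> cX k) \<and> (\<forall>i\<in>I. co k (?x i) = co k (y i) + t)"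
    unfolding eventually_sequentially by blast
  have tN: "tame N ?x" using tame_mono[OF tx] N[of N] by simp
  have inc: "inc k (?x i) = inc k (y i)" if "k \<ge> N" "i \<in> I" for k i
    using N[of k] N[of "Suc k"] that by (simp add: inc_def)
  have "tame N y"
    unfolding tame_def
  proof (intro conjI allI impI ballI)
    show "y \<in> pX I N" using N[of N] yS by (auto simp: pX_def)
    show "del N y i = del N x0 i" if "i \<in> I" for i
      using tN N[of N] that MinI by (simp add: tame_def del_def)
    show "inc k (y i) = (if Suc k \<in> qJ then inc k (y (Min I)) else q\<alpha> i (Suc k))" if "N \<le> k" "i \<in> I" for k i
    proof -
      have "inc k (?x i) = (if Suc k \<in> qJ then inc k (?x (Min I)) else q\<alpha> i (Suc k))"
        using tN that unfolding tame_def by blast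
      then show ?thesis using inc[OF that] inc[OF that(1) MinI] by simp
    qed
  qed (use N[of N] in simp)
  then show ?case using yS by blast
qed

abbreviation "qD \<equiv> quasi_C qJ (q\<alpha> (Min I))"

interpretation D: cut_sets qD
  by (rule cuts[OF MinI])

text \<open>The offset changes telescope; indices in \<open>qJ\<close> contribute nothing because x0
  has constant increments there.\<close>

lemma sum_q\<alpha>:
  assumes "k \<ge> Suc n" "i \<in> I"
  shows "(\<Sum>j\<in>{1..k} - qJ. q\<alpha> i j - q\<alpha> (Min I) j) = del k x0 i - del (Suc n) x0 i"
  using assms(1)
proof (induction k rule: dec_induct)
  case base
  have "(\<Sum>j\<in>{1..Suc n} - qJ. q\<alpha> i j - q\<alpha> (Min I) j) = 0"
    by (rule sum.neutral) (auto simp: q\<alpha>_def)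
  then show ?case by simp
next
  case (step k)
  have s: "del (Suc k) x0 i = del k x0 i + (inc k (x0 i) - inc k (x0 (Min I)))"
    by (simp add: del_def inc_def)
  show ?case
  proof (cases "Suc k \<in> qJ")
    case True
    then have "inc k (x0 i) = inc k (x0 (Min I))" using Suc_qJ[OF step(1)] const_atD[OF _ assms(2) MinI] by simp
    moreover have "{1..Suc k} - qJ = {1..k} - qJ" using True by (auto simp: le_Suc_eq)
    ultimately show ?thesis using step s by simp
  next
    case False
    then have "{1..Suc k} - qJ = insert (Suc k) ({1..k} - qJ)" by auto
    then show ?thesis using step s q\<alpha>_eq[OF step(1) False] by simp
  qed
qed

definition "qk = del (Suc n) x0"

definition "qmap z = (\<lambda>i\<in>I. if i = Min I then quasi_psi I qJ q\<alpha> z i else chacon_T (qk i) (quasi_psi I qJ q\<alpha> z i))"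

lemma psi_pS:
  assumes "z \<in> cf_space qD"
  shows "quasi_psi I qJ q\<alpha> z \<in> pS I"
  using measurable_space[OF quasi_psi_measurable[of I qJ q\<alpha>]] cuts finI I assms
  by (auto simp: space_borel_of D.topspace_cf_top topspace_pow simp del: topspace_product_topology)

lemma qmap_pT: "z \<in> cf_space qD \<Longrightarrow> qmap z = pT I qk (quasi_psi I qJ q\<alpha> z)"
  using psi_pS[of z] C.cf_T_0 by (auto simp: qmap_def pT_def fun_eq_iff restrict_def qk_def del_def pS_def PiE_iff)

text \<open>A tame point is recovered from its first coordinate: the partial sum gives the offset at
  level k relative to level n + 1, and \<open>qk\<close> supplies the offset at n + 1.\<close>

lemma qmap_rep:
  assumes y: "tame N y" and z: "D.cf_rep z (y (Min I))"
  shows "qmap z = y"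
proof -
  let ?p = "quasi_psi I qJ q\<alpha> z"
  have yS: "y \<in> pS I" using y by (auto simp: tame_def pX_def)
  have zS: "z \<in> cf_space qD" using z by (simp add: D.cf_rep_def)
  then obtain m where m: "z \<in> cf_X qD m" by (auto simp: D.cf_space_eq)
  have "qmap z i = y i" if i: "i \<in> I" for i
  proof (rule C.cf_ev_eqI)
    show "qmap z i \<in> chacon_space" "y i \<in> chacon_space"
      using pT_pS[OF psi_pS[OF zS], of qk] qmap_pT[OF zS] yS i by (auto simp: pS_def PiE_iff)
    have ez: "\<forall>\<^sub>F k in sequentially. cf_co qD k z = co k (y (Min I))" using z by (simp add: D.cf_rep_def)
    show "\<forall>\<^sub>F k in sequentially. co k (qmap z i) = co k (y i)"
      using ez ev_co_pT[OF psi_pS[OF zS], of qk] eventually_ge_at_top[of "max N (Suc m)"]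
    proof eventually_elim
      case (elim k)
      have k: "k \<ge> N" "k \<ge> Suc m" using elim(3) by auto
      have tk: "tame k y" by (rule tame_mono[OF y k(1)])
      have kn: "k \<ge> Suc n" using tk by (simp add: tame_def)
      have "co k (qmap z i) = co k (?p i) + qk i" using elim(2) i qmap_pT[OF zS] by simp
      also have "co k (?p i) = cf_co qD k z + (\<Sum>j\<in>{1..k} - qJ. q\<alpha> i j - q\<alpha> (Min I) j)"
        by (rule quasi_psi_level(2)[where I = I and J = qJ and \<alpha> = q\<alpha>, OF cuts finI I m i k(2)])
      also have "\<dots> = co k (y (Min I)) + (del k x0 i - del (Suc n) x0 i)"
        using elim(1) sum_q\<alpha>[OF kn i] by simp
      finally have "co k (qmap z i) = co k (y (Min I)) + del k x0 i" by (simp add: qk_def)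
      also have "del k x0 i = del k y i" using tk i by (simp add: tame_def)
      finally show ?case by (simp add: del_def)
    qed
  qed
  then show ?thesis using pS_extensional[OF yS] by (intro extensionalityI[of _ I]) (auto simp: qmap_def)
qed

lemma tame_inc_D:
  assumes "tame N y" "k \<ge> N"
  shows "inc k (y (Min I)) \<in> qD (Suc k)"
proof (cases "Suc k \<in> qJ")
  case True
  have "y (Min I) \<in> cX N" using assms MinI by (auto simp: tame_def pX_def)
  then show ?thesis using inc_C[of "y (Min I)" N k] assms True by (simp add: quasi_C_def)
next
  case False
  have "inc k (y (Min I)) = (if Suc k \<in> qJ then inc k (y (Min I)) else q\<alpha> (Min I) (Suc k))"
    using assms MinI unfolding tame_def by blast
  then show ?thesis using False by (simp add: quasi_C_def)
qed

lemma tame_rep: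
  assumes "tame N y"
  shows "\<exists>z. D.cf_rep z (y (Min I))"
proof -
  have "y (Min I) \<in> cX N" using assms MinI by (auto simp: tame_def pX_def)
  then show ?thesis using D.cf_rep_X'[of "y (Min I)" N] tame_inc_D[OF assms] by blast
qed

text \<open>Default value of \<open>\<Theta>\<close> where the first coordinate does not come from
  the quasi-graph space. It has to be a point of that space, or \<open>\<Theta>\<close> would not
  map into it; on tame points, hence almost everywhere, the default is never taken.\<close>

definition "z0 = (SOME z. D.cf_rep z (x0 (Min I)))"

definition "\<Theta> y = (if \<exists>z. D.cf_rep z (y (Min I)) then SOME z. D.cf_rep z (y (Min I)) else z0)"

text \<open>The preimage under \<open>\<Theta>\<close> of a cylinder, apart from the default value,
  phrased by coordinates in X so that measurability and translation can be read off.\<close>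

definition "W m g = {y \<in> pS I. y (Min I) \<in> cX m \<and> co m (y (Min I)) = g \<and> (\<forall>k\<ge>m. inc k (y (Min I)) \<in> qD (Suc k))}"

lemma z0_space: "z0 \<in> cf_space qD"
proof -
  have "D.cf_rep z0 (x0 (Min I))" unfolding z0_def by (rule someI_ex[OF tame_rep[OF tame_x0]])
  then show ?thesis by (simp add: D.cf_rep_def)
qed

lemma \<Theta>_rep: "\<exists>z. D.cf_rep z (y (Min I)) \<Longrightarrow> D.cf_rep (\<Theta> y) (y (Min I))"
  using someI_ex[of "\<lambda>z. D.cf_rep z (y (Min I))"] by (simp add: \<Theta>_def)

lemma \<Theta>_space: "\<Theta> y \<in> cf_space qD"
  using \<Theta>_rep[of y] z0_space by (cases "\<exists>z. D.cf_rep z (y (Min I))") (auto simp: D.cf_rep_def \<Theta>_def)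

lemma W_rep: "y \<in> W m g \<Longrightarrow> \<exists>z. D.cf_rep z (y (Min I))"
  using D.cf_rep_X'[of "y (Min I)" m] by (auto simp: W_def)

lemma W_iff:
  assumes y: "y \<in> pS I" "\<exists>z. D.cf_rep z (y (Min I))"
  shows "\<Theta> y \<in> cf_cyl qD m g \<longleftrightarrow> y \<in> W m g"
proof
  assume "\<Theta> y \<in> cf_cyl qD m g"
  then have t: "\<Theta> y \<in> cf_X qD m" "cf_co qD m (\<Theta> y) = g" by (auto simp: D.cf_cyl_eq)
  note r = D.cf_rep_X[OF t(1) \<Theta>_rep[of y, OF y(2)]]
  have "inc k (y (Min I)) \<in> qD (Suc k)" if "k \<ge> m" for k
    using D.cf_co_D[OF t(1), of "Suc k"] r(2)[of k] r(2)[of "Suc k"] that by (simp add: inc_def)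
  then show "y \<in> W m g" using r(1) r(2)[of m] t(2) y(1) by (simp add: W_def)
next
  assume w: "y \<in> W m g"
  then obtain z where z: "z \<in> cf_X qD m" "D.cf_rep z (y (Min I))" "\<forall>k\<ge>m. cf_co qD k z = co k (y (Min I))"
    using D.cf_rep_X'[of "y (Min I)" m] by (auto simp: W_def)
  have "\<Theta> y = z" by (rule D.cf_rep_unique'[OF \<Theta>_rep[of y, OF y(2)] z(2)])
  then show "\<Theta> y \<in> cf_cyl qD m g" using z w by (auto simp: D.cf_cyl_eq W_def)
qed

lemma W_sets: "W m g \<in> sets L"
proof -
  have "{y \<in> pS I. y (Min I) \<in> cX m \<and> co m (y (Min I)) = g \<and> inc k (y (Min I)) \<in> qD (Suc k)} \<in> sets (pB I)"
    (is "?A \<in> _") if k: "k \<ge> m" for k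
  proof (rule pX_open_sets[OF finI])
    fix x assume x: "x \<in> ?A"
    have xS: "x \<in> pS I" using x by simp
    obtain l where l: "l \<ge> Suc k" "\<forall>i\<in>I. x i \<in> cX l" using pX_level[OF finI xS] by metis
    have "y \<in> ?A" if y: "y \<in> pX I l" "\<forall>i\<in>I. co l (y i) = co l (x i)" for y
    proof -
      have yl: "y (Min I) \<in> cX l" "co l (y (Min I)) = co l (x (Min I)) + 0" using y MinI by (auto simp: pX_def)
      have xm: "x (Min I) \<in> cX m" "co m (x (Min I)) + 0 \<in> chacon_F m" using x C.cf_co_F by auto
      have "y (Min I) \<in> cX j \<and> co j (y (Min I)) = co j (x (Min I))" if "m \<le> j" "j \<le> l" for j
        using C.cf_shift_down[OF xm(1) yl xm(2) that] by simp
      from this[of m] this[of k] this[of "Suc k"] show ?thesis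
        using x y(1) k l(1) by (auto simp: inc_def pX_def)
    qed
    then show "\<exists>n. x \<in> pX I n \<and> (\<forall>y\<in>pX I n. (\<forall>i\<in>I. co n (y i) = co n (x i)) \<longrightarrow> y \<in> ?A)"
      using l x by (intro exI[of _ l]) (auto simp: pX_def)
  qed auto
  moreover have "W m g = (\<Inter>k\<in>{m..}. {y \<in> pS I. y (Min I) \<in> cX m \<and> co m (y (Min I)) = g \<and> inc k (y (Min I)) \<in> qD (Suc k)})"
    by (auto simp: W_def)
  ultimately show ?thesis unfolding setsL by (auto intro!: sets.countable_INT')
qed

lemma \<Theta>_measurable: "\<Theta> \<in> measurable L (borel_of (cf_top qD))"
proof (rule measurable_sigma_sets[OF D.sets_cf_borel])
  show "D.cyls \<subseteq> Pow (cf_space qD)" using D.Union_cyls by auto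
  show "\<Theta> \<in> space L \<rightarrow> cf_space qD" using \<Theta>_space by auto
  fix B assume "B \<in> D.cyls"
  then obtain m g where B: "B = cf_cyl qD m g" by (auto simp: D.cyls_def)
  define E where "E = (\<Union>m. \<Union>g\<in>chacon_F m. W m g)"
  have Es: "E \<in> sets L" unfolding E_def using W_sets finite_chacon_F by auto
  have E: "E = {y \<in> pS I. \<exists>z. D.cf_rep z (y (Min I))}"
  proof (intro equalityI subsetI)
    fix y assume "y \<in> E"
    then show "y \<in> {y \<in> pS I. \<exists>z. D.cf_rep z (y (Min I))}" using W_rep by (auto simp: E_def W_def)
  next
    fix y assume y: "y \<in> {y \<in> pS I. \<exists>z. D.cf_rep z (y (Min I))}"
    obtain m where m: "\<Theta> y \<in> cf_X qD m" using \<Theta>_space[of y] by (auto simp: D.cf_space_eq)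
    then have "y \<in> W m (cf_co qD m (\<Theta> y))" using W_iff[of y m "cf_co qD m (\<Theta> y)"] y by (simp add: D.cf_cyl_eq)
    then show "y \<in> E" using D.cf_co_F[OF m] by (auto simp: E_def)
  qed
  have z0E: "\<Theta> y = z0" if "y \<in> pS I - E" for y using that by (simp add: E \<Theta>_def)
  \<comment> \<open>Outside E the map is constantly \<open>z0\<close>, so this part is either
    contained in the preimage or disjoint from it.\<close>
  have "\<Theta> -` B \<inter> space L = W m g \<union> (if z0 \<in> B then pS I - E else {})"
  proof (intro equalityI subsetI)
    fix y assume y: "y \<in> \<Theta> -` B \<inter> space L"
    then have yS: "y \<in> pS I" by (simp add: spaceL)
    show "y \<in> W m g \<union> (if z0 \<in> B then pS I - E else {})"
    proof (cases "y \<in> E")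
      case True
      then show ?thesis using W_iff[OF yS] y by (auto simp: E B)
    next
      case False
      then show ?thesis using y z0E[of y] yS by auto
    qed
  next
    fix y assume y: "y \<in> W m g \<union> (if z0 \<in> B then pS I - E else {})"
    show "y \<in> \<Theta> -` B \<inter> space L"
    proof (cases "y \<in> W m g")
      case True
      then have "y \<in> pS I" by (simp add: W_def)
      then show ?thesis using True W_iff[of y m g] W_rep[OF True] by (simp add: B spaceL)
    next
      case False
      then have "z0 \<in> B" "y \<in> pS I - E" using y by (auto split: if_splits)
      then show ?thesis using z0E[of y] by (simp add: spaceL)
    qed
  qed
  also have "\<dots> \<in> sets L" using W_sets Es sets.compl_sets[OF Es] by (auto simp: spaceL)
  finally show "\<Theta> -` B \<inter> space L \<in> sets L" .
qed

text \<open>The measure on the quasi-graph space is not constructed: up to a constant it is the image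
  of \<open>L\<close>, which is why the description in \<open>cf_measure\<close> is not vacuous.\<close>
definition "qM = distr L (borel_of (cf_top qD)) \<Theta>"

lemma qM_cyl: "g \<in> chacon_F m \<Longrightarrow> emeasure qM (cf_cyl qD m g) = emeasure L (W m g)"
proof -
  assume g: "g \<in> chacon_F m"
  have "emeasure qM (cf_cyl qD m g) = emeasure L (\<Theta> -` cf_cyl qD m g \<inter> space L)"
    unfolding qM_def using \<Theta>_measurable D.cf_cyl_sets[OF g] by (rule emeasure_distr)
  also have "\<dots> = emeasure L (W m g)"
  proof (rule emeasure_eq_AE)
    show "AE y in L. y \<in> \<Theta> -` cf_cyl qD m g \<inter> space L \<longleftrightarrow> y \<in> W m g"
      using AE_tame
    proof eventually_elim
      case (elim y)
      then show ?case using W_iff[of y m g] tame_rep by (auto simp: spaceL)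
    qed
    show "\<Theta> -` cf_cyl qD m g \<inter> space L \<in> sets L"
      using \<Theta>_measurable D.cf_cyl_sets[OF g] by (rule measurable_sets)
  qed (rule W_sets)
  finally show ?thesis .
qed

lemma W_shift:
  assumes g: "g \<in> chacon_F m" "g + 1 \<in> chacon_F m"
  shows "emeasure L (W m g) = emeasure L (W m (g + 1))"
proof -
  have "pT I (\<lambda>_. 1) -` W m (g + 1) \<inter> pS I = W m g"
  proof -
    have *: "pT I (\<lambda>_. t) y \<in> W m (g' + t)" if y: "y \<in> W m g'" and F: "g' + t \<in> chacon_F m" for y t g'
    proof -
      have ym: "y (Min I) \<in> cX m" "co m (y (Min I)) + t \<in> chacon_F m" using y F by (auto simp: W_def)
      have e: "pT I (\<lambda>_. t) y (Min I) = chacon_T t (y (Min I))" using MinI by (simp add: pT_def)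
      note T = C.cf_T_co[OF ym]
      have "inc k (chacon_T t (y (Min I))) = inc k (y (Min I))" if "k \<ge> m" for k
        using T(2)[of k] T(2)[of "Suc k"] that by (simp add: inc_def)
      then show ?thesis using y pT_pS[of y I] T(1) T(2)[of m] by (auto simp: W_def e)
    qed
    show ?thesis
    proof (intro equalityI subsetI)
      fix y assume y: "y \<in> pT I (\<lambda>_. 1) -` W m (g + 1) \<inter> pS I"
      then have "pT I (\<lambda>_. - 1) (pT I (\<lambda>_. 1) y) \<in> W m (g + 1 + - 1)"
        using g by (intro *[where y = "pT I (\<lambda>_. 1) y" and g' = "g + 1" and t = "- 1"]) auto
      moreover have "pT I (\<lambda>_. - 1) (pT I (\<lambda>_. 1) y) = y" using pT_inv(1)[of y I "\<lambda>_. 1"] y by blast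
      ultimately show "y \<in> W m g" by simp
    qed (use *[where g' = g and t = 1] g in \<open>auto simp: W_def\<close>)
  qed
  then show ?thesis using sclD[OF scl_1 W_sets[of m "g + 1"]] by simp
qed

text \<open>\<open>W\<close> restricts a single coordinate, so finiteness on boxes does not bound it
  directly. For tame points the other coordinates follow from the first through the offsets of x0,
  and \<open>W\<close> at the coordinate of x0 is almost everywhere inside one box.\<close>

lemma W_fin: "\<exists>m g. g \<in> chacon_F m \<and> emeasure L (W m g) \<noteq> \<infinity>"
proof -
  let ?N = "Suc n"
  let ?f = "\<lambda>i. co ?N (x0 i)"
  have xN: "x0 i \<in> cX ?N" if "i \<in> I" for i using tame_x0 that by (auto simp: tame_def pX_def)
  have fF: "\<forall>i\<in>I. ?f i \<in> chacon_F ?N" using C.cf_co_F xN by blast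
  have sub: "y \<in> pbox I ?N ?f" if w: "y \<in> W ?N (?f (Min I))" and tm: "tame N' y" for y N'
  proof -
    have yS: "y \<in> pS I" and y0: "y (Min I) \<in> cX ?N" "co ?N (y (Min I)) = ?f (Min I)"
      and yD: "\<And>k. k \<ge> ?N \<Longrightarrow> inc k (y (Min I)) \<in> qD (Suc k)" using w by (auto simp: W_def)
    have "y i \<in> cX ?N \<and> co ?N (y i) = ?f i" if i: "i \<in> I" for i
    proof -
      \<comment> \<open>The expected coordinates of y i. At indices in \<open>qJ\<close> their
        increments are those of the first coordinate, at the others those of x0 i, so they are
        admissible from level n + 1 on.\<close>
      define u where "u k = co k (y (Min I)) + del k x0 i" for k
      have "\<exists>x\<in>cX ?N. \<forall>k\<ge>?N. co k x = u k"
      proof (rule C.cf_X_exists)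
        show "u ?N \<in> chacon_F ?N" using y0 fF i by (simp add: u_def del_def)
        fix k assume k: "k > ?N"
        then obtain l where l: "k = Suc l" "l \<ge> ?N" by (cases k) auto
        have e: "u k - u (k - 1) = inc l (y (Min I)) + (inc l (x0 i) - inc l (x0 (Min I)))"
          by (simp add: u_def del_def inc_def l)
        show "u k - u (k - 1) \<in> chacon_C k"
        proof (cases "Suc l \<in> qJ")
          case True
          then have "inc l (x0 i) = inc l (x0 (Min I))" using Suc_qJ[OF l(2)] const_atD[OF _ i MinI] by simp
          then show ?thesis using e inc_C[OF y0(1) l(2)] l(1) by simp
        next
          case False
          then have "inc l (y (Min I)) = inc l (x0 (Min I))"
            using yD[OF l(2)] q\<alpha>_eq[OF l(2) False] by (simp add: quasi_C_def)
          then show ?thesis using e inc_C[OF xN[OF i] l(2)] l(1) by simp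
        qed
      qed
      then obtain x where x: "x \<in> cX ?N" "\<And>k. k \<ge> ?N \<Longrightarrow> co k x = u k" by blast
      have "y i = x"
      proof (rule C.cf_ev_eqI)
        show "y i \<in> chacon_space" "x \<in> chacon_space" using yS i cX_space[OF x(1)] by (auto simp: pS_def)
        show "\<forall>\<^sub>F k in sequentially. co k (y i) = co k x"
          using eventually_ge_at_top[of "max N' ?N"]
        proof eventually_elim
          case (elim k)
          then have "tame k y" by (intro tame_mono[OF tm]) auto
          then have "del k y i = del k x0 i" using i by (simp add: tame_def)
          then show ?case using x(2)[of k] elim by (simp add: u_def del_def)
        qed
      qed
      then show ?thesis using x(1) x(2)[of ?N] y0(2) by (simp add: u_def del_def)
    qed
    then show ?thesis using pS_extensional[OF yS] by (simp add: mem_box_iff)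
  qed
  have bs: "pbox I ?N ?f \<in> sets L" using box_sets[OF finI fF] setsL by simp
  have "emeasure L (W ?N (?f (Min I))) \<le> emeasure L (pbox I ?N ?f)"
  proof (rule emeasure_mono_AE[OF _ bs])
    show "AE y in L. y \<in> W ?N (?f (Min I)) \<longrightarrow> y \<in> pbox I ?N ?f"
      using AE_tame by eventually_elim (use sub in blast)
  qed
  then have "emeasure L (W ?N (?f (Min I))) \<noteq> \<infinity>" using finL[OF fF] by (auto simp: top_unique)
  then show ?thesis using fF MinI by blast
qed

text \<open>The measure on the quasi-graph space is 1 / c times the image of L under
  \<open>\<Theta>\<close>; pushing it forward by \<open>qmap\<close> returns L / c because
  \<open>qmap (\<Theta> y) = y\<close> for almost every y.\<close>

lemma quasi_graph_eq: "\<exists>c::real>0. quasi_graph I qJ q\<alpha> qk = scale_measure (ennreal (1 / c)) L"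
proof -
  obtain m g where mg: "g \<in> chacon_F m" "emeasure L (W m g) \<noteq> \<infinity>" using W_fin by blast
  have "\<exists>c::real>0. cf_measure qD = scale_measure (ennreal (1 / c)) qM"
  proof (rule D.cf_measure_eq)
    show "sets qM = sets (borel_of (cf_top qD))" by (simp add: qM_def)
    show "qD (Suc k) \<noteq> {}" for k by (simp add: quasi_C_def chacon_C_def)
    show "emeasure qM (cf_cyl qD m f) = emeasure qM (cf_cyl qD m (f + 1))"
      if "f \<in> chacon_F m" "f + 1 \<in> chacon_F m" for m f
      using W_shift[OF that] qM_cyl that by simp
    show "emeasure qM (cf_cyl qD m g) \<noteq> \<infinity>" using mg qM_cyl by simp
    have "emeasure qM (space qM) = emeasure L (\<Theta> -` space (borel_of (cf_top qD)) \<inter> space L)"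
      unfolding qM_def space_distr using \<Theta>_measurable by (rule emeasure_distr) simp
    also have "\<Theta> -` space (borel_of (cf_top qD)) \<inter> space L = space L"
      using \<Theta>_space by (auto simp: space_borel_of D.topspace_cf_top)
    finally show "emeasure qM (space qM) \<noteq> 0" using nonzero by simp
  qed (rule mg)
  then obtain c :: real where c: "c > 0" "cf_measure qD = scale_measure (ennreal (1 / c)) qM" by blast
  have psi: "quasi_psi I qJ q\<alpha> \<in> measurable (borel_of (cf_top qD)) (pB I)"
    by (rule quasi_psi_measurable[where I = I and J = qJ and \<alpha> = q\<alpha>, OF cuts finI I])
  let ?S = "\<lambda>x. \<lambda>i\<in>I. if i = Min I then x i else chacon_T (qk i) (x i)"
  have S: "?S \<in> measurable (pB I) (pB I)"
  proof -
    have "?S x = pT I qk x" if "x \<in> space (pB I)" for x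
      using that C.cf_T_0 by (auto simp: space_pB pT_def fun_eq_iff restrict_def qk_def del_def pS_def PiE_iff)
    then show ?thesis using pT_measurable[OF finI, of qk] by (subst measurable_cong) auto
  qed
  have psi': "quasi_psi I qJ q\<alpha> \<in> measurable (cf_measure qD) (pB I)"
    using psi measurable_cong_sets[of "cf_measure qD" "borel_of (cf_top qD)" "pB I" "pB I"] c(2) by (simp add: qM_def)
  have qm: "qmap \<in> measurable (borel_of (cf_top qD)) (pB I)"
    using measurable_comp[OF psi S] by (simp add: qmap_def[abs_def] o_def)
  have "quasi_graph I qJ q\<alpha> qk = scale_measure (ennreal (1 / c)) L"
  proof (rule measure_eqI)
    show "sets (quasi_graph I qJ q\<alpha> qk) = sets (scale_measure (ennreal (1 / c)) L)"
      by (simp add: quasi_graph_def setsL)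
    fix A assume "A \<in> sets (quasi_graph I qJ q\<alpha> qk)"
    then have A: "A \<in> sets (pB I)" by (simp add: quasi_graph_def)
    have SA: "?S -` A \<inter> space (pB I) \<in> sets (pB I)" using S A by (rule measurable_sets)
    have qA: "qmap -` A \<inter> cf_space qD \<in> sets (borel_of (cf_top qD))"
      using measurable_sets[OF qm A] by (simp add: space_borel_of D.topspace_cf_top)
    have sp: "space (cf_measure qD) = cf_space qD"
      unfolding c(2) by (simp add: space_scale_measure qM_def space_borel_of D.topspace_cf_top)
    have "emeasure (quasi_graph I qJ q\<alpha> qk) A =
        emeasure (cf_measure qD) (quasi_psi I qJ q\<alpha> -` (?S -` A \<inter> space (pB I)) \<inter> space (cf_measure qD))"
      unfolding quasi_graph_def using S A SA psi' by (simp add: emeasure_distr)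
    also have "quasi_psi I qJ q\<alpha> -` (?S -` A \<inter> space (pB I)) \<inter> space (cf_measure qD) = qmap -` A \<inter> cf_space qD"
      using measurable_space[OF psi'] by (auto simp: qmap_def sp)
    also have "emeasure (cf_measure qD) (qmap -` A \<inter> cf_space qD) =
        ennreal (1 / c) * emeasure L (\<Theta> -` (qmap -` A \<inter> cf_space qD) \<inter> space L)"
      unfolding c(2) qM_def using \<Theta>_measurable qA by (simp add: emeasure_distr)
    also have "emeasure L (\<Theta> -` (qmap -` A \<inter> cf_space qD) \<inter> space L) = emeasure L A"
    proof (rule emeasure_eq_AE)
      show "AE y in L. y \<in> \<Theta> -` (qmap -` A \<inter> cf_space qD) \<inter> space L \<longleftrightarrow> y \<in> A"
        using AE_tame
      proof eventually_elim
        case (elim y)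
        then obtain N where N: "tame N y" by blast
        have "qmap (\<Theta> y) = y" using qmap_rep[OF N \<Theta>_rep[of y, OF tame_rep[OF N]]] .
        then show ?case using elim \<Theta>_space by (auto simp: spaceL)
      qed
      show "\<Theta> -` (qmap -` A \<inter> cf_space qD) \<inter> space L \<in> sets L" using \<Theta>_measurable qA by (rule measurable_sets)
      show "A \<in> sets L" using A setsL by simp
    qed
    finally show "emeasure (quasi_graph I qJ q\<alpha> qk) A = emeasure (scale_measure (ennreal (1 / c)) L) A"
      by simp
  qed
  then show ?thesis using c(1) by blast
qed

lemma quasi_graph_measure_L:
  "\<exists>\<nu> (c::real). c > 0 \<and> L = scale_measure (ennreal c) \<nu> \<and> \<nu> = scale_measure (ennreal (1 / c)) L \<and> quasi_graph_measure I \<nu>"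
proof -
  obtain c :: real where c: "c > 0" "quasi_graph I qJ q\<alpha> qk = scale_measure (ennreal (1 / c)) L"
    using quasi_graph_eq by blast
  have "quasi_graph_measure I (quasi_graph I qJ q\<alpha> qk)"
    unfolding quasi_graph_measure_def
  proof (intro exI conjI ballI)
    show "qJ \<subseteq> {1..}" by (auto simp: qJ_def)
    fix i k assume "i \<in> I" "k \<in> {1..} - qJ"
    then show "q\<alpha> i k \<in> chacon_C k" using q\<alpha>_C[of i "k - 1"] by (cases k) auto
  qed simp
  moreover have "L = scale_measure (ennreal c) (scale_measure (ennreal (1 / c)) L)"
  proof (rule measure_eqI)
    fix A
    have "ennreal c * ennreal (1 / c) = 1" using c(1) by (simp add: ennreal_mult'[symmetric])
    then show "emeasure L A = emeasure (scale_measure (ennreal c) (scale_measure (ennreal (1 / c)) L)) A"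
      by (simp add: mult.assoc[symmetric])
  qed simp
  ultimately show ?thesis using c by metis
qed

end

end

end

section \<open>Assembling the blocks\<close>

context power_measure
begin

text \<open>The sets \<open>pX I n\<close> form an increasing open cover, so a compact set lies in
  one of them, a finite union of boxes.\<close>

lemma radon: "radon_measure_on (chacon_pow_top I) L"
  unfolding radon_measure_on_def
proof (intro conjI allI impI)
  show "sets L = sets (pB I)" by (rule setsL)
  fix K assume K: "compactin (chacon_pow_top I) K"
  have op: "openin (chacon_pow_top I) (pX I n)" for n
    unfolding pX_eq using openin_box[OF finI] by (intro openin_Union ballI) (auto simp: PiE_iff)
  have "K \<subseteq> \<Union>(range (pX I))"
    using compactin_subset_topspace[OF K] Union_pX[OF finI] topspace_pow[of I] by auto
  then obtain F where F: "finite F" "F \<subseteq> range (pX I)" "K \<subseteq> \<Union>F"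
    using K op unfolding compactin_def by (metis (no_types, lifting) imageE)
  then obtain N where N: "finite N" "F = pX I ` N" by (meson finite_subset_image)
  then obtain m where m: "\<forall>n\<in>N. n \<le> m" using finite_nat_set_iff_bounded_le by blast
  have "K \<subseteq> pX I m" using F(3) N(2) m pX_mono[of _ m I] by blast
  then have "emeasure L K \<le> emeasure L (pX I m)" by (rule emeasure_mono) (rule pX_L)
  then show "emeasure L K < \<infinity>" using fin_pX[of m] by (auto simp: less_top top_unique)
qed

end

lemma power_measure_scale:
  assumes "power_measure I L"
  shows "power_measure I (scale_measure (ennreal c) L)"
proof -
  interpret power_measure I L by fact
  show ?thesis
    by standard (use finI setsL finL in \<open>auto simp: ennreal_mult_eq_top_iff\<close>)
qed

definition good_block :: "nat set \<Rightarrow> (nat \<Rightarrow> cf_point) measure \<Rightarrow> bool" where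
  "good_block B M \<longleftrightarrow> power_measure B M \<and> (\<exists>\<nu> (c::real). c > 0 \<and> M = scale_measure (ennreal c) \<nu> \<and>
       (card B = 1 \<longrightarrow> \<nu> = chacon_mu_single B) \<and>
       (card B > 1 \<longrightarrow> quasi_graph_radon_measure B \<nu> \<and> invariant_measure (chacon_pow_T B) \<nu>))"

text \<open>With one coordinate, invariance and finiteness on a single cylinder already determine
  the measure up to a constant, by \<open>cf_measure_eq\<close>.\<close>

lemma (in ergodic_power) good_block_single:
  assumes I: "I = {i}"
  shows "good_block I L"
proof -
  define M where "M = distr L (borel_of chacon_top) (\<lambda>y. y i)"
  have sp: "space (borel_of chacon_top) = chacon_space" by (simp add: space_borel_of C.topspace_cf_top)
  have pre: "(\<lambda>y. y i) -` cf_cyl chacon_C m g \<inter> pS I = pbox I m (\<lambda>_. g)" for m g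
    using I box_sub[of I m "\<lambda>_. g"] by (auto simp: mem_box_iff C.cf_cyl_eq pS_extensional)
  have meas: "(\<lambda>y. y i) \<in> measurable L (borel_of chacon_top)"
  proof (rule measurable_sigma_sets[OF C.sets_cf_borel])
    show "C.cyls \<subseteq> Pow chacon_space" using C.Union_cyls by auto
    show "(\<lambda>y. y i) \<in> space L \<rightarrow> chacon_space" using I by (auto simp: spaceL pS_def)
    fix B assume "B \<in> C.cyls"
    then obtain m g where B: "B = cf_cyl chacon_C m g" "g \<in> chacon_F m" by (auto simp: C.cyls_def)
    then show "(\<lambda>y. y i) -` B \<inter> space L \<in> sets L"
      using box_sets[OF finI, of "\<lambda>_. g" m] setsL pre by (simp add: spaceL)
  qed
  have cyl: "emeasure M (cf_cyl chacon_C m g) = emeasure L (pbox I m (\<lambda>_. g))" if "g \<in> chacon_F m" for m g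
    unfolding M_def using meas C.cf_cyl_sets[OF that] pre by (simp add: emeasure_distr spaceL)
  have z: "(0::int) \<in> chacon_F 0" by (simp add: mem_chacon_F_iff)
  have "\<exists>c::real>0. chacon_mu = scale_measure (ennreal (1 / c)) M"
  proof (rule C.cf_measure_eq)
    show "sets M = sets (borel_of chacon_top)" by (simp add: M_def)
    show "chacon_C (Suc k) \<noteq> {}" for k by (simp add: chacon_C_def)
    show "emeasure M (cf_cyl chacon_C m f) = emeasure M (cf_cyl chacon_C m (f + 1))"
      if "f \<in> chacon_F m" "f + 1 \<in> chacon_F m" for m f
      using box_inv[of "\<lambda>_. f" m 1] cyl that by simp
    show "0 \<in> chacon_F 0" by (rule z)
    show "emeasure M (cf_cyl chacon_C 0 0) \<noteq> \<infinity>" using cyl[OF z] finL[of "\<lambda>_. 0" 0] z by simp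
    have "emeasure M (space M) = emeasure L (space L)"
      unfolding M_def space_distr using meas measurable_space[OF meas]
      by (subst emeasure_distr) (auto intro!: arg_cong[where f = "emeasure L"])
    then show "emeasure M (space M) \<noteq> 0" using nonzero by simp
  qed
  then obtain c :: real where c: "c > 0" "chacon_mu = scale_measure (ennreal (1 / c)) M" by blast
  let ?f = "\<lambda>x. \<lambda>j\<in>I. x"
  have fm: "?f \<in> measurable (borel_of chacon_top) (pB I)"
  proof (rule measurable_sigma_sets[OF sets_pB[OF finI, of "\<lambda>_. 0"]])
    show "boxes I (\<lambda>_. 0) \<subseteq> Pow (pS I)" using Union_boxes[OF finI, of "\<lambda>_. 0"] by auto
    show "?f \<in> space (borel_of chacon_top) \<rightarrow> pS I" by (auto simp: sp pS_def)
    fix B assume "B \<in> boxes I (\<lambda>_. 0)"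
    then obtain m f where B: "B = pbox I m f" "\<forall>i\<in>I. f i \<in> chacon_F m" by (auto simp: boxes_def)
    have "?f -` B \<inter> space (borel_of chacon_top) = cf_cyl chacon_C m (f i)"
      using I cX_space[of _ m] by (auto simp: B mem_box_iff C.cf_cyl_eq sp)
    then show "?f -` B \<inter> space (borel_of chacon_top) \<in> sets (borel_of chacon_top)"
      using B I C.cf_cyl_sets by simp
  qed
  have fmu: "?f \<in> measurable chacon_mu (pB I)"
    using fm measurable_cong_sets[of chacon_mu "borel_of chacon_top" "pB I" "pB I"] c(2) by (simp add: M_def)
  have "L = scale_measure (ennreal c) (chacon_mu_single I)"
  proof (rule measure_eqI)
    show "sets L = sets (scale_measure (ennreal c) (chacon_mu_single I))"
      by (simp add: setsL chacon_mu_single_def)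
    fix A assume "A \<in> sets L"
    then have A: "A \<in> sets (pB I)" using setsL by simp
    have fA: "?f -` A \<inter> chacon_space \<in> sets (borel_of chacon_top)"
      using measurable_sets[OF fm A] by (simp add: sp)
    have spm: "space chacon_mu = chacon_space" unfolding c(2) by (simp add: space_scale_measure M_def sp)
    have "emeasure (chacon_mu_single I) A = emeasure chacon_mu (?f -` A \<inter> chacon_space)"
      unfolding chacon_mu_single_def using fmu A by (simp add: emeasure_distr spm)
    also have "\<dots> = ennreal (1 / c) * emeasure L ((\<lambda>y. y i) -` (?f -` A \<inter> chacon_space) \<inter> space L)"
      unfolding c(2) M_def using meas fA by (simp add: emeasure_distr)
    also have "(\<lambda>y. y i) -` (?f -` A \<inter> chacon_space) \<inter> space L = A"
    proof -
      have *: "(\<lambda>j\<in>I. y i) = y" "y i \<in> chacon_space" if "y \<in> pS I" for y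
        using I pS_extensional[OF that] that by (auto intro!: extensionalityI[of _ I] simp: pS_def)
      have "y \<in> (\<lambda>y. y i) -` (?f -` A \<inter> chacon_space) \<inter> space L \<longleftrightarrow> y \<in> A" for y
      proof (cases "y \<in> pS I")
        case True
        then show ?thesis by (simp only: vimage_eq Int_iff spaceL *[OF True] simp_thms)
      next
        case False
        then show ?thesis using sub_space[OF \<open>A \<in> sets L\<close>] unfolding spaceL by blast
      qed
      then show ?thesis by blast
    qed
    finally have "emeasure (scale_measure (ennreal c) (chacon_mu_single I)) A
        = (ennreal c * ennreal (1 / c)) * emeasure L A" by (simp add: mult.assoc)
    also have "ennreal c * ennreal (1 / c) = 1" using c(1) by (simp add: ennreal_mult'[symmetric])
    finally show "emeasure L A = emeasure (scale_measure (ennreal c) (chacon_mu_single I)) A" by simp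
  qed
  then show ?thesis
    unfolding good_block_def using c(1) I power_measure_axioms
    by (intro conjI exI[of _ "chacon_mu_single I"] exI[of _ c]) auto
qed

lemma (in ergodic_power) good_block_quasi_graph:
  assumes I: "card I > 1"
    and nh: "\<And>S. S \<subseteq> I \<Longrightarrow> S \<noteq> {} \<Longrightarrow> S \<noteq> I \<Longrightarrow> AE x in L. \<forall>\<^sub>F n in sequentially. \<not> hit S n x"
  shows "good_block I L"
proof -
  have ne: "I \<noteq> {}" using I by auto
  obtain n where n: "emeasure L (Gs n) \<noteq> 0" using Gs_pos[OF ne nh] by blast
  obtain x0 where x0: "x0 \<in> Gs n" "AE y in L. \<exists>t. pT I (\<lambda>_. t) y \<in> Gs n \<and>
     (\<forall>m\<ge>Suc n. \<forall>i\<in>I. del m (pT I (\<lambda>_. t) y) i = del m x0 i)"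
    using reference_point[OF ne n] by blast
  obtain \<nu> and c :: real where c: "c > 0" "L = scale_measure (ennreal c) \<nu>"
    "\<nu> = scale_measure (ennreal (1 / c)) L" "quasi_graph_measure I \<nu>"
    using quasi_graph_measure_L[OF ne x0] by blast
  have "card I \<noteq> 1" using I by simp
  moreover have "radon_measure_on (chacon_pow_top I) \<nu>"
    unfolding c(3) by (rule power_measure.radon[OF power_measure_scale[OF power_measure_axioms]])
  moreover have "invariant_measure (chacon_pow_T I) \<nu>"
    using ergodic_measure_scale[OF erg, of "ennreal (1 / c)"] c(3) by (simp add: ergodic_measure_def)
  ultimately show ?thesis
    unfolding good_block_def quasi_graph_radon_measure_def using c(1,2,4) power_measure_axioms by blast
qed

text \<open>Induction on the number of coordinates: split off S as long as hits for some nontrivial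
  S recur, and stop with a single coordinate or a quasi-graph. The product formula is stated on
  boxes only, where it composes by multiplication; the gluing of blocks is done once,
  afterwards.\<close>

lemma ergodic_power_decompose:
  assumes "ergodic_power I L" "I \<noteq> {}"
  shows "\<exists>P \<Lambda>. partition_on I P \<and> (\<forall>B\<in>P. good_block B (\<Lambda> B)) \<and>
    (\<forall>n f. (\<forall>i\<in>I. f i \<in> chacon_F n) \<longrightarrow> emeasure L (pbox I n f) = (\<Prod>B\<in>P. emeasure (\<Lambda> B) (pbox B n f)))"
  using assms
proof (induction "card I" arbitrary: I L rule: less_induct)
  case less
  interpret ergodic_power I L by fact
  have whole: ?case if "good_block I L"
    using that less.prems(2) by (intro exI[of _ "{I}"] exI[of _ "\<lambda>_. L"]) (auto simp: partition_on_def)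
  show ?case
  proof (cases "card I = 1")
    case True
    then obtain i where "I = {i}" by (rule card_1_singletonE)
    then show ?thesis using whole good_block_single by blast
  next
    case False
    have cI: "card I > 1" using False less.prems(2) finI by (metis card_0_eq less_one nat_neq_iff)
    show ?thesis
    proof (cases "\<exists>S. S \<subseteq> I \<and> S \<noteq> {} \<and> S \<noteq> I \<and> (AE x in L. \<exists>\<^sub>F n in sequentially. hit S n x)")
      case True
      then obtain S where S: "S \<subseteq> I" "S \<noteq> {}" "S \<noteq> I" "AE x in L. \<exists>\<^sub>F n in sequentially. hit S n x" by blast
      have "scl (e S) 1" by (rule scl_e[OF S(1,2,4)])
      then have inv: "scl (\<lambda>i. if i \<in> S then 1 else 0) 1"
        using scl_cong[of "e S" "\<lambda>i. if i \<in> S then 1 else 0" 1] by (simp add: e_def[OF S(1,2,4)])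
      obtain L1 L2 where L12: "ergodic_power S L1" "ergodic_power (I - S) L2"
        "\<And>n f. \<forall>i\<in>I. f i \<in> chacon_F n \<Longrightarrow>
          emeasure L (pbox I n f) = emeasure L1 (pbox S n f) * emeasure L2 (pbox (I - S) n f)"
        using split_product[OF S(1) inv] by blast
      have ne: "I - S \<noteq> {}" using S by auto
      have "card S < card I" using S finI by (intro psubset_card_mono) auto
      from less.hyps[OF this L12(1) S(2)]
      obtain P1 \<Lambda>1 where 1: "partition_on S P1" "\<forall>B\<in>P1. good_block B (\<Lambda>1 B)"
        "\<And>n f. (\<forall>i\<in>S. f i \<in> chacon_F n) \<Longrightarrow> emeasure L1 (pbox S n f) = (\<Prod>B\<in>P1. emeasure (\<Lambda>1 B) (pbox B n f))"
        by blast
      have "card (I - S) < card I" using S finI by (intro psubset_card_mono) auto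
      from less.hyps[OF this L12(2) ne]
      obtain P2 \<Lambda>2 where 2: "partition_on (I - S) P2" "\<forall>B\<in>P2. good_block B (\<Lambda>2 B)"
        "\<And>n f. (\<forall>i\<in>I - S. f i \<in> chacon_F n) \<Longrightarrow> emeasure L2 (pbox (I - S) n f) = (\<Prod>B\<in>P2. emeasure (\<Lambda>2 B) (pbox B n f))"
        by blast
      have P12: "P1 \<inter> P2 = {}"
      proof (rule ccontr)
        assume "P1 \<inter> P2 \<noteq> {}"
        then obtain B where B: "B \<in> P1" "B \<in> P2" by blast
        then have "B \<subseteq> S" "B \<subseteq> I - S" "B \<noteq> {}"
          using 1(1) 2(1) by (auto simp: partition_on_def)
        then show False by blast
      qed
      have fS: "finite S" "finite (I - S)" using S(1) finI finite_subset by auto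
      have fP: "finite P1" "finite P2"
        using finite_elements[OF fS(1) 1(1)] finite_elements[OF fS(2) 2(1)] by auto
      have IS: "S \<union> (I - S) = I" using S(1) by auto
      have "disjoint (P1 \<union> P2)"
        using 1(1) 2(1) by (intro disjoint_union) (auto simp: partition_on_def)
      then have part: "partition_on I (P1 \<union> P2)"
        using 1(1) 2(1) IS by (auto simp: partition_on_def)
      let ?\<Lambda> = "\<lambda>B. if B \<in> P1 then \<Lambda>1 B else \<Lambda>2 B"
      have "emeasure L (pbox I n f) = (\<Prod>B\<in>P1 \<union> P2. emeasure (?\<Lambda> B) (pbox B n f))"
        if f: "\<forall>i\<in>I. f i \<in> chacon_F n" for n f
      proof -
        have "(\<Prod>B\<in>P2. emeasure (\<Lambda>2 B) (pbox B n f)) = (\<Prod>B\<in>P2. emeasure (?\<Lambda> B) (pbox B n f))"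
          using P12 by (intro prod.cong) auto
        moreover have "(\<Prod>B\<in>P1. emeasure (\<Lambda>1 B) (pbox B n f)) = (\<Prod>B\<in>P1. emeasure (?\<Lambda> B) (pbox B n f))"
          by (intro prod.cong) auto
        moreover have "emeasure L1 (pbox S n f) = (\<Prod>B\<in>P1. emeasure (\<Lambda>1 B) (pbox B n f))"
          "emeasure L2 (pbox (I - S) n f) = (\<Prod>B\<in>P2. emeasure (\<Lambda>2 B) (pbox B n f))"
          using f S(1) by (auto intro!: 1(3) 2(3))
        ultimately show ?thesis
          unfolding L12(3)[OF f] prod.union_disjoint[OF fP P12] by simp
      qed
      moreover have "\<forall>B\<in>P1 \<union> P2. good_block B (?\<Lambda> B)" using 1(2) 2(2) by auto
      ultimately show ?thesis
        using part by (intro exI[of _ "P1 \<union> P2"] exI[of _ ?\<Lambda>] conjI) auto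
    next
      case False
      have "AE x in L. \<forall>\<^sub>F n in sequentially. \<not> hit S n x" if S: "S \<subseteq> I" "S \<noteq> {}" "S \<noteq> I" for S
        using io_dichotomy[of "\<lambda>n c. is_a I S n c \<or> is_b I S n c"] False S
        unfolding hit_def by blast
      then show ?thesis using whole good_block_quasi_graph[OF cI] by blast
    qed
  qed
qed

text \<open>Gluing pulls a box of the power back to the product of its block boxes, whose mass is
  the product of masses; boxes determine the measure.\<close>

lemma block_product_eq:
  assumes L: "power_measure I L" and P: "partition_on I P"
    and \<Lambda>: "\<And>B. B \<in> P \<Longrightarrow> power_measure B (\<Lambda> B)"
    and eq: "\<And>n f. (\<forall>i\<in>I. f i \<in> chacon_F n) \<Longrightarrow>
       emeasure L (pbox I n f) = (\<Prod>B\<in>P. emeasure (\<Lambda> B) (pbox B n f))"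
  shows "L = block_product I P \<Lambda>"
proof -
  interpret L: power_measure I L by fact
  have finP: "finite P" by (rule finite_elements[OF L.finI P])
  \<comment> \<open>\<open>product_sigma_finite\<close> asks for a sigma-finite measure at every
    index, so a trivial one is put at the indices outside P.\<close>
  define \<Lambda>' where "\<Lambda>' B = (if B \<in> P then \<Lambda> B else count_space {})" for B
  have sf: "sigma_finite_measure (\<Lambda>' B)" for B
  proof (cases "B \<in> P")
    case True
    then show ?thesis using power_measure.sigma_finite_L[OF \<Lambda>] by (simp add: \<Lambda>'_def)
  next
    case False
    then show ?thesis by (simp add: \<Lambda>'_def sigma_finite_measure_count_space_finite)
  qed
  interpret P: product_sigma_finite \<Lambda>'
    using sf by (simp add: product_sigma_finite_def)
  have PM: "PiM P \<Lambda> = PiM P \<Lambda>'" by (intro PiM_cong) (auto simp: \<Lambda>'_def)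
  have \<Lambda>'P: "power_measure B (\<Lambda>' B)" if "B \<in> P" for B using \<Lambda>[OF that] that by (simp add: \<Lambda>'_def)
  have the_block: "(THE B'. B' \<in> P \<and> i \<in> B') = B" if "B \<in> P" "i \<in> B" for B i
    using P that by (intro the_equality) (auto simp: partition_on_def disjoint_def)
  have PI: "\<Union>P = I" using P by (simp add: partition_on_def)
  let ?glue = "\<lambda>\<omega>. \<lambda>i\<in>I. \<omega> (THE B. B \<in> P \<and> i \<in> B) i"
  have sp: "space (PiM P \<Lambda>') = PiE P pS"
    using power_measure.spaceL[OF \<Lambda>'P] by (auto simp: space_PiM intro!: PiE_cong)
  have glue: "?glue \<omega> i = \<omega> B i" if "B \<in> P" "i \<in> B" for \<omega> B i
    using the_block[OF that] that PI by auto
  have pre: "?glue -` pbox I n f \<inter> space (PiM P \<Lambda>') = PiE P (\<lambda>B. pbox B n f)" for n f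
  proof (intro equalityI subsetI)
    fix \<omega> assume w: "\<omega> \<in> ?glue -` pbox I n f \<inter> space (PiM P \<Lambda>')"
    have "\<omega> B \<in> pbox B n f" if B: "B \<in> P" for B
    proof -
      have wB: "\<omega> B \<in> pS B" using w B sp by auto
      have "\<omega> B i \<in> cX n \<and> co n (\<omega> B i) = f i" if i: "i \<in> B" for i
      proof -
        have iI: "i \<in> I" using B i PI by auto
        have "?glue \<omega> \<in> pbox I n f" using w by simp
        then have "?glue \<omega> i \<in> cX n \<and> co n (?glue \<omega> i) = f i" using iI unfolding mem_box_iff by blast
        then show ?thesis unfolding glue[OF B i] .
      qed
      then show ?thesis using pS_extensional[OF wB] by (simp add: mem_box_iff)
    qed
    then show "\<omega> \<in> PiE P (\<lambda>B. pbox B n f)" using w sp by (auto simp: PiE_iff)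
  next
    fix \<omega> assume w: "\<omega> \<in> PiE P (\<lambda>B. pbox B n f)"
    have "?glue \<omega> i \<in> cX n \<and> co n (?glue \<omega> i) = f i" if i: "i \<in> I" for i
    proof -
      obtain B where B: "B \<in> P" "i \<in> B" using i PI by auto
      have "\<omega> B \<in> pbox B n f" using w B by auto
      then show ?thesis unfolding glue[OF B] using B by (auto simp: mem_box_iff)
    qed
    then have "?glue \<omega> \<in> pbox I n f" unfolding mem_box_iff by auto
    moreover have "\<omega> \<in> space (PiM P \<Lambda>')" using w box_sub sp by (fastforce simp: PiE_iff)
    ultimately show "\<omega> \<in> ?glue -` pbox I n f \<inter> space (PiM P \<Lambda>')" by simp
  qed
  have bs: "pbox B n f \<in> sets (\<Lambda>' B)" if "B \<in> P" "\<forall>i\<in>I. f i \<in> chacon_F n" for B n f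
    using that PI power_measure.setsL[OF \<Lambda>'P[OF that(1)]] power_measure.finI[OF \<Lambda>'P[OF that(1)]]
    by (auto intro!: box_sets)
  have meas: "?glue \<in> measurable (PiM P \<Lambda>') (pB I)"
  proof (rule measurable_sigma_sets[OF sets_pB[OF L.finI, of "\<lambda>_. 0"]])
    show "boxes I (\<lambda>_. 0) \<subseteq> Pow (pS I)" using Union_boxes[OF L.finI, of "\<lambda>_. 0"] by auto
    show "?glue \<in> space (PiM P \<Lambda>') \<rightarrow> pS I"
    proof
      fix \<omega> assume w: "\<omega> \<in> space (PiM P \<Lambda>')"
      have "?glue \<omega> i \<in> chacon_space" if i: "i \<in> I" for i
      proof -
        obtain B where B: "B \<in> P" "i \<in> B" using i PI by auto
        have "\<omega> B \<in> pS B" using w B sp by auto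
        then show ?thesis unfolding glue[OF B] using B by (auto simp: pS_def)
      qed
      then show "?glue \<omega> \<in> pS I" unfolding pS_def by auto
    qed
    fix A assume "A \<in> boxes I (\<lambda>_. 0)"
    then obtain n f where A: "A = pbox I n f" "\<forall>i\<in>I. f i \<in> chacon_F n" by (auto simp: boxes_def)
    show "?glue -` A \<inter> space (PiM P \<Lambda>') \<in> sets (PiM P \<Lambda>')"
      unfolding A(1) pre using finP bs[OF _ A(2)] by (intro sets_PiM_I_finite)
  qed
  show ?thesis
    unfolding block_product_def PM
  proof (rule box_measure_eqI[OF L.finI, where v = "\<lambda>_. 0"])
    fix n f assume f: "\<forall>i\<in>I. f i \<in> chacon_F n \<and> f i + 0 \<in> chacon_F n"
    then have f': "\<forall>i\<in>I. f i \<in> chacon_F n" by simp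
    have "emeasure (distr (PiM P \<Lambda>') (pB I) ?glue) (pbox I n f) = emeasure (PiM P \<Lambda>') (PiE P (\<lambda>B. pbox B n f))"
      using emeasure_distr[OF meas box_sets[OF L.finI f']] unfolding pre .
    also have "\<dots> = (\<Prod>B\<in>P. emeasure (\<Lambda>' B) (pbox B n f))"
      using finP bs[OF _ f'] by (intro P.emeasure_PiM)
    also have "\<dots> = emeasure L (pbox I n f)"
      unfolding eq[OF f'] by (intro prod.cong) (auto simp: \<Lambda>'_def)
    finally show "emeasure L (pbox I n f) = emeasure (distr (PiM P \<Lambda>') (pB I) ?glue) (pbox I n f)" by simp
    show "emeasure L (pbox I n f) \<noteq> \<infinity>" by (rule L.finL[OF f'])
  qed (simp_all add: L.setsL)
qed

theorem theorem5p3: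
  fixes d :: nat and L :: "(nat \<Rightarrow> cf_point) measure"
  assumes "d > 1"
    and "radon_measure_on (chacon_pow_top {1..d}) L"
    and "emeasure L (space L) \<noteq> 0"
    and "ergodic_measure (chacon_pow_T {1..d}) L"
  shows "\<exists>P \<Lambda>. partition_on {1..d} P \<and> L = block_product {1..d} P \<Lambda> \<and>
    (\<forall>B\<in>P. \<exists>\<nu> (c::real). c > 0 \<and> \<Lambda> B = scale_measure (ennreal c) \<nu> \<and>
       (card B = 1 \<longrightarrow> \<nu> = chacon_mu_single B) \<and>
       (card B > 1 \<longrightarrow> quasi_graph_radon_measure B \<nu> \<and> invariant_measure (chacon_pow_T B) \<nu>))"
proof -
  have E: "ergodic_power {1..d} L"
  proof
    show "sets L = sets (pB {1..d})" using assms(2) by (simp add: radon_measure_on_def)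
    fix n f assume "\<forall>i\<in>{1..d}. f i \<in> chacon_F n"
    then have "compactin (chacon_pow_top {1..d}) (pbox {1..d} n f)" by (rule compactin_box)
    then show "emeasure L (pbox {1..d} n f) \<noteq> \<infinity>" using assms(2) by (auto simp: radon_measure_on_def)
  qed (use assms in auto)
  have "{1..d} \<noteq> {}" using assms(1) by simp
  from ergodic_power_decompose[OF E this]
  obtain P \<Lambda> where P: "partition_on {1..d} P" "\<forall>B\<in>P. good_block B (\<Lambda> B)"
    "\<And>n f. (\<forall>i\<in>{1..d}. f i \<in> chacon_F n) \<Longrightarrow>
       emeasure L (pbox {1..d} n f) = (\<Prod>B\<in>P. emeasure (\<Lambda> B) (pbox B n f))"
    by blast
  have "L = block_product {1..d} P \<Lambda>"
    using P by (intro block_product_eq ergodic_power.axioms(1)[OF E]) (auto simp: good_block_def)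
  moreover have "\<forall>B\<in>P. \<exists>\<nu> (c::real). c > 0 \<and> \<Lambda> B = scale_measure (ennreal c) \<nu> \<and>
       (card B = 1 \<longrightarrow> \<nu> = chacon_mu_single B) \<and>
       (card B > 1 \<longrightarrow> quasi_graph_radon_measure B \<nu> \<and> invariant_measure (chacon_pow_T B) \<nu>)"
    using P(2) unfolding good_block_def by blast
  ultimately show ?thesis using P(1) by blast
qed

end
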